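(* Let $k$ be an algebraically closed field of characteristic $p>0$, let $A=k[x_0,\dots,x_N]$ be graded by $\deg(x_i)=q_i\in\mathbb{Z}_{>0}$, put $d=q_0+\cdots+q_N$, and let $x^{\alpha_1},\dots,x^{\alpha_m}$ be all monomials of degree $d$. For $b,c\in k^m$ put $$G(b)=\sum_{i=1}^mb_ix^{\alpha_i}\in A,\qquad \widetilde{G}(b,c)=\sum_{i=1}^m([b_i]+p[c_i])x^{\alpha_i}\in W(k)[x_0,\dots,x_N],$$ where $[\cdot]$ is the Teichmüller lift. Then for every nonzero $b\in k^m$, $$\operatorname{ns}(G(b))=\min\{\operatorname{ns}(\widetilde{G}(b,c))\mid c\in k^m\}.$$
   Context: Non-splitting index in characteristic $p$. For $0\ne f\in A$ and $n\ge1$ put $D_n=(1-\frac{2}{p^n})\operatorname{div}(f)$ and let $W_n(A)(pD_n)\subset W_n(\operatorname{Frac}A)$ be the $W_n(A)$-submodule of those Witt vectors $(a_0,\dots,a_{n-1})$ with $f^{p^{i+1}-1}a_i\in A$ for $0\le i\le n-2$ and $f^{p^n-2}a_{n-1}\in A$. The pair $(A,D_n)$ is $n$-quasi-$F$-split if there is a $W_n(A)$-module homomorphism $\varphi:F_*W_n(A)(pD_n)\to A$ with $\varphi(F_*1)=1$ ($F_*$ is restriction of scalars along the Witt vector Frobenius, $A$ is a $W_n(A)$-module via restriction). Define $\operatorname{ns}(f):=\inf\{n\ge1\mid(A,D_n)\text{ is not }n\text{-quasi-}F\text{-split}\}$, with $\inf\emptyset=\infty$. Non-splitting index in mixed characteristic.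 Let $\widetilde{A}=W(k)[x_0,\dots,x_N]$ with Frobenius lift $\phi$ given by the Witt vector Frobenius on $W(k)$ and $\phi(x_j)=x_j^p$. For $\widetilde f\in\widetilde A$ with nonzero reduction mod $p$, put $\Delta(\widetilde f)=(\widetilde f^p-\phi(\widetilde f))/p$ and, for $l\ge1$, $$\widetilde f_l=\widetilde f^{\,p-2}\bigl(\widetilde f^{\,p^2-2p}\Delta(\widetilde f)\bigr)^{1+p+\cdots+p^{l-2}}\qquad(\widetilde f_1=\widetilde f^{\,p-2}).$$ Let $\mathfrak{m}^{[p^l]}=(p,x_0^{p^l},\dots,x_N^{p^l})$. Then $\operatorname{ns}(\widetilde f)=n<\infty$ if and only if $\widetilde f_i\notin\mathfrak{m}^{[p^i]}$ and $\widetilde f\widetilde f_i\in\mathfrak{m}^{[p^i]}$ for all $1\le i\le n-1$, and $\widetilde f_n\in\mathfrak{m}^{[p^n]}$ (there is at most one such $n\geq 1$); if no such $n$ exists, $\operatorname{ns}(\widetilde f)=\infty$. *)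

theory Defs
  imports
    "HOL-Analysis.Finite_Cartesian_Product"
    "HOL-Library.Poly_Mapping"
    "HOL-Library.Extended_Nat"
    "HOL-Computational_Algebra.Polynomial"
    "HOL-Computational_Algebra.Fraction_Field"
begin

section \<open>Multivariate polynomials\<close>

text \<open>
  A polynomial is a finitely supported function from exponent vectors to coefficients;
  its ring structure is the convolution product of \<^theory>\<open>HOL-Library.Poly_Mapping\<close>.
\<close>

type_synonym 'v monomial = "'v \<Rightarrow>\<^sub>0 nat"
type_synonym ('v, 'r) mpoly = "'v monomial \<Rightarrow>\<^sub>0 'r"

abbreviation lookup :: "('a \<Rightarrow>\<^sub>0 'b::zero) \<Rightarrow> 'a \<Rightarrow> 'b" where
  "lookup \<equiv> Poly_Mapping.lookup"

abbreviation keys :: "('a \<Rightarrow>\<^sub>0 'b::zero) \<Rightarrow> 'a set" where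
  "keys \<equiv> Poly_Mapping.keys"

abbreviation single :: "'a \<Rightarrow> 'b \<Rightarrow> ('a \<Rightarrow>\<^sub>0 'b::zero)" where
  "single \<equiv> Poly_Mapping.single"

definition Var :: "'v \<Rightarrow> ('v, 'r::comm_semiring_1) mpoly" where
  "Var v = single (single v 1) 1"

definition weighted_degree :: "('v::finite \<Rightarrow> nat) \<Rightarrow> 'v monomial \<Rightarrow> nat" where
  "weighted_degree q \<mu> = (\<Sum>v\<in>UNIV. q v * lookup \<mu> v)"

definition insertion :: "('v \<Rightarrow> 'r::comm_ring_1) \<Rightarrow> ('v, int) mpoly \<Rightarrow> 'r" where
  "insertion a P = (\<Sum>\<mu>\<in>keys P. of_int (lookup P \<mu>) * (\<Prod>v\<in>keys \<mu>. a v ^ lookup \<mu> v))"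

lemma CHAR_poly_mapping [simp]:
  "CHAR('a::monoid_add \<Rightarrow>\<^sub>0 'b::semiring_1) = CHAR('b)"
proof (rule CHAR_eqI)
  show "of_nat CHAR('b) = (0 :: 'a \<Rightarrow>\<^sub>0 'b)"
    by (metis of_nat_CHAR single_of_nat single_zero)
  fix n assume "of_nat n = (0 :: 'a \<Rightarrow>\<^sub>0 'b)"
  then have "lookup (of_nat n :: 'a \<Rightarrow>\<^sub>0 'b) 0 = 0" by simp
  then show "CHAR('b) dvd n" by (simp add: lookup_of_nat of_nat_eq_0_iff_char_dvd)
qed

instance poly_mapping :: (monoid_add, semiring_prime_char) semiring_prime_char
  by (rule semiring_prime_charI) auto
instance poly_mapping :: (comm_monoid_add, comm_semiring_prime_char) comm_semiring_prime_char
  ..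
instance poly_mapping :: (comm_monoid_add, comm_ring_prime_char) comm_ring_prime_char
  ..
instance poly_mapping :: ("{ordered_cancel_comm_monoid_add, linorder}", idom_prime_char) idom_prime_char
  ..

lemma CHAR_fract [simp]: "CHAR('a::idom fract) = CHAR('a)"
  by (rule CHAR_eqI)
    (auto simp: of_nat_fract Zero_fract_def eq_fract of_nat_eq_0_iff_char_dvd)

instance fract :: (idom_prime_char) field_prime_char
  by (rule field_prime_charI') (simp add: prime_gt_0_nat)

lemma sum_single: "(\<Sum>\<mu>\<in>keys P. single \<mu> (lookup P \<mu>)) = (P :: 'a \<Rightarrow>\<^sub>0 'b::comm_monoid_add)"
  by (rule poly_mapping_eqI)
    (auto simp: lookup_sum lookup_single when_def in_keys_iff sum.delta)

lemma insertion_superset: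
  assumes "finite S" "keys P \<subseteq> S"
  shows "insertion a P = (\<Sum>\<mu>\<in>S. of_int (lookup P \<mu>) * (\<Prod>v\<in>keys \<mu>. a v ^ lookup \<mu> v))"
  unfolding insertion_def using assms
  by (intro sum.mono_neutral_left) (auto simp: in_keys_iff)

lemma insertion_add: "insertion a (P + Q) = insertion a P + insertion a Q"
proof -
  let ?S = "keys P \<union> keys Q"
  have "keys (P + Q) \<subseteq> ?S" by (rule keys_add)
  then show ?thesis
    by (simp add: insertion_superset[of ?S] lookup_add sum.distrib ring_distribs)
qed

lemma insertion_0 [simp]: "insertion a 0 = 0"
  by (simp add: insertion_def)

lemma insertion_uminus: "insertion a (- P) = - insertion a P"
  by (metis add_eq_0_iff2 insertion_0 insertion_add neg_eq_iff_add_eq_0)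

lemma insertion_diff: "insertion a (P - Q) = insertion a P - insertion a Q"
  by (metis diff_conv_add_uminus insertion_add insertion_uminus)

lemma insertion_sum: "insertion a (sum f S) = (\<Sum>s\<in>S. insertion a (f s))"
  by (induction S rule: infinite_finite_induct) (auto simp: insertion_add)

definition mono_eval :: "('v \<Rightarrow> 'r::comm_ring_1) \<Rightarrow> 'v monomial \<Rightarrow> 'r" where
  "mono_eval a \<mu> = (\<Prod>v\<in>keys \<mu>. a v ^ lookup \<mu> v)"

lemma mono_eval_superset:
  assumes "finite S" "keys \<mu> \<subseteq> S"
  shows "mono_eval a \<mu> = (\<Prod>v\<in>S. a v ^ lookup \<mu> v)"
  unfolding mono_eval_def using assms
  by (intro prod.mono_neutral_left) (auto simp: in_keys_iff)

lemma mono_eval_add: "mono_eval a (\<mu> + \<nu>) = mono_eval a \<mu> * mono_eval a \<nu>"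
proof -
  let ?S = "keys \<mu> \<union> keys \<nu>"
  have "keys (\<mu> + \<nu>) \<subseteq> ?S" by (rule keys_add)
  then show ?thesis
    by (simp add: mono_eval_superset[of ?S] lookup_add prod.distrib power_add)
qed

lemma insertion_single: "insertion a (single \<mu> c) = of_int c * mono_eval a \<mu>"
  by (cases "c = 0") (auto simp: insertion_def mono_eval_def)

lemma insertion_mult: "insertion a (P * Q) = insertion a P * insertion a Q"
proof -
  have "P * Q = (\<Sum>\<mu>\<in>keys P. single \<mu> (lookup P \<mu>)) * (\<Sum>\<nu>\<in>keys Q. single \<nu> (lookup Q \<nu>))"
    by (simp only: sum_single)
  also have "\<dots> = (\<Sum>\<mu>\<in>keys P. \<Sum>\<nu>\<in>keys Q. single (\<mu> + \<nu>) (lookup P \<mu> * lookup Q \<nu>))"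
    by (simp add: sum_product mult_single)
  finally have "insertion a (P * Q) =
      (\<Sum>\<mu>\<in>keys P. \<Sum>\<nu>\<in>keys Q. (of_int (lookup P \<mu>) * mono_eval a \<mu>) * (of_int (lookup Q \<nu>) * mono_eval a \<nu>))"
    by (simp add: insertion_sum insertion_single mono_eval_add algebra_simps)
  also have "\<dots> = insertion a P * insertion a Q"
    unfolding insertion_def by (simp add: sum_product mono_eval_def)
  finally show ?thesis .
qed

lemma insertion_1 [simp]: "insertion a 1 = 1"
  by (simp add: insertion_def)

lemma insertion_power: "insertion a (P ^ n) = insertion a P ^ n"
  by (induction n) (auto simp: insertion_mult)

lemma insertion_prod: "insertion a (prod f S) = (\<Prod>s\<in>S. insertion a (f s))"
  by (induction S rule: infinite_finite_induct) (auto simp: insertion_mult)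

lemma insertion_of_nat [simp]: "insertion a (of_nat n) = of_nat n"
  by (induction n) (auto simp: insertion_add)

lemma insertion_of_int [simp]: "insertion a (of_int n) = of_int n"
  by (cases n) (auto simp: insertion_uminus insertion_add insertion_diff)

lemma insertion_Var [simp]: "insertion a (Var v) = a v"
  by (simp add: Var_def insertion_single mono_eval_def)

lemma insertion_insertion: "insertion a (insertion b P) = insertion (\<lambda>v. insertion a (b v)) P"
  unfolding insertion_def[of b] insertion_def[of "\<lambda>v. insertion a (b v)"]
  by (simp add: insertion_sum insertion_mult insertion_prod insertion_power)

lemma Var_power: "Var v ^ e = single (single v e) 1"
  by (induction e) (auto simp: Var_def mult_single simp flip: single_add)

lemma prod_single_one: "(\<Prod>s\<in>S. single (f s) (1::int)) = single (\<Sum>s\<in>S. f s :: 'v monomial) 1"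
  by (induction S rule: infinite_finite_induct) (auto simp: mult_single)

lemma insertion_Var_id: "insertion Var P = (P :: ('v, int) mpoly)"
proof -
  have "mono_eval Var \<mu> = (single \<mu> 1 :: ('v, int) mpoly)" for \<mu>
    by (simp add: mono_eval_def Var_power prod_single_one sum_single)
  moreover have "of_int c * single \<mu> 1 = (single \<mu> c :: ('v, int) mpoly)" for c \<mu>
    using mult_single[of 0 c \<mu> "1::int"] by (simp add: single_of_int[symmetric])
  ultimately have "insertion Var P = (\<Sum>\<mu>\<in>keys P. single \<mu> (lookup P \<mu>))"
    unfolding insertion_def mono_eval_def[symmetric] by (simp only:)
  then show ?thesis by (simp only: sum_single)
qed


section \<open>Universal Witt polynomials\<close>

definition ghost :: "nat \<Rightarrow> nat \<Rightarrow> (nat \<Rightarrow> 'r::comm_ring_1) \<Rightarrow> 'r" where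
  "ghost p n x = (\<Sum>i\<le>n. of_nat p ^ i * x i ^ (p ^ (n - i)))"

text \<open>
  For a sequence \<open>g\<close> of integral polynomials, \<open>ghost_inv p g\<close> is the sequence \<open>s\<close> with
  \<open>ghost p n s = g n\<close>. For the sequences used below all the coefficientwise divisions by
  \<open>p ^ n\<close> are exact (lemma \<open>ghost_ghost_inv\<close>).
\<close>

fun ghost_inv :: "nat \<Rightarrow> (nat \<Rightarrow> ('v, int) mpoly) \<Rightarrow> nat \<Rightarrow> ('v, int) mpoly" where
  "ghost_inv p g n = Poly_Mapping.map (\<lambda>c. c div int p ^ n)
     (g n - (\<Sum>i<n. of_nat p ^ i * ghost_inv p g i ^ (p ^ (n - i))))"

declare ghost_inv.simps [simp del]

definition witt_add_poly :: "nat \<Rightarrow> nat \<Rightarrow> (nat + nat, int) mpoly" where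
  "witt_add_poly p = ghost_inv p
     (\<lambda>n. ghost p n (\<lambda>i. Var (Inl i)) + ghost p n (\<lambda>i. Var (Inr i)))"

definition witt_mult_poly :: "nat \<Rightarrow> nat \<Rightarrow> (nat + nat, int) mpoly" where
  "witt_mult_poly p = ghost_inv p
     (\<lambda>n. ghost p n (\<lambda>i. Var (Inl i)) * ghost p n (\<lambda>i. Var (Inr i)))"

definition witt_neg_poly :: "nat \<Rightarrow> nat \<Rightarrow> (nat, int) mpoly" where
  "witt_neg_poly p = ghost_inv p (\<lambda>n. - ghost p n Var)"

definition wadd :: "nat \<Rightarrow> (nat \<Rightarrow> 'r::comm_ring_1) \<Rightarrow> (nat \<Rightarrow> 'r) \<Rightarrow> nat \<Rightarrow> 'r" where
  "wadd p x y n = insertion (case_sum x y) (witt_add_poly p n)"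

definition wmult :: "nat \<Rightarrow> (nat \<Rightarrow> 'r::comm_ring_1) \<Rightarrow> (nat \<Rightarrow> 'r) \<Rightarrow> nat \<Rightarrow> 'r" where
  "wmult p x y n = insertion (case_sum x y) (witt_mult_poly p n)"

definition wneg :: "nat \<Rightarrow> (nat \<Rightarrow> 'r::comm_ring_1) \<Rightarrow> nat \<Rightarrow> 'r" where
  "wneg p x n = insertion x (witt_neg_poly p n)"


subsection \<open>Integrality\<close>

lemma freshman_dvd:
  fixes a b :: "'r::comm_ring_1"
  assumes "prime p"
  shows "of_nat p dvd (a + b) ^ p - (a ^ p + b ^ p)"
proof -
  have p: "p > 0" using assms by (simp add: prime_gt_0_nat)
  have "(a + b) ^ p = (\<Sum>k\<le>p. of_nat (p choose k) * a ^ k * b ^ (p - k))"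
    by (rule binomial_ring)
  also have "{..p} = insert 0 (insert p {0<..<p})" using p by auto
  also have "(\<Sum>k\<in>insert 0 (insert p {0<..<p}). of_nat (p choose k) * a ^ k * b ^ (p - k))
      = b ^ p + a ^ p + (\<Sum>k\<in>{0<..<p}. of_nat (p choose k) * a ^ k * b ^ (p - k))"
    using p by (subst sum.insert, simp, simp)+ simp
  finally have "(a + b) ^ p - (a ^ p + b ^ p) =
      (\<Sum>k\<in>{0<..<p}. of_nat (p choose k) * a ^ k * b ^ (p - k))" by simp
  also have "of_nat p dvd \<dots>"
  proof (intro dvd_sum dvd_mult2)
    fix k assume "k \<in> {0<..<p}"
    then have "p dvd p choose k" using assms by (intro dvd_choose_prime) auto
    then show "(of_nat p :: 'r) dvd of_nat (p choose k)" by (metis dvdE dvd_triv_left of_nat_mult)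
  qed
  finally show ?thesis .
qed

lemma dvd_diff_power_prime:
  fixes a b :: "'r::comm_ring_1"
  assumes p: "prime p" and k: "k > 0" and d: "of_nat p ^ k dvd a - b"
  shows "of_nat p ^ Suc k dvd a ^ p - b ^ p"
proof -
  obtain c where c: "a = b + of_nat p ^ k * c"
    using d by (metis add_diff_cancel_left' add_diff_eq dvdE diff_add_cancel)
  have S: "of_nat p dvd (\<Sum>i<p. b ^ (p - Suc i) * a ^ i)"
  proof -
    have "of_nat p dvd a ^ i - b ^ i" for i
    proof -
      have "of_nat p dvd a - b" using d k by (meson dvd_power dvd_trans)
      moreover have "a - b dvd a ^ i - b ^ i" by (metis dvd_triv_left power_diff_sumr2)
      ultimately show ?thesis by (rule dvd_trans)
    qed
    then have "of_nat p dvd (\<Sum>i<p. b ^ (p - Suc i) * (a ^ i - b ^ i))"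
      by (intro dvd_sum dvd_mult)
    moreover have "(\<Sum>i<p. b ^ (p - Suc i) * (a ^ i - b ^ i)) =
        (\<Sum>i<p. b ^ (p - Suc i) * a ^ i) - (\<Sum>i<p. b ^ (p - Suc i) * b ^ i)"
      by (simp add: right_diff_distrib sum_subtractf)
    moreover have "(\<Sum>i<p. b ^ (p - Suc i) * b ^ i) = of_nat p * b ^ (p - 1)"
      by (simp flip: power_add)
    ultimately have "of_nat p dvd (\<Sum>i<p. b ^ (p - Suc i) * a ^ i) - of_nat p * b ^ (p - 1)"
      by simp
    then have "of_nat p dvd (\<Sum>i<p. b ^ (p - Suc i) * a ^ i) - of_nat p * b ^ (p - 1)
        + of_nat p * b ^ (p - 1)"
      by (rule dvd_add) simp
    then show ?thesis by simp
  qed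
  have "a ^ p - b ^ p = (a - b) * (\<Sum>i<p. b ^ (p - Suc i) * a ^ i)"
    by (rule power_diff_sumr2)
  then show ?thesis
    using mult_dvd_mono[OF d S] by (simp add: mult.commute)
qed

lemma dvd_diff_power_prime_power:
  fixes a b :: "'r::comm_ring_1"
  assumes p: "prime p" and d: "of_nat p dvd a - b"
  shows "of_nat p ^ Suc j dvd a ^ (p ^ j) - b ^ (p ^ j)"
proof (induction j)
  case 0
  then show ?case using d by simp
next
  case (Suc j)
  have "of_nat p ^ Suc (Suc j) dvd (a ^ (p ^ j)) ^ p - (b ^ (p ^ j)) ^ p"
    by (rule dvd_diff_power_prime[OF p _ Suc]) simp
  then show ?case by (simp add: power_mult[symmetric] mult.commute)
qed

definition frob :: "nat \<Rightarrow> ('v, int) mpoly \<Rightarrow> ('v, int) mpoly" where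
  "frob p = insertion (\<lambda>v. Var v ^ p)"

lemma frob_hom:
  "frob p (P + Q) = frob p P + frob p Q" "frob p (P - Q) = frob p P - frob p Q"
  "frob p (- P) = - frob p P"
  "frob p (P * Q) = frob p P * frob p Q" "frob p (P ^ n) = frob p P ^ n"
  "frob p (of_nat n) = of_nat n" "frob p (sum f S) = (\<Sum>s\<in>S. frob p (f s))"
  "frob p (Var v) = Var v ^ p"
  by (simp_all add: frob_def insertion_add insertion_diff insertion_uminus insertion_mult
      insertion_power insertion_sum)

lemma frob_lifts:
  assumes p: "prime p"
  shows "of_nat p dvd frob p P - P ^ p"
proof -
  define G where "G = {Q :: ('a, int) mpoly. of_nat p dvd frob p Q - Q ^ p}"
  have p0: "p > 0" using p by (simp add: prime_gt_0_nat)
  have add: "Q + R \<in> G" if "Q \<in> G" "R \<in> G" for Q R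
  proof -
    have "of_nat p dvd (frob p Q - Q ^ p) + (frob p R - R ^ p) - ((Q + R) ^ p - (Q ^ p + R ^ p))"
      using that freshman_dvd[OF p, of Q R] unfolding G_def mem_Collect_eq
      by (metis dvd_add dvd_diff)
    then show ?thesis by (simp add: G_def frob_hom algebra_simps)
  qed
  have diff: "Q - R \<in> G" if "Q \<in> G" "R \<in> G" for Q R
  proof -
    have "of_nat p dvd (frob p Q - Q ^ p) - (frob p R - R ^ p)
        + ((Q - R + R) ^ p - ((Q - R) ^ p + R ^ p))"
      using that freshman_dvd[OF p, of "Q - R" R] unfolding G_def mem_Collect_eq
      by (metis dvd_add dvd_diff)
    then show ?thesis by (simp add: G_def frob_hom algebra_simps)
  qed
  have mult: "Q * R \<in> G" if "Q \<in> G" "R \<in> G" for Q R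
  proof -
    have "frob p (Q * R) - (Q * R) ^ p =
        (frob p Q - Q ^ p) * frob p R + Q ^ p * (frob p R - R ^ p)"
      by (simp add: frob_hom algebra_simps power_mult_distrib)
    also have "of_nat p dvd \<dots>"
      using that unfolding G_def by (intro dvd_add) auto
    finally show ?thesis by (simp add: G_def)
  qed
  have one: "1 \<in> G" by (simp add: G_def frob_def)
  have zero: "0 \<in> G" using p0 by (simp add: G_def frob_def zero_power)
  have var: "Var v \<in> G" for v by (simp add: G_def frob_hom)
  have pow: "Q ^ n \<in> G" if "Q \<in> G" for Q n
    using that by (induction n) (auto intro: one mult)
  have pr: "(\<Prod>s\<in>S. h s) \<in> G" if "\<And>s. h s \<in> G" for h :: "'a \<Rightarrow> _" and S
    using that by (induction S rule: infinite_finite_induct) (auto intro: one mult)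
  have sm: "(\<Sum>s\<in>S. h s) \<in> G" if "\<And>s. h s \<in> G" for h :: "'a monomial \<Rightarrow> _" and S
    using that by (induction S rule: infinite_finite_induct) (auto intro: zero add)
  have nat: "of_nat n \<in> G" for n
    by (induction n) (auto intro: zero one add)
  have int: "of_int c \<in> G" for c
    using nat[of "nat c"] diff[OF zero nat[of "nat (- c)"]] by (cases "c \<ge> 0") auto
  have "insertion Var P \<in> G"
    unfolding insertion_def by (intro sm mult int pr pow var)
  then show ?thesis by (simp add: insertion_Var_id G_def)
qed

lemma of_nat_power_mult_lookup:
  "lookup (of_nat p ^ n * P) \<mu> = int p ^ n * lookup (P :: ('v, int) mpoly) \<mu>"
proof -
  have "of_nat p ^ n * P = single 0 (int p ^ n) * P"
    by (metis of_nat_power single_of_nat)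
  also have "\<dots> = Poly_Mapping.map ((*) (int p ^ n)) P"
    by (rule mult_map_scale_conv_mult[symmetric])
  finally show ?thesis by (simp add: Poly_Mapping.map.rep_eq when_def)
qed

lemma map_div_exact:
  assumes "of_nat p ^ n dvd (P :: ('v, int) mpoly)" "p > 0"
  shows "of_nat p ^ n * Poly_Mapping.map (\<lambda>c. c div int p ^ n) P = P"
proof -
  obtain Q where Q: "P = of_nat p ^ n * Q" using assms by blast
  show ?thesis
  proof (rule poly_mapping_eqI)
    fix \<mu>
    have "int p ^ n dvd lookup P \<mu>" unfolding Q of_nat_power_mult_lookup by simp
    then show "lookup (of_nat p ^ n * Poly_Mapping.map (\<lambda>c. c div int p ^ n) P) \<mu> = lookup P \<mu>"
      by (simp add: of_nat_power_mult_lookup Poly_Mapping.map.rep_eq when_def)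
  qed
qed

lemma of_nat_power_cancel:
  assumes "of_nat p ^ n * P = of_nat p ^ n * (Q :: ('v, int) mpoly)" "p > 0"
  shows "P = Q"
proof (rule poly_mapping_eqI)
  fix \<mu>
  have "int p ^ n * lookup P \<mu> = int p ^ n * lookup Q \<mu>"
    using assms(1) by (metis of_nat_power_mult_lookup)
  then show "lookup P \<mu> = lookup Q \<mu>" using assms(2) by simp
qed

definition ghostly :: "nat \<Rightarrow> (nat \<Rightarrow> ('v, int) mpoly) \<Rightarrow> bool" where
  "ghostly p g \<longleftrightarrow> (\<forall>n. of_nat p ^ Suc n dvd g (Suc n) - frob p (g n))"

lemma ghost_split: "ghost p n x = (\<Sum>i<n. of_nat p ^ i * x i ^ (p ^ (n - i))) + of_nat p ^ n * x n"
  by (simp add: ghost_def flip: lessThan_Suc_atMost)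

lemma ghost_Suc_dvd:
  assumes p: "prime p"
  shows "of_nat p ^ Suc n dvd (\<Sum>i\<le>n. of_nat p ^ i * s i ^ (p ^ (Suc n - i))) - frob p (ghost p n s)"
proof -
  have "frob p (ghost p n s) = (\<Sum>i\<le>n. of_nat p ^ i * frob p (s i) ^ (p ^ (n - i)))"
    by (simp add: ghost_def frob_hom)
  then have "(\<Sum>i\<le>n. of_nat p ^ i * s i ^ (p ^ (Suc n - i))) - frob p (ghost p n s) =
      (\<Sum>i\<le>n. of_nat p ^ i * (s i ^ (p ^ (Suc n - i)) - frob p (s i) ^ (p ^ (n - i))))"
    by (simp add: right_diff_distrib sum_subtractf)
  also have "of_nat p ^ Suc n dvd \<dots>"
  proof (rule dvd_sum)
    fix i assume i: "i \<in> {..n}"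
    have "of_nat p dvd s i ^ p - frob p (s i)"
      using frob_lifts[OF p, of "s i"] by (metis dvd_minus_iff minus_diff_eq)
    from dvd_diff_power_prime_power[OF p this, of "n - i"]
    have *: "of_nat p ^ Suc (n - i) dvd s i ^ (p ^ (Suc n - i)) - frob p (s i) ^ (p ^ (n - i))"
      using i by (simp add: power_mult[symmetric] Suc_diff_le)
    have "of_nat p ^ Suc n = of_nat p ^ i * (of_nat p ^ Suc (n - i) :: ('a, int) mpoly)"
      using i by (simp flip: power_add power_Suc)
    then show "of_nat p ^ Suc n dvd
        of_nat p ^ i * (s i ^ (p ^ (Suc n - i)) - frob p (s i) ^ (p ^ (n - i)))"
      using mult_dvd_mono[OF dvd_refl *] by metis
  qed
  finally show ?thesis .
qed

lemma ghost_ghost_inv: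
  assumes p: "prime p" and g: "ghostly p g"
  shows "ghost p n (ghost_inv p g) = g n"
proof (induction n rule: less_induct)
  case (less n)
  have p0: "p > 0" using p by (simp add: prime_gt_0_nat)
  let ?R = "\<Sum>i<n. of_nat p ^ i * ghost_inv p g i ^ (p ^ (n - i))"
  have "of_nat p ^ n dvd g n - ?R"
  proof (cases n)
    case 0
    then show ?thesis by simp
  next
    case (Suc m)
    have "of_nat p ^ Suc m dvd g (Suc m) - frob p (g m)"
      using g by (simp add: ghostly_def)
    moreover have "of_nat p ^ Suc m dvd
        (\<Sum>i\<le>m. of_nat p ^ i * ghost_inv p g i ^ (p ^ (Suc m - i))) - frob p (g m)"
      using ghost_Suc_dvd[OF p, of m "ghost_inv p g"] less[of m] Suc by simp
    ultimately show ?thesis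
      unfolding Suc lessThan_Suc_atMost by (metis (no_types, lifting) dvd_diff diff_diff_eq2 diff_add_cancel)
  qed
  from map_div_exact[OF this p0] have "of_nat p ^ n * ghost_inv p g n = g n - ?R"
    by (subst ghost_inv.simps)
  then show ?case by (simp add: ghost_split)
qed

lemma ghostly_ghost: "prime p \<Longrightarrow> ghostly p (\<lambda>n. ghost p n (s :: nat \<Rightarrow> ('v, int) mpoly))"
  unfolding ghostly_def
proof
  fix n assume p: "prime p"
  have "ghost p (Suc n) s - frob p (ghost p n s) =
      ((\<Sum>i\<le>n. of_nat p ^ i * s i ^ (p ^ (Suc n - i))) - frob p (ghost p n s))
      + of_nat p ^ Suc n * s (Suc n)"
    unfolding ghost_split[of p "Suc n"] lessThan_Suc_atMost by simp
  also have "of_nat p ^ Suc n dvd \<dots>"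
    by (intro dvd_add ghost_Suc_dvd p dvd_triv_left)
  finally show "of_nat p ^ Suc n dvd ghost p (Suc n) s - frob p (ghost p n s)" .
qed

lemma ghostly_add: "ghostly p g \<Longrightarrow> ghostly p h \<Longrightarrow> ghostly p (\<lambda>n. g n + h n)"
  unfolding ghostly_def frob_hom by (metis add_diff_add dvd_add)

lemma ghostly_uminus: "ghostly p g \<Longrightarrow> ghostly p (\<lambda>n. - g n)"
  unfolding ghostly_def frob_hom by (metis dvd_minus_iff minus_diff_minus)

lemma ghostly_mult: "ghostly p g \<Longrightarrow> ghostly p h \<Longrightarrow> ghostly p (\<lambda>n. g n * h n)"
  unfolding ghostly_def frob_hom by (metis mult_diff_mult dvd_add dvd_mult dvd_mult2)

lemma insertion_ghost: "insertion a (ghost p n s) = ghost p n (\<lambda>i. insertion a (s i))"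
  by (simp add: ghost_def insertion_sum insertion_mult insertion_power flip: of_nat_power)

lemma ghost_wadd:
  assumes p: "prime p"
  shows "ghost p n (wadd p x y) = ghost p n x + ghost p n y"
proof -
  have "ghost p n (witt_add_poly p) = ghost p n (\<lambda>i. Var (Inl i)) + ghost p n (\<lambda>i. Var (Inr i))"
    unfolding witt_add_poly_def by (intro ghost_ghost_inv p ghostly_add ghostly_ghost)
  from arg_cong[OF this, of "insertion (case_sum x y)"] show ?thesis
    by (simp add: insertion_ghost insertion_add wadd_def[abs_def])
qed

lemma ghost_wmult:
  assumes p: "prime p"
  shows "ghost p n (wmult p x y) = ghost p n x * ghost p n y"
proof -
  have "ghost p n (witt_mult_poly p) = ghost p n (\<lambda>i. Var (Inl i)) * ghost p n (\<lambda>i. Var (Inr i))"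
    unfolding witt_mult_poly_def by (intro ghost_ghost_inv p ghostly_mult ghostly_ghost)
  from arg_cong[OF this, of "insertion (case_sum x y)"] show ?thesis
    by (simp add: insertion_ghost insertion_mult wmult_def[abs_def])
qed

lemma ghost_wneg:
  assumes p: "prime p"
  shows "ghost p n (wneg p x) = - ghost p n x"
proof -
  have "ghost p n (witt_neg_poly p) = - ghost p n Var"
    unfolding witt_neg_poly_def by (intro ghost_ghost_inv p ghostly_uminus ghostly_ghost)
  from arg_cong[OF this, of "insertion x"] show ?thesis
    by (simp add: insertion_ghost insertion_uminus wneg_def[abs_def])
qed

definition wone :: "nat \<Rightarrow> 'r::comm_ring_1" where
  "wone n = (if n = 0 then 1 else 0)"

lemma ghost_wone: "p > 0 \<Longrightarrow> ghost p n wone = 1"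
proof -
  assume p: "p > 0"
  have "ghost p n wone = (\<Sum>i\<le>n. if i = 0 then 1 else 0)"
    unfolding ghost_def using p by (intro sum.cong) (auto simp: wone_def zero_power)
  then show ?thesis by simp
qed

lemma ghost_zero: "p > 0 \<Longrightarrow> ghost p n (\<lambda>_. 0) = 0"
  by (simp add: ghost_def zero_power)

lemma ghost_inject:
  fixes x y :: "nat \<Rightarrow> ('v, int) mpoly"
  assumes p: "p > 0" and eq: "\<And>n. ghost p n x = ghost p n y"
  shows "x = y"
proof
  fix n show "x n = y n"
  proof (induction n rule: less_induct)
    case (less n)
    then have "(\<Sum>i<n. of_nat p ^ i * x i ^ (p ^ (n - i))) = (\<Sum>i<n. of_nat p ^ i * y i ^ (p ^ (n - i)))"
      by (intro sum.cong) auto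
    then have "of_nat p ^ n * x n = of_nat p ^ n * y n"
      using eq[of n] by (simp add: ghost_split)
    then show ?case using p by (rule of_nat_power_cancel)
  qed
qed

lemma insertion_wadd: "insertion a (wadd p x y n) = wadd p (\<lambda>i. insertion a (x i)) (\<lambda>i. insertion a (y i)) n"
  unfolding wadd_def insertion_insertion
  by (rule arg_cong[of _ _ "\<lambda>b. insertion b _"]) (auto split: sum.split)

lemma insertion_wmult: "insertion a (wmult p x y n) = wmult p (\<lambda>i. insertion a (x i)) (\<lambda>i. insertion a (y i)) n"
  unfolding wmult_def insertion_insertion
  by (rule arg_cong[of _ _ "\<lambda>b. insertion b _"]) (auto split: sum.split)

lemma insertion_wneg: "insertion a (wneg p x n) = wneg p (\<lambda>i. insertion a (x i)) n"
  unfolding wneg_def insertion_insertion ..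

text \<open>
  Identities between Witt vector operations hold over polynomial rings over the integers by
  injectivity of the ghost map, and hence over every commutative ring by specialization.
\<close>

locale witt_laws =
  fixes p :: nat and a b c :: "nat \<Rightarrow> 'r::comm_ring_1"
  assumes p: "prime p"
begin

definition ev :: "nat \<times> nat \<Rightarrow> 'r" where
  "ev = (\<lambda>(j, i). if j = 0 then a i else if j = 1 then b i else c i)"

definition X :: "nat \<Rightarrow> nat \<Rightarrow> (nat \<times> nat, int) mpoly" where
  "X j i = Var (j, i)"

lemma ev_X: "insertion ev (X 0 i) = a i" "insertion ev (X 1 i) = b i" "insertion ev (X 2 i) = c i"
  by (simp_all add: ev_def X_def)

lemma p0: "p > 0" using p by (simp add: prime_gt_0_nat)

lemma specialize:
  fixes L R :: "nat \<Rightarrow> (nat \<times> nat, int) mpoly"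
  assumes "\<And>n. ghost p n L = ghost p n R"
  shows "(\<lambda>i. insertion ev (L i)) = (\<lambda>i. insertion ev (R i))"
  using ghost_inject[OF p0 assms] by simp

lemmas ghosts = ghost_wadd[OF p] ghost_wmult[OF p] ghost_wneg[OF p]
  ghost_zero[OF p0] ghost_wone[OF p0]
lemmas inss = insertion_wadd insertion_wmult insertion_wneg ev_X

lemma insertion_wone: "insertion ev (wone n) = wone n"
  by (simp add: wone_def)

lemma wadd_assoc: "wadd p (wadd p a b) c = wadd p a (wadd p b c)"
  using specialize[of "wadd p (wadd p (X 0) (X 1)) (X 2)" "wadd p (X 0) (wadd p (X 1) (X 2))"]
  by (simp add: inss ghosts add.assoc del: One_nat_def)

lemma wadd_commute: "wadd p a b = wadd p b a"
  using specialize[of "wadd p (X 0) (X 1)" "wadd p (X 1) (X 0)"]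
  by (simp add: inss ghosts add.commute del: One_nat_def)

lemma wadd_0: "wadd p (\<lambda>_. 0) a = a"
  using specialize[of "wadd p (\<lambda>_. 0) (X 0)" "X 0"]
  by (simp add: inss ghosts del: One_nat_def)

lemma wadd_wneg: "wadd p (wneg p a) a = (\<lambda>_. 0)"
  using specialize[of "wadd p (wneg p (X 0)) (X 0)" "\<lambda>_. 0"]
  by (simp add: inss ghosts del: One_nat_def)

lemma wmult_assoc: "wmult p (wmult p a b) c = wmult p a (wmult p b c)"
  using specialize[of "wmult p (wmult p (X 0) (X 1)) (X 2)" "wmult p (X 0) (wmult p (X 1) (X 2))"]
  by (simp add: inss ghosts mult.assoc del: One_nat_def)

lemma wmult_commute: "wmult p a b = wmult p b a"
  using specialize[of "wmult p (X 0) (X 1)" "wmult p (X 1) (X 0)"]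
  by (simp add: inss ghosts mult.commute del: One_nat_def)

lemma wmult_1: "wmult p wone a = a"
  using specialize[of "wmult p wone (X 0)" "X 0"]
  by (simp add: inss ghosts insertion_wone del: One_nat_def)

lemma distrib: "wmult p (wadd p a b) c = wadd p (wmult p a c) (wmult p b c)"
  using specialize[of "wmult p (wadd p (X 0) (X 1)) (X 2)" "wadd p (wmult p (X 0) (X 2)) (wmult p (X 1) (X 2))"]
  by (simp add: inss ghosts distrib_right del: One_nat_def)

end


section \<open>The ring of Witt vectors\<close>

datatype 'a witt = Witt (coord: "nat \<Rightarrow> 'a")

text \<open>The \<open>p\<close>-typical Witt vectors, where \<open>p\<close> is the characteristic of the base ring.\<close>

instantiation witt :: (comm_ring_prime_char) comm_ring_1
begin

definition zero_witt :: "'a witt" where "0 = Witt (\<lambda>_. 0)"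
definition one_witt :: "'a witt" where "1 = Witt (\<lambda>n. if n = 0 then 1 else 0)"
definition plus_witt :: "'a witt \<Rightarrow> 'a witt \<Rightarrow> 'a witt" where
  "x + y = Witt (wadd CHAR('a) (coord x) (coord y))"
definition times_witt :: "'a witt \<Rightarrow> 'a witt \<Rightarrow> 'a witt" where
  "x * y = Witt (wmult CHAR('a) (coord x) (coord y))"
definition uminus_witt :: "'a witt \<Rightarrow> 'a witt" where
  "- x = Witt (wneg CHAR('a) (coord x))"
definition minus_witt :: "'a witt \<Rightarrow> 'a witt \<Rightarrow> 'a witt" where
  "x - y = x + (- y :: 'a witt)"

instance
proof
  fix x y z :: "'a witt"
  have laws: "witt_laws CHAR('a)" by (rule witt_laws.intro) simp
  note ops = plus_witt_def times_witt_def uminus_witt_def witt.sel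
  show "x + y + z = x + (y + z)"
    unfolding ops witt_laws.wadd_assoc[OF laws] ..
  show "x + y = y + x"
    unfolding ops by (subst witt_laws.wadd_commute[OF laws]) (rule refl)
  show "0 + x = x"
    unfolding ops zero_witt_def witt_laws.wadd_0[OF laws] by (rule witt.collapse)
  show "- x + x = 0"
    unfolding ops zero_witt_def witt_laws.wadd_wneg[OF laws] ..
  show "x - y = x + - y" by (rule minus_witt_def)
  show "x * y * z = x * (y * z)"
    unfolding ops witt_laws.wmult_assoc[OF laws] ..
  show "x * y = y * x"
    unfolding ops by (subst witt_laws.wmult_commute[OF laws]) (rule refl)
  have one: "(1 :: 'a witt) = Witt wone"
    unfolding one_witt_def wone_def[abs_def] ..
  show "1 * x = x"
    unfolding one ops witt_laws.wmult_1[OF laws] by (rule witt.collapse)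
  show "(x + y) * z = x * z + y * z"
    unfolding ops witt_laws.distrib[OF laws] ..
  have "coord (0 :: 'a witt) 0 \<noteq> coord 1 0"
    unfolding zero_witt_def one_witt_def by simp
  then show "(0 :: 'a witt) \<noteq> 1" by metis
qed

end

definition teichmueller :: "'a::comm_ring_prime_char \<Rightarrow> 'a witt" where
  "teichmueller a = Witt (\<lambda>n. if n = 0 then a else 0)"

text \<open>In characteristic \<open>p\<close> the Witt vector Frobenius is the coordinatewise \<open>p\<close>-th power.\<close>

definition witt_frob :: "'a::comm_ring_prime_char witt \<Rightarrow> 'a witt" where
  "witt_frob x = Witt (\<lambda>n. coord x n ^ CHAR('a))"

text \<open>
  An element of the ring \<open>W\<^sub>n\<close> of Witt vectors of length \<open>n\<close> is represented by the Witt vector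
  whose coordinates with index at least \<open>n\<close> vanish; sums and products in \<open>W\<^sub>n\<close> are the
  truncations of those in \<open>W\<close>.
\<close>

definition witt_len :: "nat \<Rightarrow> 'a::comm_ring_prime_char witt set" where
  "witt_len n = {x. \<forall>i\<ge>n. coord x i = 0}"

definition witt_trunc :: "nat \<Rightarrow> 'a::comm_ring_prime_char witt \<Rightarrow> 'a witt" where
  "witt_trunc n x = Witt (\<lambda>i. if i < n then coord x i else 0)"


section \<open>Non-splitting index in characteristic \<open>p\<close>\<close>

definition to_frac :: "'a::idom \<Rightarrow> 'a fract" where
  "to_frac a = Fract a 1"

text \<open>\<open>W\<^sub>n(A)(p D\<^sub>n)\<close> for \<open>D\<^sub>n = (1 - 2 / p\<^sup>n) div(f)\<close>\<close>

definition witt_pD :: "nat \<Rightarrow> 'a::idom_prime_char \<Rightarrow> 'a fract witt set" where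
  "witt_pD n f = {x \<in> witt_len n.
     (\<forall>i. i + 1 < n \<longrightarrow> to_frac f ^ (CHAR('a) ^ (i + 1) - 1) * coord x i \<in> range to_frac) \<and>
     to_frac f ^ (CHAR('a) ^ n - 2) * coord x (n - 1) \<in> range to_frac}"

text \<open>
  The second condition on \<open>\<phi>\<close> is linearity over \<open>W\<^sub>n(A)\<close>: a scalar \<open>w\<close> acts on the source through
  its Frobenius and on \<open>A\<close> through its zeroth coordinate.
\<close>

definition quasi_F_split :: "nat \<Rightarrow> 'a::idom_prime_char \<Rightarrow> bool" where
  "quasi_F_split n f \<longleftrightarrow> (\<exists>\<phi> :: 'a fract witt \<Rightarrow> 'a.
     (\<forall>x\<in>witt_pD n f. \<forall>y\<in>witt_pD n f. \<phi> (witt_trunc n (x + y)) = \<phi> x + \<phi> y) \<and>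
     (\<forall>w\<in>witt_len n. \<forall>x\<in>witt_pD n f.
        \<phi> (witt_trunc n (map_witt to_frac (witt_frob w) * x)) = coord w 0 * \<phi> x) \<and>
     \<phi> 1 = 1)"

definition ns :: "'a::idom_prime_char \<Rightarrow> enat" where
  "ns f = Inf {enat n | n. n \<ge> 1 \<and> \<not> quasi_F_split n f}"


section \<open>Non-splitting index in mixed characteristic\<close>

definition frob_lift ::
    "('v, 'k::comm_ring_prime_char witt) mpoly \<Rightarrow> ('v, 'k witt) mpoly" where
  "frob_lift g = (\<Sum>\<mu>\<in>keys g.
     single (Poly_Mapping.map (\<lambda>e. CHAR('k) * e) \<mu>) (witt_frob (lookup g \<mu>)))"

text \<open>
  Over a perfect field \<open>k\<close> of characteristic \<open>p\<close> the ring \<open>W(k)[x]\<close> has no \<open>p\<close>-torsion,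
  and \<open>g ^ p - frob_lift g\<close> is divisible by \<open>p\<close>, so \<open>delta g\<close> is well defined.
\<close>

definition delta ::
    "('v, 'k::comm_ring_prime_char witt) mpoly \<Rightarrow> ('v, 'k witt) mpoly" where
  "delta g = (THE h. of_nat CHAR('k) * h = g ^ CHAR('k) - frob_lift g)"

definition tilde_seq ::
    "('v, 'k::comm_ring_prime_char witt) mpoly \<Rightarrow> nat \<Rightarrow> ('v, 'k witt) mpoly" where
  "tilde_seq g l = g ^ (CHAR('k) - 2) *
     (g ^ (CHAR('k)\<^sup>2 - 2 * CHAR('k)) * delta g) ^ (\<Sum>i<l - 1. CHAR('k) ^ i)"

definition frob_ideal :: "nat \<Rightarrow> ('v::finite, 'k::comm_ring_prime_char witt) mpoly set" where
  "frob_ideal l = {of_nat CHAR('k) * h + (\<Sum>v\<in>UNIV. Var v ^ (CHAR('k) ^ l) * u v) | h u. True}"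

definition ns_mixed_eq :: "('v::finite, 'k::comm_ring_prime_char witt) mpoly \<Rightarrow> nat \<Rightarrow> bool" where
  "ns_mixed_eq g n \<longleftrightarrow> n \<ge> 1 \<and>
     (\<forall>i\<in>{1..n - 1}. tilde_seq g i \<notin> frob_ideal i \<and> g * tilde_seq g i \<in> frob_ideal i) \<and>
     tilde_seq g n \<in> frob_ideal n"

lemma ns_mixed_eq_unique:
  assumes "ns_mixed_eq g m" "ns_mixed_eq g n"
  shows "m = n"
proof (rule ccontr)
  assume "m \<noteq> n"
  then consider "m \<in> {1..n - 1}" | "n \<in> {1..m - 1}"
    using assms unfolding ns_mixed_eq_def by fastforce
  then show False using assms unfolding ns_mixed_eq_def by cases blast+
qed

definition ns_mixed :: "('v::finite, 'k::comm_ring_prime_char witt) mpoly \<Rightarrow> enat" where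
  "ns_mixed g = (if \<exists>n. ns_mixed_eq g n then enat (THE n. ns_mixed_eq g n) else \<infinity>)"


section \<open>The two families of polynomials\<close>

text \<open>\<open>\<alpha>\<close> enumerates the monomials of the given degree by a finite type \<open>'m\<close>.\<close>

definition generic_poly :: "('m::finite \<Rightarrow> 'v monomial) \<Rightarrow> 'k^'m \<Rightarrow> ('v, 'k::comm_ring_1) mpoly" where
  "generic_poly \<alpha> b = (\<Sum>i\<in>UNIV. single (\<alpha> i) (b $ i))"

definition generic_lift ::
    "('m::finite \<Rightarrow> 'v monomial) \<Rightarrow> 'k^'m \<Rightarrow> 'k^'m \<Rightarrow> ('v, 'k::comm_ring_prime_char witt) mpoly" where
  "generic_lift \<alpha> b c =
     (\<Sum>i\<in>UNIV. single (\<alpha> i) (teichmueller (b $ i) + of_nat CHAR('k) * teichmueller (c $ i)))"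

end

theory Submission
  imports Defs
begin

text \<open>
  Write \<open>A = k[x]\<close> and \<open>f = G(b)\<close>, let \<open>F\<close> be a lift of \<open>f\<close> to \<open>W(k)[x]\<close>, let \<open>\<delta>\<close> be the
  reduction of \<open>delta F\<close>, and let \<open>u\<close> be the trace (Cartier operator) dual to the Frobenius of \<open>A\<close>.
  Everything is governed by the two inverse-linear operators \<open>\<tau>(h) = u(f ^ (p - 2) * h)\<close> and
  \<open>\<theta>(h) = u(f ^ (p - 2) * \<delta> * h)\<close>.

  In characteristic \<open>p\<close>, the ghost component of index \<open>m\<close> identifies \<open>W(A)\<close>, truncated to length
  \<open>m + 1\<close>, with the sums \<open>\<Sum>i\<le>m. p ^ i * \<phi> ^ (m - i) (b i)\<close> in \<open>W(k)[x]\<close> modulo \<open>p ^ (m + 1)\<close>,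
  and the Witt vector Frobenius with the Frobenius lift \<open>\<phi>\<close>. A linear functional therefore has the
  form \<open>\<Sum>i\<le>m. u ^ (i + 1) (g i * b i)\<close> with \<open>u (g i) = 0\<close> for \<open>i \<ge> 1\<close>
  (\<open>functional_represents\<close>, \<open>functional_exists\<close>). Expanding powers of \<open>F\<close> in iterated Frobenius
  lifts shows which \<open>g\<close> extend to the Witt vectors with poles along \<open>f\<close>. The outcome is the
  criterion \<open>quasi_F_split_iff_chain\<close>: the pair is \<open>n\<close>-quasi-F-split if and only if there are
  \<open>h 0, \<dots>, h (n - 1)\<close> with \<open>\<tau> (h 0) = 1\<close>, with \<open>\<tau> (h i) = 0\<close> for \<open>i \<ge> 1\<close>, and with
  \<open>h i + \<theta> (h (i + 1))\<close> divisible by \<open>f\<close>. Since the degree \<open>d\<close> of \<open>f\<close> is the sum of the weights,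
  \<open>\<theta>\<close> preserves the space \<open>V\<close> of forms of degree \<open>d\<close>, \<open>\<tau>\<close> is scalar on it, and the chain can be
  taken in \<open>V\<close>. With \<open>J 0 = V\<close> and \<open>J (n + 1) = k f + \<theta> (J n \<inter> ker \<tau>)\<close>, the index \<open>ns f\<close> is the
  least \<open>n \<ge> 1\<close> for which \<open>\<tau>\<close> vanishes on \<open>J (n - 1)\<close>.

  In mixed characteristic, the trace pairing translates membership in the Frobenius powers of the
  maximal ideal (\<open>homogeneous_frob_ideal_iff\<close>, \<open>trace_tilde_seq\<close>): the index of the lift is \<open>n\<close>
  when \<open>\<tau> \<circ> \<theta> ^ (i - 1)\<close> is nonzero on \<open>V\<close> but kills \<open>f\<close> for all \<open>i < n\<close>, and \<open>\<tau> \<circ> \<theta> ^ (n - 1)\<close>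
  vanishes on \<open>V\<close>. Adding \<open>p [c i]\<close> to the coefficients replaces \<open>\<delta>\<close> by \<open>\<delta> - g ^ p\<close> and \<open>\<theta>\<close> by
  its twist \<open>\<theta> - g * \<tau>\<close>, where \<open>g = G(c)\<close> is an arbitrary element of \<open>V\<close>.

  It remains to compare. On the kernel of \<open>\<tau>\<close> a twist agrees with \<open>\<theta>\<close>, so a chain can be computed
  with any twist; if the lift has index \<open>n\<close>, this shows that \<open>\<tau>\<close> vanishes on \<open>J (n - 1)\<close>, and
  \<open>ns f \<le> n\<close> (\<open>tau_J_eq_0_of_twist\<close>). Conversely, if \<open>n \<ge> 2\<close> is the index of \<open>f\<close>, take
  \<open>e\<close> in \<open>J (n - 2)\<close> with \<open>\<tau> e = 1\<close> and \<open>g = \<theta> e\<close>. The twist kills \<open>e\<close> and maps \<open>J i\<close> into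
  \<open>J (i + 1)\<close> for \<open>i \<le> n - 2\<close>, so that its \<open>(n - 1)\<close>-st power maps \<open>V\<close> into \<open>J (n - 1)\<close>, where \<open>\<tau>\<close> is
  zero. All iterates of the twist at \<open>f\<close> stay in \<open>J (n - 1)\<close> as well, and the index of this lift is
  at most \<open>n\<close> (\<open>exists_twist\<close>).
\<close>

section \<open>Ring homomorphisms and Witt vectors\<close>

locale unital_hom =
  fixes h :: "'a::comm_ring_1 \<Rightarrow> 'b::comm_ring_1"
  assumes add: "h (x + y) = h x + h y"
    and mult: "h (x * y) = h x * h y"
    and one: "h 1 = 1"
begin

lemma zero: "h 0 = 0"
  using add[of 0 0] by simp

lemma uminus: "h (- x) = - h x"
  using add[of x "- x"] by (simp add: zero eq_neg_iff_add_eq_0 add.commute)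

lemma diff: "h (x - y) = h x - h y"
  using add[of x "- y"] by (simp add: uminus)

lemma sum: "h (sum f A) = (\<Sum>a\<in>A. h (f a))"
  by (induction A rule: infinite_finite_induct) (simp_all add: zero add)

lemma prod: "h (prod f A) = (\<Prod>a\<in>A. h (f a))"
  by (induction A rule: infinite_finite_induct) (simp_all add: one mult)

lemma power: "h (x ^ n) = h x ^ n"
  by (induction n) (simp_all add: one mult)

lemma of_nat: "h (of_nat n) = of_nat n"
  by (induction n) (simp_all add: zero one add)

lemma of_int: "h (of_int n) = of_int n"
  by (cases n) (simp_all add: of_nat uminus diff one)

lemma insertion: "h (insertion a P) = insertion (\<lambda>v. h (a v)) P"
  by (simp add: insertion_def sum mult prod power of_int)

lemma wadd: "h (wadd p x y n) = wadd p (\<lambda>i. h (x i)) (\<lambda>i. h (y i)) n"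
  unfolding wadd_def insertion
  by (rule arg_cong[of _ _ "\<lambda>b. Defs.insertion b _"]) (auto split: sum.split)

lemma wmult: "h (wmult p x y n) = wmult p (\<lambda>i. h (x i)) (\<lambda>i. h (y i)) n"
  unfolding wmult_def insertion
  by (rule arg_cong[of _ _ "\<lambda>b. Defs.insertion b _"]) (auto split: sum.split)

lemma ghost: "h (ghost p n x) = ghost p n (\<lambda>i. h (x i))"
  by (simp add: ghost_def sum mult power of_nat)

end

lemma coord_add: "coord (x + y) = wadd CHAR('a) (coord x) (coord y)"
  for x y :: "'a::comm_ring_prime_char witt"
  by (simp add: plus_witt_def)

lemma coord_mult: "coord (x * y) = wmult CHAR('a) (coord x) (coord y)"
  for x y :: "'a::comm_ring_prime_char witt"
  by (simp add: times_witt_def)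

lemma coord_zero [simp]: "coord 0 i = 0"
  by (simp add: zero_witt_def)

lemma coord_one: "coord 1 i = (if i = 0 then 1 else 0)"
  by (simp add: one_witt_def)

lemma witt_eqI: "(\<And>i. coord x i = coord y i) \<Longrightarrow> x = y"
  by (cases x, cases y) auto

lemma coord_map_witt [simp]: "coord (map_witt h x) i = h (coord x i)"
  by (cases x) simp

lemma unital_hom_map_witt:
  fixes h :: "'a::comm_ring_prime_char \<Rightarrow> 'b::comm_ring_prime_char"
  assumes "unital_hom h" and "CHAR('a) = CHAR('b)"
  shows "unital_hom (map_witt h)"
proof -
  interpret unital_hom h by fact
  show ?thesis
  proof
    show "map_witt h (x + y) = map_witt h x + map_witt h y" for x y
      by (rule witt_eqI) (simp add: coord_add wadd assms(2) coord_map_witt[abs_def])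
    show "map_witt h (x * y) = map_witt h x * map_witt h y" for x y
      by (rule witt_eqI) (simp add: coord_mult wmult assms(2) coord_map_witt[abs_def])
    show "map_witt h 1 = 1"
      by (rule witt_eqI) (simp add: coord_one one zero)
  qed
qed

lemma unital_hom_power_CHAR:
  "unital_hom (\<lambda>x::'a::comm_ring_prime_char. x ^ CHAR('a))"
  by standard (simp_all add: freshmans_dream power_mult_distrib)

lemma witt_frob_eq_map: "witt_frob x = map_witt (\<lambda>a. a ^ CHAR('a)) x"
  for x :: "'a::comm_ring_prime_char witt"
  by (rule witt_eqI) (simp add: witt_frob_def)

lemma coord_witt_frob [simp]: "coord (witt_frob x) i = coord x i ^ CHAR('a)"
  for x :: "'a::comm_ring_prime_char witt"
  by (simp add: witt_frob_def)

lemma unital_hom_witt_frob: "unital_hom (witt_frob :: 'a::comm_ring_prime_char witt \<Rightarrow> _)"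
  unfolding witt_frob_eq_map[abs_def] by (intro unital_hom_map_witt unital_hom_power_CHAR refl)

lemma unital_hom_coord_0: "unital_hom (\<lambda>x::'a::comm_ring_prime_char witt. coord x 0)"
proof
  fix x y :: "'a witt"
  show "coord (x + y) 0 = coord x 0 + coord y 0"
    using ghost_wadd[of "CHAR('a)" 0 "coord x" "coord y"] by (simp add: coord_add ghost_def)
  show "coord (x * y) 0 = coord x 0 * coord y 0"
    using ghost_wmult[of "CHAR('a)" 0 "coord x" "coord y"] by (simp add: coord_mult ghost_def)
qed (simp add: coord_one)

lemma ghost_inject_below:
  fixes x y :: "nat \<Rightarrow> ('v, int) mpoly"
  assumes p: "p > 0" and eq: "\<And>m. m < n \<Longrightarrow> ghost p m x = ghost p m y" and "i < n"
  shows "x i = y i"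
  using \<open>i < n\<close>
proof (induction i rule: less_induct)
  case (less i)
  then have "(\<Sum>j<i. of_nat p ^ j * x j ^ (p ^ (i - j))) = (\<Sum>j<i. of_nat p ^ j * y j ^ (p ^ (i - j)))"
    by (intro sum.cong) auto
  then have "of_nat p ^ i * x i = of_nat p ^ i * y i"
    using eq[of i] less.prems by (simp add: ghost_split)
  then show ?case using p by (rule of_nat_power_cancel)
qed

lemma ghost_cong_below: "(\<And>i. i \<le> m \<Longrightarrow> x i = y i) \<Longrightarrow> ghost p m x = ghost p m y"
  by (simp add: ghost_def)

text \<open>
  The ghost components with index below \<open>n\<close> see only the coordinates with index below \<open>n\<close>;
  injectivity of the ghost map transports this to the universal polynomials.
\<close>

lemma wadd_wmult_cong_below:
  fixes x y :: "nat \<Rightarrow> 'r::comm_ring_1"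
  assumes p: "prime p" and "\<And>i. i < n \<Longrightarrow> x i = x' i" "\<And>i. i < n \<Longrightarrow> y i = y' i" and "i < n"
  shows "wadd p x y i = wadd p x' y' i" "wmult p x y i = wmult p x' y' i"
proof -
  define X :: "nat \<Rightarrow> (nat + nat, int) mpoly" where "X = (\<lambda>i. Var (Inl i))"
  define Y :: "nat \<Rightarrow> (nat + nat, int) mpoly" where "Y = (\<lambda>i. Var (Inr i))"
  define cut :: "(nat \<Rightarrow> (nat + nat, int) mpoly) \<Rightarrow> _" where "cut = (\<lambda>Z i. if i < n then Z i else 0)"
  have p0: "p > 0" using p by (simp add: prime_gt_0_nat)
  have g: "ghost p m (cut Z) = ghost p m Z" if "m < n" for m Z
    using that by (intro ghost_cong_below) (auto simp: cut_def)
  have a: "wadd p (cut X) (cut Y) i = wadd p X Y i"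
    by (rule ghost_inject_below[OF p0 _ \<open>i < n\<close>]) (simp add: ghost_wadd[OF p] g)
  have m: "wmult p (cut X) (cut Y) i = wmult p X Y i"
    by (rule ghost_inject_below[OF p0 _ \<open>i < n\<close>]) (simp add: ghost_wmult[OF p] g)
  have cutx: "(\<lambda>i. insertion (case_sum u v) (cut X i)) = (\<lambda>i. if i < n then u i else 0)"
    and cuty: "(\<lambda>i. insertion (case_sum u v) (cut Y i)) = (\<lambda>i. if i < n then v i else 0)"
    for u v :: "nat \<Rightarrow> 'r"
    by (auto simp: cut_def X_def Y_def fun_eq_iff)
  have e: "(\<lambda>i. insertion (case_sum u v) (X i)) = u" "(\<lambda>i. insertion (case_sum u v) (Y i)) = v"
    for u v :: "nat \<Rightarrow> 'r"
    by (auto simp: X_def Y_def)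
  have eqs: "(\<lambda>i. if i < n then x i else 0) = (\<lambda>i. if i < n then x' i else 0)"
    "(\<lambda>i. if i < n then y i else 0) = (\<lambda>i. if i < n then y' i else 0)"
    using assms by auto
  have "wadd p u v i = wadd p (\<lambda>i. if i < n then u i else 0) (\<lambda>i. if i < n then v i else 0) i"
    for u v :: "nat \<Rightarrow> 'r"
    using arg_cong[OF a, of "insertion (case_sum u v)"] by (simp add: insertion_wadd cutx cuty e)
  from this[of x y] this[of x' y'] show "wadd p x y i = wadd p x' y' i"
    by (simp add: eqs)
  have "wmult p u v i = wmult p (\<lambda>i. if i < n then u i else 0) (\<lambda>i. if i < n then v i else 0) i"
    for u v :: "nat \<Rightarrow> 'r"
    using arg_cong[OF m, of "insertion (case_sum u v)"] by (simp add: insertion_wmult cutx cuty e)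
  from this[of x y] this[of x' y'] show "wmult p x y i = wmult p x' y' i"
    by (simp add: eqs)
qed

lemma coord_witt_trunc: "coord (witt_trunc n x) i = (if i < n then coord x i else 0)"
  by (simp add: witt_trunc_def)

lemma witt_trunc_eq_iff: "witt_trunc n x = witt_trunc n y \<longleftrightarrow> (\<forall>i<n. coord x i = coord y i)"
  unfolding witt_trunc_def by (auto simp: fun_eq_iff)

text \<open>
  Witt vectors with vanishing first \<open>n\<close> coordinates form an ideal, so truncation turns the
  operations of \<open>W\<close> into well-defined operations on \<open>W\<^sub>n\<close>.
\<close>

lemma witt_trunc_add: "witt_trunc n (witt_trunc n x + witt_trunc n y) = witt_trunc n (x + y)"
  unfolding witt_trunc_eq_iff coord_add
  by (intro allI impI wadd_wmult_cong_below(1)[where n = n]) (simp_all add: coord_witt_trunc)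

lemma witt_trunc_mult: "witt_trunc n (witt_trunc n x * witt_trunc n y) = witt_trunc n (x * y)"
  unfolding witt_trunc_eq_iff coord_mult
  by (intro allI impI wadd_wmult_cong_below(2)[where n = n]) (simp_all add: coord_witt_trunc)

lemma witt_trunc_id: "x \<in> witt_len n \<Longrightarrow> witt_trunc n x = x"
  by (rule witt_eqI) (auto simp: witt_len_def coord_witt_trunc)

lemma witt_trunc_in_len: "witt_trunc n x \<in> witt_len n"
  by (simp add: witt_len_def coord_witt_trunc)

lemma witt_trunc_trunc [simp]: "witt_trunc n (witt_trunc n x) = witt_trunc n x"
  by (intro witt_trunc_id witt_trunc_in_len)

lemma witt_trunc_map: "h 0 = 0 \<Longrightarrow> witt_trunc n (map_witt h x) = map_witt h (witt_trunc n x)"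
  by (rule witt_eqI) (simp add: coord_witt_trunc)

lemma witt_trunc_frob: "witt_trunc n (witt_frob x) = witt_frob (witt_trunc n x)"
  unfolding witt_frob_eq_map by (rule witt_trunc_map) (simp add: zero_power)

lemma ghost_single:
  assumes "p > 0" "i \<le> m"
  shows "ghost p m (\<lambda>j. if j = i then c else 0) = of_nat p ^ i * c ^ (p ^ (m - i))"
proof -
  have "ghost p m (\<lambda>j. if j = i then c else 0)
      = (\<Sum>j\<le>m. if j = i then of_nat p ^ i * c ^ (p ^ (m - i)) else 0)"
    unfolding ghost_def using assms by (intro sum.cong) (auto simp: zero_power)
  then show ?thesis using assms by simp
qed

lemma teichmueller_mult:
  fixes x :: "'a::comm_ring_prime_char witt"
  shows "teichmueller t * x = Witt (\<lambda>i. t ^ (CHAR('a) ^ i) * coord x i)"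
proof -
  define p where "p = CHAR('a)"
  have p: "prime p" by (simp add: p_def)
  then have p0: "p > 0" by (simp add: prime_gt_0_nat)
  define T :: "(unit + nat, int) mpoly" where "T = Var (Inl ())"
  define X :: "nat \<Rightarrow> (unit + nat, int) mpoly" where "X = (\<lambda>i. Var (Inr i))"
  have gT: "ghost p n (\<lambda>i. if i = 0 then T else 0) = T ^ (p ^ n)" for n
    using ghost_single[OF p0, of 0 n T] by simp
  have "wmult p (\<lambda>i. if i = 0 then T else 0) X = (\<lambda>i. T ^ (p ^ i) * X i)"
  proof (rule ghost_inject[OF p0])
    fix n
    have "ghost p n (\<lambda>i. T ^ (p ^ i) * X i) = T ^ (p ^ n) * ghost p n X"
      unfolding ghost_def sum_distrib_left
      by (intro sum.cong) (simp_all add: power_mult_distrib algebra_simps flip: power_mult power_add)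
    then show "ghost p n (wmult p (\<lambda>i. if i = 0 then T else 0) X) = ghost p n (\<lambda>i. T ^ (p ^ i) * X i)"
      by (simp add: ghost_wmult[OF p] gT)
  qed
  from arg_cong[OF this, of "\<lambda>Z i. insertion (case_sum (\<lambda>_. t) (coord x)) (Z i)"]
  have "wmult p (\<lambda>i. if i = 0 then t else 0) (coord x) = (\<lambda>i. t ^ (p ^ i) * coord x i)"
    by (simp add: insertion_wmult insertion_mult insertion_power T_def X_def if_distrib cong: if_cong)
  then show ?thesis
    by (simp add: times_witt_def teichmueller_def p_def)
qed

text \<open>
  In characteristic \<open>p\<close> multiplication by \<open>p\<close> is the Frobenius followed by the Verschiebung.
  Over the integers the two differ, in ghost components, by the sequence
  \<open>p ^ (n + 1) * x n\<close>, which is the ghost of a Witt vector \<open>p * t\<close> all of whose coordinates are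
  divisible by \<open>p\<close>.
\<close>

fun pmult_error :: "nat \<Rightarrow> nat \<Rightarrow> (nat, int) mpoly" where
  "pmult_error p n =
     Var n - (\<Sum>i<n. of_nat p ^ (i + p ^ (n - i) - Suc n) * pmult_error p i ^ (p ^ (n - i)))"

declare pmult_error.simps [simp del]

lemma ghost_pmult_error:
  assumes "prime p"
  shows "ghost p n (\<lambda>i. of_nat p * pmult_error p i) = of_nat p ^ Suc n * Var n"
proof -
  let ?t = "pmult_error p"
  have "of_nat p ^ i * (of_nat p * ?t i) ^ (p ^ (n - i))
      = of_nat p ^ Suc n * (of_nat p ^ (i + p ^ (n - i) - Suc n) * ?t i ^ (p ^ (n - i)))" if "i < n" for i
  proof -
    have "n - i < p ^ (n - i)"
      using prime_gt_1_nat[OF assms] by (intro power_gt_expt) simp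
    then have "i + p ^ (n - i) = Suc n + (i + p ^ (n - i) - Suc n)" using that by linarith
    then have "(of_nat p :: (nat, int) mpoly) ^ i * of_nat p ^ (p ^ (n - i))
        = of_nat p ^ Suc n * of_nat p ^ (i + p ^ (n - i) - Suc n)"
      by (metis power_add)
    then show ?thesis by (simp only: power_mult_distrib mult.assoc[symmetric])
  qed
  then have "(\<Sum>i<n. of_nat p ^ i * (of_nat p * ?t i) ^ (p ^ (n - i)))
      = of_nat p ^ Suc n * (\<Sum>i<n. of_nat p ^ (i + p ^ (n - i) - Suc n) * ?t i ^ (p ^ (n - i)))"
    unfolding sum_distrib_left by (intro sum.cong) auto
  moreover have "?t n = Var n - (\<Sum>i<n. of_nat p ^ (i + p ^ (n - i) - Suc n) * ?t i ^ (p ^ (n - i)))"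
    by (rule pmult_error.simps)
  ultimately show ?thesis
    unfolding ghost_split by (simp only:) (simp add: algebra_simps)
qed

lemma of_nat_CHAR_mult_witt:
  fixes x :: "'a::comm_ring_prime_char witt"
  shows "of_nat CHAR('a) * x = Witt (\<lambda>n. if n = 0 then 0 else coord x (n - 1) ^ CHAR('a))"
proof -
  define p where "p = CHAR('a)"
  have p: "prime p" by (simp add: p_def)
  then have p0: "p > 0" by (simp add: prime_gt_0_nat)
  define X :: "nat \<Rightarrow> (nat, int) mpoly" where "X = Var"
  define VF :: "nat \<Rightarrow> (nat, int) mpoly" where "VF n = (if n = 0 then 0 else X (n - 1) ^ p)" for n
  define rep :: "nat \<Rightarrow> nat \<Rightarrow> (nat, int) mpoly" where "rep k = (wadd p X ^^ k) (\<lambda>_. 0)" for k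
  have grep: "ghost p n (rep k) = of_nat k * ghost p n X" for n k
    by (induction k) (simp_all add: rep_def ghost_wadd[OF p] ghost_zero[OF p0] algebra_simps)
  have gVF: "ghost p n VF = of_nat p * ghost p n X - of_nat p ^ Suc n * X n" for n
  proof (cases n)
    case 0
    then show ?thesis by (simp add: ghost_def VF_def)
  next
    case (Suc m)
    have "ghost p n VF = (\<Sum>i\<le>m. of_nat p ^ Suc i * (X i ^ p) ^ (p ^ (m - i)))"
      unfolding ghost_def Suc sum.atMost_Suc_shift using p0 by (simp add: VF_def zero_power)
    also have "\<dots> = of_nat p * (\<Sum>i<n. of_nat p ^ i * X i ^ (p ^ (n - i)))"
      unfolding sum_distrib_left Suc lessThan_Suc_atMost
      by (intro sum.cong) (simp_all add: Suc_diff_le mult.assoc flip: power_mult)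
    finally show ?thesis by (simp add: ghost_split algebra_simps)
  qed
  have eq: "rep p = wadd p VF (\<lambda>i. of_nat p * pmult_error p i)"
    by (rule ghost_inject[OF p0])
      (simp add: grep gVF ghost_wadd[OF p] ghost_pmult_error[OF p] X_def)
  have rep: "insertion (coord x) (rep k i) = coord (of_nat k * x) i" for k i
  proof (induction k arbitrary: i)
    case 0
    then show ?case by (simp add: rep_def)
  next
    case (Suc k)
    have "rep (Suc k) = wadd p X (rep k)" by (simp add: rep_def)
    then have "insertion (coord x) (rep (Suc k) i) = wadd p (coord x) (coord (of_nat k * x)) i"
      by (simp add: insertion_wadd Suc.IH X_def)
    then show ?case by (simp add: distrib_right coord_add p_def)
  qed
  have laws: "witt_laws p" by (rule witt_laws.intro) (rule p)
  have p_zero: "(of_nat p :: 'a) = 0" by (simp add: p_def)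
  show ?thesis
  proof (rule witt_eqI)
    fix i
    have "coord (of_nat p * x) i
        = wadd p (\<lambda>i. insertion (coord x) (VF i)) (\<lambda>i. 0) i"
      unfolding rep[symmetric] eq insertion_wadd by (simp add: insertion_mult p_zero)
    also have "\<dots> = insertion (coord x) (VF i)"
      using witt_laws.wadd_0[OF laws] witt_laws.wadd_commute[OF laws] by metis
    finally show "coord (of_nat CHAR('a) * x) i
        = coord (Witt (\<lambda>n. if n = 0 then 0 else coord x (n - 1) ^ CHAR('a))) i"
      by (simp add: VF_def X_def insertion_power p_def)
  qed
qed


section \<open>Polynomials and their lifts to the Witt vectors\<close>

lemma poly_mapping_add_induct [case_names zero single add]:
  fixes f :: "'a \<Rightarrow>\<^sub>0 'b::comm_monoid_add"
  assumes "P 0" "\<And>\<mu> c. P (single \<mu> c)" "\<And>f g. P f \<Longrightarrow> P g \<Longrightarrow> P (f + g)"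
  shows "P f"
proof -
  have "P (\<Sum>\<mu>\<in>S. single \<mu> (lookup f \<mu>))" if "finite S" for S
    using that by (induction S) (auto intro: assms)
  then show ?thesis using sum_single[of f] by (metis finite_keys)
qed

lemma unital_hom_poly_mappingI:
  fixes h :: "('a::comm_monoid_add \<Rightarrow>\<^sub>0 'b::comm_ring_1) \<Rightarrow> 'c::comm_ring_1"
  assumes add: "\<And>f g. h (f + g) = h f + h g"
    and mult: "\<And>\<mu> \<nu> c d. h (single \<mu> c * single \<nu> d) = h (single \<mu> c) * h (single \<nu> d)"
    and one: "h 1 = 1"
  shows "unital_hom h"
proof
  have zero: "h 0 = 0" using add[of 0 0] by simp
  have 1: "h (single \<mu> c * g) = h (single \<mu> c) * h g" for \<mu> c g
    by (induction g rule: poly_mapping_add_induct) (simp_all add: zero mult add distrib_left)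
  show "h (f * g) = h f * h g" for f g
    by (induction f rule: poly_mapping_add_induct) (simp_all add: zero 1 add distrib_right)
qed (fact add one)+

lemma lookup_map_zero: "f 0 = 0 \<Longrightarrow> lookup (Poly_Mapping.map f g) \<mu> = f (lookup g \<mu>)"
  by (simp add: Poly_Mapping.map.rep_eq when_def)

abbreviation scale_monomial :: "nat \<Rightarrow> 'v monomial \<Rightarrow> 'v monomial" where
  "scale_monomial e \<equiv> Poly_Mapping.map (\<lambda>n. e * n)"

lemma lookup_scale_monomial [simp]: "lookup (scale_monomial e \<mu>) v = e * lookup \<mu> v"
  by (simp add: lookup_map_zero)

lemma scale_monomial_add: "scale_monomial e (\<mu> + \<nu>) = scale_monomial e \<mu> + scale_monomial e \<nu>"
  by (rule poly_mapping_eqI) (simp add: lookup_add distrib_left)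

lemma single_power:
  "single \<mu> c ^ n = single (scale_monomial n \<mu>) (c ^ n)" for c :: "'r::comm_ring_1"
proof (induction n)
  case 0
  have "scale_monomial 0 \<mu> = 0" by (rule poly_mapping_eqI) (simp add: lookup_map_zero)
  then show ?case by simp
next
  case (Suc n)
  have "\<mu> + scale_monomial n \<mu> = scale_monomial (Suc n) \<mu>"
    by (rule poly_mapping_eqI) (simp add: lookup_add lookup_map_zero)
  then show ?case by (simp add: Suc mult_single)
qed

lemma lookup_const_mult: "lookup (single 0 c * g) \<mu> = c * lookup g \<mu>"
  for c :: "'r::comm_ring_1"
  unfolding mult_map_scale_conv_mult[symmetric] by (simp add: lookup_map_zero)

lemma lookup_of_nat_mult: "lookup (of_nat n * g) \<mu> = of_nat n * lookup g \<mu>"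
  for g :: "('v, 'r::comm_ring_1) mpoly"
  using lookup_const_mult[of "of_nat n" g \<mu>] by simp

text \<open>
  The polynomial ring \<open>k[x]\<close> and its lift \<open>W(k)[x]\<close> are related by reduction modulo \<open>p\<close> and by
  the coefficientwise Teichmueller section of it.
\<close>

definition red :: "('v, 'k::comm_ring_prime_char witt) mpoly \<Rightarrow> ('v, 'k) mpoly" where
  "red = Poly_Mapping.map (\<lambda>c. coord c 0)"

definition teich_lift :: "('v, 'k::comm_ring_prime_char) mpoly \<Rightarrow> ('v, 'k witt) mpoly" where
  "teich_lift = Poly_Mapping.map teichmueller"

lemma lookup_red: "lookup (red g) \<mu> = coord (lookup g \<mu>) 0"
  by (simp add: red_def lookup_map_zero)

lemma teichmueller_zero: "teichmueller 0 = 0"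
  by (rule witt_eqI) (simp add: teichmueller_def)

lemma coord_teichmueller: "coord (teichmueller c) i = (if i = 0 then c else 0)"
  by (simp add: teichmueller_def)

lemma red_teich_lift: "red (teich_lift a) = a"
  by (rule poly_mapping_eqI)
    (simp add: lookup_red teich_lift_def lookup_map_zero teichmueller_zero coord_teichmueller)

lemma teich_lift_zero: "teich_lift 0 = 0"
  by (rule poly_mapping_eqI) (simp add: teich_lift_def lookup_map_zero teichmueller_zero)

lemma red_single: "red (single \<mu> c) = single \<mu> (coord c 0)"
  by (simp add: red_def)

interpretation red: unital_hom "red :: ('v, 'k::comm_ring_prime_char witt) mpoly \<Rightarrow> _"
proof (rule unital_hom_poly_mappingI)
  interpret c: unital_hom "\<lambda>x :: 'k witt. coord x 0" by (rule unital_hom_coord_0)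
  show "red (f + g) = red f + red g" for f g :: "('v, 'k witt) mpoly"
    by (rule poly_mapping_eqI) (simp add: lookup_red lookup_add c.add)
  show "red (single \<mu> c * single \<nu> d) = red (single \<mu> c) * red (single \<nu> d)"
    for \<mu> \<nu> :: "'v monomial" and c d :: "'k witt"
    by (simp add: mult_single red_single c.mult)
  show "red (1 :: ('v, 'k witt) mpoly) = 1"
    using red_single[of "0 :: 'v monomial" "1 :: 'k witt"] by (simp add: coord_one)
qed

lemma frob_lift_superset:
  fixes g :: "('v, 'k::comm_ring_prime_char witt) mpoly"
  assumes "finite S" "keys g \<subseteq> S"
  shows "frob_lift g = (\<Sum>\<mu>\<in>S. single (scale_monomial CHAR('k) \<mu>) (witt_frob (lookup g \<mu>)))"
  unfolding frob_lift_def using assms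
  by (intro sum.mono_neutral_left)
    (auto simp: in_keys_iff unital_hom.zero[OF unital_hom_witt_frob])

lemma frob_lift_single:
  "frob_lift (single \<mu> c) = single (scale_monomial CHAR('k) \<mu>) (witt_frob c)"
  for c :: "'k::comm_ring_prime_char witt"
  using frob_lift_superset[of "{\<mu>}" "single \<mu> c"] by simp

interpretation frob_lift: unital_hom "frob_lift :: ('v, 'k::comm_ring_prime_char witt) mpoly \<Rightarrow> _"
proof (rule unital_hom_poly_mappingI)
  interpret F: unital_hom "witt_frob :: 'k witt \<Rightarrow> _" by (rule unital_hom_witt_frob)
  show "frob_lift (f + g) = frob_lift f + frob_lift g" for f g :: "('v, 'k witt) mpoly"
  proof -
    let ?S = "keys f \<union> keys g"
    have "keys (f + g) \<subseteq> ?S" by (rule keys_add)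
    then show ?thesis
      by (simp add: frob_lift_superset[of ?S] lookup_add F.add single_add sum.distrib)
  qed
  show "frob_lift (single \<mu> c * single \<nu> d) = frob_lift (single \<mu> c) * frob_lift (single \<nu> d)"
    for \<mu> \<nu> :: "'v monomial" and c d :: "'k witt"
    by (simp add: mult_single frob_lift_single F.mult scale_monomial_add)
  show "frob_lift (1 :: ('v, 'k witt) mpoly) = 1"
  proof -
    have "scale_monomial CHAR('k) (0 :: 'v monomial) = 0"
      by (rule poly_mapping_eqI) simp
    then show ?thesis
      using frob_lift_single[of "0 :: 'v monomial" "1 :: 'k witt"] by (simp add: F.one)
  qed
qed

lemma add_power_CHAR: "(f + g) ^ (CHAR('k) ^ e) = f ^ (CHAR('k) ^ e) + g ^ (CHAR('k) ^ e)"
  for f g :: "('v, 'k::comm_ring_prime_char) mpoly"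
  by (rule freshmans_dream') simp_all

lemma red_frob_lift: "red (frob_lift g) = red g ^ CHAR('k)"
  for g :: "('v, 'k::comm_ring_prime_char witt) mpoly"
proof (induction g rule: poly_mapping_add_induct)
  case zero
  then show ?case by (simp add: frob_lift.zero red.zero zero_power)
next
  case (single \<mu> c)
  then show ?case by (simp add: frob_lift_single red_single single_power)
next
  case (add f g)
  then show ?case using add_power_CHAR[of "red f" "red g" 1] by (simp add: frob_lift.add red.add)
qed

lemma unital_hom_funpow: "unital_hom h \<Longrightarrow> unital_hom (h ^^ n)" for h :: "'a::comm_ring_1 \<Rightarrow> 'a"
  by (induction n) (auto simp: unital_hom_def)

interpretation frob_pow: unital_hom "frob_lift ^^ n :: ('v, 'k::comm_ring_prime_char witt) mpoly \<Rightarrow> _" for n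
  by (intro unital_hom_funpow frob_lift.unital_hom_axioms)

lemma red_frob_pow: "red ((frob_lift ^^ n) g) = red g ^ (CHAR('k) ^ n)"
  for g :: "('v, 'k::comm_ring_prime_char witt) mpoly"
  by (induction n) (simp_all add: red_frob_lift flip: power_mult power_Suc2)

lemma red_of_nat_CHAR [simp]: "red (of_nat CHAR('k) * g) = 0"
  for g :: "('v, 'k::comm_ring_prime_char witt) mpoly"
proof -
  have "(of_nat CHAR('k) :: ('v, 'k) mpoly) = 0"
    by (simp add: of_nat_eq_0_iff_char_dvd)
  then show ?thesis by (simp add: red.mult red.of_nat)
qed


subsection \<open>Perfect coefficient fields\<close>

definition frob_root :: "nat \<Rightarrow> 'k::{alg_closed_field, field_prime_char} \<Rightarrow> 'k" where
  "frob_root e c = inv (\<lambda>x. x ^ (CHAR('k) ^ e)) c"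

lemma bij_frobenius: "bij (\<lambda>x::'k::{alg_closed_field, field_prime_char}. x ^ (CHAR('k) ^ e))"
proof (rule bijI)
  show "inj (\<lambda>x::'k. x ^ (CHAR('k) ^ e))"
  proof (rule injI)
    fix x y :: 'k
    assume "x ^ (CHAR('k) ^ e) = y ^ (CHAR('k) ^ e)"
    moreover have "(x - y + y) ^ (CHAR('k) ^ e) = (x - y) ^ (CHAR('k) ^ e) + y ^ (CHAR('k) ^ e)"
      by (rule freshmans_dream') simp_all
    ultimately show "x = y" by simp
  qed
  show "surj (\<lambda>x::'k. x ^ (CHAR('k) ^ e))"
    unfolding surj_def using nth_root_exists[of "CHAR('k) ^ e"] by (metis CHAR_pos zero_less_power)
qed

lemma frob_root_power [simp]: "frob_root e c ^ (CHAR('k) ^ e) = c"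
  for c :: "'k::{alg_closed_field, field_prime_char}"
  unfolding frob_root_def by (rule surj_f_inv_f) (rule bij_is_surj[OF bij_frobenius])

lemma frob_root_unique: "x ^ (CHAR('k) ^ e) = c \<Longrightarrow> frob_root e c = x"
  for c :: "'k::{alg_closed_field, field_prime_char}"
  unfolding frob_root_def by (rule inv_f_eq) (rule bij_is_inj[OF bij_frobenius])

lemma frob_root_zero [simp]: "frob_root e 0 = 0"
  by (rule frob_root_unique) (simp add: zero_power)

lemma frob_root_add: "frob_root e (c + d) = frob_root e c + frob_root e d"
  for c :: "'k::{alg_closed_field, field_prime_char}"
  by (rule frob_root_unique) (simp add: freshmans_dream')

lemma frob_root_mult: "frob_root e (c * d) = frob_root e c * frob_root e d"
  for c :: "'k::{alg_closed_field, field_prime_char}"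
  by (rule frob_root_unique) (simp add: power_mult_distrib)

lemma frob_root_root: "frob_root i (frob_root j c) = frob_root (i + j) c"
  for c :: "'k::{alg_closed_field, field_prime_char}"
  by (rule frob_root_unique[symmetric]) (simp add: power_add power_mult)

lemma frob_root_eq_0_iff [simp]: "frob_root e c = 0 \<longleftrightarrow> c = 0"
  for c :: "'k::{alg_closed_field, field_prime_char}"
  by (metis frob_root_power frob_root_zero zero_power CHAR_pos zero_less_power)

text \<open>
  Over a perfect field \<open>p\<close> acts on Witt vectors as an injective shift whose image consists of the
  vectors with vanishing zeroth coordinate. Hence \<open>W(k)[x]\<close> has no \<open>p\<close>-torsion and reduction has
  kernel \<open>p W(k)[x]\<close>, which is what makes division by powers of \<open>p\<close> meaningful below.
\<close>

lemma of_nat_CHAR_mult_witt_cancel: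
  fixes x y :: "'k::{alg_closed_field, field_prime_char} witt"
  assumes "of_nat CHAR('k) * x = of_nat CHAR('k) * y"
  shows "x = y"
proof (rule witt_eqI)
  fix i
  have "coord x i ^ CHAR('k) = coord y i ^ CHAR('k)"
    using assms unfolding of_nat_CHAR_mult_witt witt.inject by (auto dest: fun_cong[of _ _ "Suc i"])
  then show "coord x i = coord y i"
    using bij_is_inj[OF bij_frobenius[of 1]] by (auto dest: injD)
qed

lemma of_nat_CHAR_dvd_witt:
  fixes x :: "'k::{alg_closed_field, field_prime_char} witt"
  assumes "coord x 0 = 0"
  shows "\<exists>y. of_nat CHAR('k) * y = x"
proof
  have root: "frob_root (Suc 0) c ^ CHAR('k) = c" for c :: 'k
    using frob_root_power[of 1 c] by simp
  show "of_nat CHAR('k) * Witt (\<lambda>i. frob_root 1 (coord x (Suc i))) = x"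
    by (rule witt_eqI) (use assms in \<open>simp add: of_nat_CHAR_mult_witt root\<close>)
qed

lemma of_nat_CHAR_mult_cancel:
  fixes f g :: "('v, 'k::{alg_closed_field, field_prime_char} witt) mpoly"
  assumes "of_nat CHAR('k) * f = of_nat CHAR('k) * g"
  shows "f = g"
  by (rule poly_mapping_eqI)
    (metis assms lookup_of_nat_mult of_nat_CHAR_mult_witt_cancel)

lemma of_nat_CHAR_power_mult_cancel:
  fixes f g :: "('v, 'k::{alg_closed_field, field_prime_char} witt) mpoly"
  assumes "of_nat CHAR('k) ^ n * f = of_nat CHAR('k) ^ n * g"
  shows "f = g"
  using assms by (induction n) (auto simp: mult.assoc dest: of_nat_CHAR_mult_cancel)

lemma red_eq_0_iff:
  fixes g :: "('v, 'k::{alg_closed_field, field_prime_char} witt) mpoly"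
  shows "red g = 0 \<longleftrightarrow> of_nat CHAR('k) dvd g"
proof
  assume r: "red g = 0"
  define quot where "quot x = (SOME y. of_nat CHAR('k) * y = x)" for x :: "'k witt"
  have quot: "of_nat CHAR('k) * quot x = x" if "coord x 0 = 0" for x
    unfolding quot_def by (rule someI_ex) (rule of_nat_CHAR_dvd_witt[OF that])
  have quot0: "quot 0 = 0"
    by (rule of_nat_CHAR_mult_witt_cancel) (simp add: quot)
  have "g = of_nat CHAR('k) * Poly_Mapping.map quot g"
  proof (rule poly_mapping_eqI)
    fix \<mu>
    have "coord (lookup g \<mu>) 0 = 0"
      using arg_cong[OF r, of "\<lambda>f. lookup f \<mu>"] by (simp add: lookup_red)
    then show "lookup g \<mu> = lookup (of_nat CHAR('k) * Poly_Mapping.map quot g) \<mu>"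
      unfolding lookup_of_nat_mult lookup_map_zero[of quot, OF quot0] by (rule quot[symmetric])
  qed
  then show "of_nat CHAR('k) dvd g" by (rule dvdI)
qed (auto elim!: dvdE)

lemma red_eq_iff:
  fixes f g :: "('v, 'k::{alg_closed_field, field_prime_char} witt) mpoly"
  shows "red f = red g \<longleftrightarrow> of_nat CHAR('k) dvd f - g"
  unfolding red_eq_0_iff[symmetric] by (simp add: red.diff)

lemma CHAR_mult_delta:
  fixes g :: "('v, 'k::{alg_closed_field, field_prime_char} witt) mpoly"
  shows "of_nat CHAR('k) * delta g = g ^ CHAR('k) - frob_lift g"
proof -
  have "red (g ^ CHAR('k)) = red (frob_lift g)"
    by (simp add: red.power red_frob_lift)
  then obtain h where h: "of_nat CHAR('k) * h = g ^ CHAR('k) - frob_lift g"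
    unfolding red_eq_iff by (metis dvdE)
  show ?thesis
    unfolding delta_def
  proof (rule theI[of "\<lambda>h. of_nat CHAR('k) * h = g ^ CHAR('k) - frob_lift g", OF h])
    fix h'
    assume "of_nat CHAR('k) * h' = g ^ CHAR('k) - frob_lift g"
    with h show "h' = h" by (metis of_nat_CHAR_mult_cancel)
  qed
qed


section \<open>Iterated traces\<close>

definition const_monomial :: "nat \<Rightarrow> 'v::finite monomial" where
  "const_monomial c = Abs_poly_mapping (\<lambda>_. c)"

lemma lookup_const_monomial [simp]: "lookup (const_monomial c) v = c"
  by (simp add: const_monomial_def)

text \<open>
  The \<open>e\<close>-fold Cartier operator: the map inverse-linear for the \<open>p ^ e\<close>-th power Frobenius that
  sends the monomial with all exponents \<open>p ^ e - 1\<close> to \<open>1\<close> and the other monomials with exponents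
  below \<open>p ^ e\<close> to \<open>0\<close>.
\<close>

definition trace :: "nat \<Rightarrow> ('v::finite, 'k::{alg_closed_field, field_prime_char}) mpoly \<Rightarrow> ('v, 'k) mpoly" where
  "trace e g = Poly_Mapping.map (frob_root e) (Poly_Mapping.map_key
     (\<lambda>\<nu>. scale_monomial (CHAR('k) ^ e) \<nu> + const_monomial (CHAR('k) ^ e - 1)) g)"

lemma inj_scale_monomial: "c > 0 \<Longrightarrow> inj (\<lambda>\<nu> :: 'v monomial. scale_monomial c \<nu> + \<mu>)"
proof (rule injI)
  fix \<nu> \<nu>' :: "'v monomial"
  assume "c > 0" and eq: "scale_monomial c \<nu> + \<mu> = scale_monomial c \<nu>' + \<mu>"
  show "\<nu> = \<nu>'"
  proof (rule poly_mapping_eqI)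
    fix v
    have "c * lookup \<nu> v = c * lookup \<nu>' v"
      using arg_cong[OF eq, of "\<lambda>x. lookup x v"] by (simp add: lookup_add)
    then show "lookup \<nu> v = lookup \<nu>' v" using \<open>c > 0\<close> by simp
  qed
qed

lemma lookup_trace:
  fixes g :: "('v::finite, 'k::{alg_closed_field, field_prime_char}) mpoly"
  shows "lookup (trace e g) \<nu> =
    frob_root e (lookup g (scale_monomial (CHAR('k) ^ e) \<nu> + const_monomial (CHAR('k) ^ e - 1)))"
  unfolding trace_def lookup_map_zero[of "frob_root e", OF frob_root_zero]
  by (subst Poly_Mapping.map_key.rep_eq) (simp_all add: inj_scale_monomial)

lemma trace_add: "trace e (f + g) = trace e f + trace e g"
  by (rule poly_mapping_eqI) (simp add: lookup_trace lookup_add frob_root_add)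

lemma trace_zero [simp]: "trace e 0 = 0"
  by (rule poly_mapping_eqI) (simp add: lookup_trace)

lemma trace_uminus: "trace e (- g) = - trace e g"
  by (metis add_eq_0_iff2 trace_add trace_zero neg_eq_iff_add_eq_0)

lemma trace_diff: "trace e (f - g) = trace e f - trace e g"
  using trace_add[of e f "- g"] by (simp add: trace_uminus)

lemma trace_sum: "trace e (sum h S) = (\<Sum>s\<in>S. trace e (h s))"
  by (induction S rule: infinite_finite_induct) (simp_all add: trace_add)

lemma trace_trace: "trace i (trace j g) = trace (i + j) g"
  for g :: "('v::finite, 'k::{alg_closed_field, field_prime_char}) mpoly"
proof (rule poly_mapping_eqI)
  fix \<nu> :: "'v monomial"
  let ?p = "CHAR('k)"
  have arith: "b * (a * n + (a - Suc 0)) + (b - Suc 0) = a * b * n + (a * b - Suc 0)"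
    if "a > 0" "b > 0" for a b n :: nat
    using that by (cases a; cases b) (simp_all add: algebra_simps)
  have "scale_monomial (?p ^ j) (scale_monomial (?p ^ i) \<nu> + const_monomial (?p ^ i - 1)) + const_monomial (?p ^ j - 1)
     = scale_monomial (?p ^ (i + j)) \<nu> + const_monomial (?p ^ (i + j) - 1)"
    by (rule poly_mapping_eqI) (simp add: lookup_add power_add arith)
  then show "lookup (trace i (trace j g)) \<nu> = lookup (trace (i + j) g) \<nu>"
    by (simp add: lookup_trace frob_root_root)
qed

lemma trace_single:
  fixes c :: "'k::{alg_closed_field, field_prime_char}"
  shows "trace e (single \<mu> c) =
    (if \<forall>v. lookup \<mu> v mod CHAR('k) ^ e = CHAR('k) ^ e - 1
     then single (Poly_Mapping.map (\<lambda>n. n div CHAR('k) ^ e) \<mu>) (frob_root e c) else 0)"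
proof (rule poly_mapping_eqI)
  fix \<nu>
  let ?q = "CHAR('k) ^ e"
  have q: "?q > 0" by simp
  have "\<mu> = scale_monomial ?q \<nu> + const_monomial (?q - 1) \<longleftrightarrow>
      (\<forall>v. lookup \<mu> v mod ?q = ?q - 1) \<and> Poly_Mapping.map (\<lambda>n. n div ?q) \<mu> = \<nu>"
    (is "?l \<longleftrightarrow> ?r")
  proof
    assume ?l
    moreover have "(?q * n + (?q - Suc 0)) mod ?q = ?q - Suc 0" "(?q * n + (?q - Suc 0)) div ?q = n" for n
      using q by simp_all
    ultimately show ?r
      by (auto intro!: poly_mapping_eqI simp: lookup_add lookup_map_zero)
  next
    assume r: ?r
    show ?l
    proof (rule poly_mapping_eqI)
      fix v
      have "lookup \<nu> v = lookup \<mu> v div ?q" using r by (auto simp: lookup_map_zero)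
      then show "lookup \<mu> v = lookup (scale_monomial ?q \<nu> + const_monomial (?q - 1)) v"
        using r by (metis lookup_add lookup_scale_monomial lookup_const_monomial mult_div_mod_eq)
    qed
  qed
  then show "lookup (trace e (single \<mu> c)) \<nu> = lookup (if \<forall>v. lookup \<mu> v mod ?q = ?q - 1
     then single (Poly_Mapping.map (\<lambda>n. n div ?q) \<mu>) (frob_root e c) else 0) \<nu>"
    by (auto simp: lookup_trace lookup_single when_def)
qed

lemma trace_power_mult:
  fixes a g :: "('v::finite, 'k::{alg_closed_field, field_prime_char}) mpoly"
  shows "trace e (a ^ (CHAR('k) ^ e) * g) = a * trace e g"
proof -
  let ?q = "CHAR('k) ^ e"
  have q: "?q > 0" by simp
  have single: "trace e (single \<mu> c ^ ?q * single \<nu> d) = single \<mu> c * trace e (single \<nu> d)"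
    for \<mu> \<nu> :: "'v monomial" and c d :: 'k
  proof -
    have "Poly_Mapping.map (\<lambda>n. n div ?q) (scale_monomial ?q \<mu> + \<nu>)
        = \<mu> + Poly_Mapping.map (\<lambda>n. n div ?q) \<nu>"
      using q by (intro poly_mapping_eqI) (simp add: lookup_add lookup_map_zero)
    then show ?thesis
      by (simp add: trace_single single_power mult_single lookup_add frob_root_mult
          frob_root_unique[of c e "c ^ ?q"])
  qed
  have "trace e (single \<mu> c ^ ?q * g) = single \<mu> c * trace e g" for \<mu> :: "'v monomial" and c :: 'k
    by (induction g rule: poly_mapping_add_induct) (simp_all add: single trace_add distrib_left)
  then show ?thesis
    by (induction a rule: poly_mapping_add_induct)
      (simp_all add: zero_power add_power_CHAR distrib_right trace_add)
qed

text \<open>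
  The monomials with all exponents below \<open>q = p ^ e\<close> form a basis of the polynomial ring over
  its subring of \<open>q\<close>-th powers, and the trace pairing recovers the coordinates in this basis.
\<close>

definition reduced_monomials :: "nat \<Rightarrow> 'v::finite monomial set" where
  "reduced_monomials q = {\<mu>. \<forall>v. lookup \<mu> v < q}"

definition dual_monomial :: "nat \<Rightarrow> 'v::finite monomial \<Rightarrow> 'v monomial" where
  "dual_monomial q \<mu> = Abs_poly_mapping (\<lambda>v. q - 1 - lookup \<mu> v)"

lemma lookup_dual_monomial [simp]: "lookup (dual_monomial q \<mu>) v = q - 1 - lookup \<mu> v"
  by (simp add: dual_monomial_def)

lemma finite_reduced_monomials: "finite (reduced_monomials q :: 'v::finite monomial set)"
proof -
  have "lookup ` (reduced_monomials q :: 'v monomial set) \<subseteq> PiE UNIV (\<lambda>_. {..<q})"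
    by (auto simp: reduced_monomials_def)
  then have "finite (lookup ` (reduced_monomials q :: 'v monomial set))"
    by (rule finite_subset) (simp add: finite_PiE)
  then show ?thesis
    by (rule finite_imageD) (auto intro: inj_onI poly_mapping_eqI)
qed

lemma trace_basis:
  fixes e :: nat and g :: "('v::finite, 'k::{alg_closed_field, field_prime_char}) mpoly"
  defines "q \<equiv> CHAR('k) ^ e"
  shows "g = (\<Sum>\<mu>\<in>reduced_monomials q.
    trace e (g * single (dual_monomial q \<mu>) 1) ^ q * single \<mu> 1)"
proof (induction g rule: poly_mapping_add_induct)
  case zero
  then show ?case by (simp add: q_def zero_power)
next
  case (add f g)
  then show ?case
    by (simp add: distrib_right trace_add add_power_CHAR sum.distrib q_def)
next
  case (single \<kappa> c)
  have q: "q > 0" by (simp add: q_def)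
  define \<kappa>0 where "\<kappa>0 = Poly_Mapping.map (\<lambda>n. n mod q) \<kappa>"
  have \<kappa>0: "lookup \<kappa>0 v = lookup \<kappa> v mod q" for v
    by (simp add: \<kappa>0_def lookup_map_zero)
  have "trace e (single \<kappa> c * single (dual_monomial q \<mu>) 1) ^ q * single \<mu> 1
      = (if \<mu> = \<kappa>0 then single \<kappa> c else 0)" if "\<mu> \<in> reduced_monomials q" for \<mu>
  proof -
    have less: "lookup \<mu> v < q" for v using that by (simp add: reduced_monomials_def)
    have arith: "(n + (q - Suc m)) mod q = q - 1 \<longleftrightarrow> m = n mod q" if "m < q" for n m
    proof
      assume "m = n mod q"
      then have "n + (q - Suc m) = (q - 1) + q * (n div q)"
        using that mult_div_mod_eq[of q n] by linarith
      then have "(n + (q - Suc m)) mod q = (q - 1) mod q" by (simp only: mod_mult_self2)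
      then show "(n + (q - Suc m)) mod q = q - 1" using q by simp
    next
      assume "(n + (q - Suc m)) mod q = q - 1"
      then have "n + (q - Suc m) = q * ((n + (q - Suc m)) div q) + (q - 1)"
        by (metis mult_div_mod_eq)
      then have "n = m + q * ((n + (q - Suc m)) div q)" using that by linarith
      then show "m = n mod q" using that by (metis mod_less mod_mult_self2)
    qed
    have "lookup (\<kappa> + dual_monomial q \<mu>) v = lookup \<kappa> v + (q - Suc (lookup \<mu> v))" for v
      by (simp add: lookup_add)
    then have iff: "(\<forall>v. lookup (\<kappa> + dual_monomial q \<mu>) v mod q = q - 1) \<longleftrightarrow> \<mu> = \<kappa>0"
      by (simp only: arith[OF less] poly_mapping_eq_iff fun_eq_iff \<kappa>0)
    show ?thesis
    proof (cases "\<mu> = \<kappa>0")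
      case True
      have "scale_monomial q (Poly_Mapping.map (\<lambda>n. n div q) (\<kappa> + dual_monomial q \<mu>)) + \<mu> = \<kappa>"
      proof (rule poly_mapping_eqI)
        fix v
        define n where "n = lookup \<kappa> v"
        have "n + (q - 1 - n mod q) = (q - 1) + q * (n div q)"
          using mult_div_mod_eq[of q n] mod_less_divisor[OF q, of n] by linarith
        then have "(n + (q - 1 - n mod q)) div q = ((q - 1) + q * (n div q)) div q"
          by (simp only:)
        also have "\<dots> = n div q + (q - 1) div q"
          using q by (intro div_mult_self2) simp
        also have "(q - 1) div q = 0" using q by simp
        finally have "(n + (q - 1 - n mod q)) div q = n div q" by simp
        then show "lookup (scale_monomial q (Poly_Mapping.map (\<lambda>n. n div q) (\<kappa> + dual_monomial q \<mu>)) + \<mu>) v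
            = lookup \<kappa> v"
          by (simp add: True lookup_add lookup_map_zero \<kappa>0 flip: n_def)
      qed
      then show ?thesis
        using iff True by (simp add: trace_single mult_single single_power flip: q_def)
          (simp add: q_def)
    next
      case False
      then show ?thesis
        using iff q by (auto simp: trace_single mult_single zero_power simp flip: q_def)
    qed
  qed
  then have "(\<Sum>\<mu>\<in>reduced_monomials q. trace e (single \<kappa> c * single (dual_monomial q \<mu>) 1) ^ q * single \<mu> 1)
      = (\<Sum>\<mu>\<in>reduced_monomials q. if \<mu> = \<kappa>0 then single \<kappa> c else 0)"
    by (intro sum.cong) auto
  also have "\<dots> = single \<kappa> c"
  proof -
    have "\<kappa>0 \<in> reduced_monomials q" using q by (simp add: reduced_monomials_def \<kappa>0)
    then show ?thesis by (simp add: finite_reduced_monomials)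
  qed
  finally show ?case by simp
qed

text \<open>
  The trace pairing is perfect: a functional on the free module with basis the reduced monomials is
  determined by its values on them, and these are matched by pairing with the dual monomials.
\<close>

lemma trace_representable:
  fixes P :: "('v::finite, 'k::{alg_closed_field, field_prime_char}) mpoly \<Rightarrow> ('v, 'k) mpoly"
  assumes add: "\<And>a b. P (a + b) = P a + P b"
    and semilinear: "\<And>a b. P (a ^ (CHAR('k) ^ e) * b) = a * P b"
  shows "\<exists>g. \<forall>b. P b = trace e (g * b)"
proof (intro exI allI)
  fix b
  let ?q = "CHAR('k) ^ e" and ?B = "reduced_monomials (CHAR('k) ^ e) :: 'v monomial set"
  have zero: "P 0 = 0" using add[of 0 0] by simp
  have sum: "P (sum h S) = (\<Sum>s\<in>S. P (h s))" for h :: "'v monomial \<Rightarrow> _" and S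
    by (induction S rule: infinite_finite_induct) (simp_all add: zero add)
  have "P b = (\<Sum>\<mu>\<in>?B. P (trace e (b * single (dual_monomial ?q \<mu>) 1) ^ ?q * single \<mu> 1))"
    unfolding sum[symmetric] by (subst trace_basis[of b e]) (rule refl)
  also have "\<dots> = (\<Sum>\<mu>\<in>?B. trace e (P (single \<mu> 1) ^ ?q * (b * single (dual_monomial ?q \<mu>) 1)))"
    unfolding semilinear trace_power_mult by (simp add: mult.commute)
  also have "\<dots> = trace e ((\<Sum>\<mu>\<in>?B. P (single \<mu> 1) ^ ?q * single (dual_monomial ?q \<mu>) 1) * b)"
    unfolding sum_distrib_right trace_sum by (simp add: algebra_simps)
  finally show "P b = trace e ((\<Sum>\<mu>\<in>?B. P (single \<mu> 1) ^ ?q * single (dual_monomial ?q \<mu>) 1) * b)" .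
qed

lemma trace_dvd_imp_dvd:
  fixes f g :: "('v::finite, 'k::{alg_closed_field, field_prime_char}) mpoly"
  assumes "\<And>b. f dvd trace e (g * b)"
  shows "f ^ (CHAR('k) ^ e) dvd g"
proof -
  let ?q = "CHAR('k) ^ e" and ?B = "reduced_monomials (CHAR('k) ^ e) :: 'v monomial set"
  have "f ^ ?q dvd (\<Sum>\<mu>\<in>?B. trace e (g * single (dual_monomial ?q \<mu>) 1) ^ ?q * single \<mu> 1)"
    by (intro dvd_sum dvd_mult2 dvd_power_same assms)
  then show ?thesis using trace_basis[of g e] by simp
qed

lemma dvd_trace: "f ^ (CHAR('k) ^ e) dvd g \<Longrightarrow> f dvd trace e g"
  for f g :: "('v::finite, 'k::{alg_closed_field, field_prime_char}) mpoly"
  by (auto simp: trace_power_mult elim!: dvdE)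


section \<open>Homogeneous components\<close>

definition hom_part :: "('v::finite \<Rightarrow> nat) \<Rightarrow> nat \<Rightarrow> ('v, 'r::comm_ring_1) mpoly \<Rightarrow> ('v, 'r) mpoly" where
  "hom_part q D g = (\<Sum>\<mu>\<in>{\<mu> \<in> keys g. weighted_degree q \<mu> = D}. single \<mu> (lookup g \<mu>))"

definition homogeneous :: "('v::finite \<Rightarrow> nat) \<Rightarrow> nat \<Rightarrow> ('v, 'r::comm_ring_1) mpoly \<Rightarrow> bool" where
  "homogeneous q D g \<longleftrightarrow> (\<forall>\<mu>. lookup g \<mu> \<noteq> 0 \<longrightarrow> weighted_degree q \<mu> = D)"

lemma lookup_hom_part: "lookup (hom_part q D g) \<mu> = (if weighted_degree q \<mu> = D then lookup g \<mu> else 0)"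
  unfolding hom_part_def lookup_sum lookup_single
  by (auto simp: when_def in_keys_iff sum.delta')

lemma weighted_degree_add: "weighted_degree q (\<mu> + \<nu>) = weighted_degree q \<mu> + weighted_degree q \<nu>"
  by (simp add: weighted_degree_def lookup_add distrib_left sum.distrib)

lemma weighted_degree_scale: "weighted_degree q (scale_monomial c \<mu>) = c * weighted_degree q \<mu>"
  by (simp add: weighted_degree_def sum_distrib_left mult.left_commute)

lemma weighted_degree_const: "weighted_degree q (const_monomial c) = (\<Sum>j\<in>UNIV. q j) * c"
  by (simp add: weighted_degree_def sum_distrib_right)

lemma hom_part_add: "hom_part q D (f + g) = hom_part q D f + hom_part q D g"
  by (rule poly_mapping_eqI) (simp add: lookup_hom_part lookup_add)

lemma hom_part_zero [simp]: "hom_part q D 0 = 0"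
  by (rule poly_mapping_eqI) (simp add: lookup_hom_part)

lemma hom_part_single: "hom_part q D (single \<mu> c) = (if weighted_degree q \<mu> = D then single \<mu> c else 0)"
  by (rule poly_mapping_eqI) (auto simp: lookup_hom_part lookup_single when_def)

lemma homogeneous_iff: "homogeneous q D g \<longleftrightarrow> hom_part q D g = g"
  by (auto simp: homogeneous_def lookup_hom_part poly_mapping_eq_iff fun_eq_iff)

lemma homogeneous_hom_part: "homogeneous q D (hom_part q D g)"
  by (auto simp: homogeneous_def lookup_hom_part)

lemma hom_part_mult:
  assumes "homogeneous q D P"
  shows "hom_part q (D + E) (P * h) = P * hom_part q E h"
proof -
  have "hom_part q (D + E) (single \<mu> c * h) = single \<mu> c * hom_part q E h"
    if "weighted_degree q \<mu> = D" for \<mu> c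
    by (induction h rule: poly_mapping_add_induct)
      (simp_all add: hom_part_add distrib_left mult_single hom_part_single weighted_degree_add that)
  then have "hom_part q (D + E) (hom_part q D P * h) = hom_part q D P * hom_part q E h"
    by (induction P rule: poly_mapping_add_induct)
      (simp_all add: hom_part_add hom_part_single distrib_right)
  then show ?thesis using assms by (simp add: homogeneous_iff)
qed

lemma homogeneous_mult:
  "homogeneous q D f \<Longrightarrow> homogeneous q E g \<Longrightarrow> homogeneous q (D + E) (f * g)"
  by (metis hom_part_mult homogeneous_iff)

lemma homogeneous_one: "homogeneous q 0 1"
  by (auto simp: homogeneous_def lookup_one weighted_degree_def when_def)

lemma homogeneous_power: "homogeneous q D f \<Longrightarrow> homogeneous q (n * D) (f ^ n)"
  by (induction n) (auto intro: homogeneous_mult homogeneous_one)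

lemma homogeneous_add: "homogeneous q D f \<Longrightarrow> homogeneous q D g \<Longrightarrow> homogeneous q D (f + g)"
  by (simp add: homogeneous_iff hom_part_add)

lemma homogeneous_diff: "homogeneous q D f \<Longrightarrow> homogeneous q D g \<Longrightarrow> homogeneous q D (f - g)"
  unfolding homogeneous_def lookup_minus by (metis diff_0_right)

lemma hom_part_trace:
  fixes g :: "('v::finite, 'k::{alg_closed_field, field_prime_char}) mpoly"
  shows "hom_part q D (trace e g) =
    trace e (hom_part q (CHAR('k) ^ e * D + (\<Sum>j\<in>UNIV. q j) * (CHAR('k) ^ e - 1)) g)"
  by (rule poly_mapping_eqI)
    (simp add: lookup_hom_part lookup_trace weighted_degree_add weighted_degree_scale weighted_degree_const)

lemma hom_part_0:
  assumes "\<And>j. q j > 0"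
  shows "hom_part q 0 g = single 0 (lookup g 0)"
proof (rule poly_mapping_eqI)
  fix \<mu> :: "'a monomial"
  have "weighted_degree q \<mu> = 0 \<longleftrightarrow> \<mu> = 0"
    using assms by (simp add: weighted_degree_def poly_mapping_eq_iff fun_eq_iff) (metis less_irrefl)
  then show "lookup (hom_part q 0 g) \<mu> = lookup (single 0 (lookup g 0)) \<mu>"
    by (auto simp: lookup_hom_part lookup_single)
qed


section \<open>Witt vectors over a polynomial ring in ghost coordinates\<close>

text \<open>Congruence modulo \<open>p ^ (m + 1)\<close>, the precision at which the \<open>m\<close>-th ghost component of a
  lift depends only on the reduction of the lift.\<close>

definition pcong :: "nat \<Rightarrow> ('v, 'k::comm_ring_prime_char witt) mpoly \<Rightarrow> ('v, 'k witt) mpoly \<Rightarrow> bool" where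
  "pcong m x y \<longleftrightarrow> of_nat CHAR('k) ^ Suc m dvd x - y"

lemma pcong_refl [simp]: "pcong m x x"
  by (simp add: pcong_def)

lemma pcong_sym: "pcong m x y \<Longrightarrow> pcong m y x"
  unfolding pcong_def by (metis dvd_minus_iff minus_diff_eq)

lemma pcong_trans [trans]: "pcong m x y \<Longrightarrow> pcong m y z \<Longrightarrow> pcong m x z"
  unfolding pcong_def using dvd_add[of _ "x - y" "y - z"] by simp

lemma pcong_add: "pcong m x y \<Longrightarrow> pcong m x' y' \<Longrightarrow> pcong m (x + x') (y + y')"
  unfolding pcong_def by (metis add_diff_add dvd_add)

lemma pcong_diff: "pcong m x y \<Longrightarrow> pcong m x' y' \<Longrightarrow> pcong m (x - x') (y - y')"
  unfolding pcong_def using dvd_diff[of _ "x - y" "x' - y'"] by (simp add: algebra_simps)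

lemma pcong_mult: "pcong m x y \<Longrightarrow> pcong m x' y' \<Longrightarrow> pcong m (x * x') (y * y')"
  unfolding pcong_def by (metis mult_diff_mult dvd_add dvd_mult dvd_mult2)

lemma pcong_sum: "(\<And>s. s \<in> S \<Longrightarrow> pcong m (f s) (g s)) \<Longrightarrow> pcong m (sum f S) (sum g S)"
  by (induction S rule: infinite_finite_induct) (auto intro: pcong_add)

lemma pcong_frob_lift: "pcong m x y \<Longrightarrow> pcong m (frob_lift x) (frob_lift y)"
  unfolding pcong_def frob_lift.diff[symmetric]
  by (auto simp: frob_lift.mult frob_lift.power frob_lift.of_nat elim!: dvdE)

lemma red_pcong: "pcong m x y \<Longrightarrow> red x = red y"
proof -
  assume "pcong m x y"
  then obtain z where "x - y = of_nat CHAR('b) * (of_nat CHAR('b) ^ m * z)"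
    by (auto simp: pcong_def mult.assoc elim!: dvdE)
  then have "red (x - y) = 0" by (simp only: red_of_nat_CHAR)
  then show ?thesis by (simp add: red.diff)
qed

lemma pcong_zero_iff: "pcong m x 0 \<longleftrightarrow> of_nat CHAR('k) ^ Suc m dvd x"
  for x :: "('v, 'k::comm_ring_prime_char witt) mpoly"
  by (simp add: pcong_def)

lemma mpoly_power_CHAR_inject:
  fixes a b :: "('v::{finite, linorder}, 'k::field_prime_char) mpoly"
  assumes "a ^ (CHAR('k) ^ e) = b ^ (CHAR('k) ^ e)"
  shows "a = b"
proof -
  have "(a - b) ^ (CHAR('k) ^ e) + b ^ (CHAR('k) ^ e) = a ^ (CHAR('k) ^ e)"
    using add_power_CHAR[of "a - b" b e] by simp
  then show ?thesis using assms by simp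
qed

lemma ghost_char:
  assumes "of_nat p = (0::'r::comm_ring_1)"
  shows "ghost p m x = (x 0 :: 'r) ^ (p ^ m)"
proof -
  have "ghost p m x = (\<Sum>i\<le>m. if i = 0 then x 0 ^ (p ^ m) else 0)"
    unfolding ghost_def using assms by (intro sum.cong) (auto simp: zero_power)
  then show ?thesis by simp
qed

lemma red_ghost: "red (ghost CHAR('k) m x) = red (x 0) ^ (CHAR('k) ^ m)"
  for x :: "nat \<Rightarrow> ('v, 'k::comm_ring_prime_char witt) mpoly"
  unfolding red.ghost by (rule ghost_char) (simp add: of_nat_eq_0_iff_char_dvd)

lemma ghost_shift:
  "p > 0 \<Longrightarrow> x 0 = 0 \<Longrightarrow> ghost p (Suc m) x = of_nat p * ghost p m (\<lambda>i. x (Suc i))"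
  by (simp add: ghost_def sum.atMost_Suc_shift zero_power sum_distrib_left mult.assoc
      del: sum.atMost_Suc)

lemma ghost_cong:
  fixes x y :: "nat \<Rightarrow> ('v, 'k::{alg_closed_field, field_prime_char} witt) mpoly"
  assumes "\<And>i. i \<le> m \<Longrightarrow> red (x i) = red (y i)"
  shows "pcong m (ghost CHAR('k) m x) (ghost CHAR('k) m y)"
  unfolding ghost_def
proof (rule pcong_sum)
  fix i assume i: "i \<in> {..m}"
  then have "of_nat CHAR('k) dvd x i - y i" using assms by (simp add: red_eq_iff)
  from dvd_diff_power_prime_power[OF CHAR_prime this, of "m - i"]
  have "of_nat CHAR('k) ^ i * of_nat CHAR('k) ^ Suc (m - i) dvd
      of_nat CHAR('k) ^ i * (x i ^ CHAR('k) ^ (m - i) - y i ^ CHAR('k) ^ (m - i))"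
    by (rule mult_dvd_mono[OF dvd_refl])
  then show "pcong m (of_nat CHAR('k) ^ i * x i ^ CHAR('k) ^ (m - i))
      (of_nat CHAR('k) ^ i * y i ^ CHAR('k) ^ (m - i))"
    using i by (simp add: pcong_def right_diff_distrib flip: power_add power_Suc)
qed

text \<open>
  Modulo \<open>p\<close> the ghost component is a power of the zeroth coordinate, which therefore vanishes;
  replacing it by \<open>0\<close> leaves \<open>p\<close> times a shorter ghost component, and \<open>p\<close> can be cancelled.
\<close>

lemma ghost_pcong_zero:
  fixes x :: "nat \<Rightarrow> ('v::{finite, linorder}, 'k::{alg_closed_field, field_prime_char} witt) mpoly"
  assumes "pcong m (ghost CHAR('k) m x) 0" "i \<le> m"
  shows "red (x i) = 0"
  using assms
proof (induction m arbitrary: x i)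
  case 0
  then have "red (ghost CHAR('k) 0 x) = red 0" by (intro red_pcong[of 0])
  then show ?case using 0 by (simp add: red_ghost red.zero)
next
  case (Suc m)
  have "red (ghost CHAR('k) (Suc m) x) = red 0" by (intro red_pcong[of "Suc m"] Suc.prems)
  then have x0: "red (x 0) = 0" by (simp add: red_ghost red.zero)
  have "pcong (Suc m) (ghost CHAR('k) (Suc m) (x(0 := 0))) (ghost CHAR('k) (Suc m) x)"
    by (rule ghost_cong) (simp add: x0 red.zero)
  from pcong_trans[OF this Suc.prems(1)]
  have "of_nat CHAR('k) ^ Suc (Suc m) dvd of_nat CHAR('k) * ghost CHAR('k) m (\<lambda>i. x (Suc i))"
    by (simp add: pcong_zero_iff ghost_shift)
  then obtain z where "of_nat CHAR('k) * ghost CHAR('k) m (\<lambda>i. x (Suc i))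
      = of_nat CHAR('k) * (of_nat CHAR('k) ^ Suc m * z)"
    by (auto simp: mult.assoc elim!: dvdE)
  then have "pcong m (ghost CHAR('k) m (\<lambda>i. x (Suc i))) 0"
    unfolding pcong_zero_iff by (metis of_nat_CHAR_mult_cancel dvd_triv_left)
  from Suc.IH[OF this] x0 Suc.prems(2) show ?case by (cases i) auto
qed

text \<open>
  The ghost component of any lift gives a ring homomorphism from \<open>W(A)\<close> to \<open>W(k)[x]\<close> modulo
  \<open>p ^ (m + 1)\<close>. It is injective on Witt vectors of length \<open>m + 1\<close> and turns the Witt vector
  Frobenius into the Frobenius lift, so that linearity over \<open>W(A)\<close> can be checked in \<open>W(k)[x]\<close>.
\<close>

definition wval :: "nat \<Rightarrow> ('v, 'k::comm_ring_prime_char) mpoly witt \<Rightarrow> ('v, 'k witt) mpoly" where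
  "wval m a = ghost CHAR('k) m (\<lambda>i. teich_lift (coord a i))"

context
  fixes m :: nat
begin

lemma wval_pcong_ghost:
  fixes a :: "('v, 'k::{alg_closed_field, field_prime_char}) mpoly witt"
  assumes "\<And>i. i \<le> m \<Longrightarrow> red (x i) = coord a i"
  shows "pcong m (wval m a) (ghost CHAR('k) m x)"
  unfolding wval_def by (rule ghost_cong) (simp add: red_teich_lift assms)

lemma wval_add: "pcong m (wval m (a + b)) (wval m a + wval m b)"
  for a b :: "('v, 'k::{alg_closed_field, field_prime_char}) mpoly witt"
proof -
  have "pcong m (wval m (a + b)) (ghost CHAR('k) m
      (wadd CHAR('k) (\<lambda>i. teich_lift (coord a i)) (\<lambda>i. teich_lift (coord b i))))"
    by (rule wval_pcong_ghost) (simp add: red.wadd red_teich_lift coord_add)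
  then show ?thesis by (simp add: ghost_wadd wval_def)
qed

lemma wval_mult: "pcong m (wval m (a * b)) (wval m a * wval m b)"
  for a b :: "('v, 'k::{alg_closed_field, field_prime_char}) mpoly witt"
proof -
  have "pcong m (wval m (a * b)) (ghost CHAR('k) m
      (wmult CHAR('k) (\<lambda>i. teich_lift (coord a i)) (\<lambda>i. teich_lift (coord b i))))"
    by (rule wval_pcong_ghost) (simp add: red.wmult red_teich_lift coord_mult)
  then show ?thesis by (simp add: ghost_wmult wval_def)
qed

lemma wval_one: "pcong m (wval m (1 :: ('v, 'k::{alg_closed_field, field_prime_char}) mpoly witt)) 1"
proof -
  have "pcong m (wval m (1 :: ('v, 'k) mpoly witt)) (ghost CHAR('k) m wone)"
    by (rule wval_pcong_ghost) (simp add: wone_def coord_one red.one red.zero)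
  then show ?thesis by (simp add: ghost_wone)
qed

lemma wval_frob: "pcong m (wval m (witt_frob a)) (frob_lift (wval m a))"
  for a :: "('v, 'k::{alg_closed_field, field_prime_char}) mpoly witt"
proof -
  have "pcong m (wval m (witt_frob a)) (ghost CHAR('k) m (\<lambda>i. frob_lift (teich_lift (coord a i))))"
    by (rule wval_pcong_ghost) (simp add: red_frob_lift red_teich_lift)
  then show ?thesis by (simp add: wval_def frob_lift.ghost)
qed

lemma wval_pcong_zero: "pcong m (wval m a) 0 \<longleftrightarrow> (\<forall>i\<le>m. coord a i = 0)"
  for a :: "('v::{finite, linorder}, 'k::{alg_closed_field, field_prime_char}) mpoly witt"
proof
  assume "pcong m (wval m a) 0"
  then have "red (teich_lift (coord a i)) = 0" if "i \<le> m" for i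
    unfolding wval_def using that by (rule ghost_pcong_zero)
  then show "\<forall>i\<le>m. coord a i = 0" by (simp add: red_teich_lift)
next
  assume "\<forall>i\<le>m. coord a i = 0"
  then have "pcong m (wval m a) (ghost CHAR('k) m (\<lambda>_. 0))"
    by (intro wval_pcong_ghost) (simp add: red.zero)
  then show "pcong m (wval m a) 0" by (simp add: ghost_zero)
qed

lemma wval_diff: "pcong m (wval m (a - b)) (wval m a - wval m b)"
  for a b :: "('v, 'k::{alg_closed_field, field_prime_char}) mpoly witt"
proof -
  have "pcong m (wval m a) (wval m (a - b) + wval m b)"
    using wval_add[of "a - b" b] by simp
  from pcong_diff[OF this pcong_refl[of m "wval m b"]] show ?thesis
    by (simp add: pcong_sym)
qed

lemma wval_zero: "pcong m (wval m (0 :: ('v::{finite, linorder}, 'k::{alg_closed_field, field_prime_char}) mpoly witt)) 0"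
  by (simp add: wval_pcong_zero)

lemma wval_of_nat_mult: "pcong m (wval m (of_nat n * a)) (of_nat n * wval m a)"
  for a :: "('v::{finite, linorder}, 'k::{alg_closed_field, field_prime_char}) mpoly witt"
proof (induction n)
  case 0
  then show ?case using wval_zero by simp
next
  case (Suc n)
  have "pcong m (wval m (a + of_nat n * a)) (wval m a + wval m (of_nat n * a))"
    by (rule wval_add)
  also have "pcong m \<dots> (wval m a + of_nat n * wval m a)"
    by (intro pcong_add pcong_refl Suc)
  finally show ?case by (simp add: distrib_right)
qed

lemma wval_sum: "pcong m (wval m (sum f S)) (\<Sum>s\<in>S. wval m (f s))"
  for f :: "'s \<Rightarrow> ('v::{finite, linorder}, 'k::{alg_closed_field, field_prime_char}) mpoly witt"
proof (induction S rule: infinite_finite_induct)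
  case (insert s S)
  have "pcong m (wval m (f s + sum f S)) (wval m (f s) + wval m (sum f S))" by (rule wval_add)
  also have "pcong m \<dots> (wval m (f s) + (\<Sum>s\<in>S. wval m (f s)))"
    by (intro pcong_add pcong_refl insert)
  finally show ?case using insert by simp
qed (simp_all add: wval_zero)

end

text \<open>
  The ghost image of the Witt vectors of length \<open>m + 1\<close> consists of the sums
  \<open>\<Sum>i\<le>m. p ^ i * \<phi> ^ (m - i) (b i)\<close> for the Frobenius lift \<open>\<phi>\<close>.
\<close>

definition frob_sum :: "nat \<Rightarrow> (nat \<Rightarrow> ('v, 'k::comm_ring_prime_char witt) mpoly) \<Rightarrow> ('v, 'k witt) mpoly" where
  "frob_sum m b = (\<Sum>i\<le>m. of_nat CHAR('k) ^ i * (frob_lift ^^ (m - i)) (b i))"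

lemma frob_sum_add: "frob_sum m (\<lambda>i. b i + c i) = frob_sum m b + frob_sum m c"
  by (simp add: frob_sum_def frob_pow.add distrib_left sum.distrib)

lemma frob_sum_diff: "frob_sum m (\<lambda>i. b i - c i) = frob_sum m b - frob_sum m c"
  by (simp add: frob_sum_def frob_pow.diff right_diff_distrib sum_subtractf)

lemma frob_sum_Suc: "frob_sum (Suc m) b =
    (frob_lift ^^ Suc m) (b 0) + of_nat CHAR('k) * frob_sum m (\<lambda>i. b (Suc i))"
  for b :: "nat \<Rightarrow> ('v, 'k::comm_ring_prime_char witt) mpoly"
  unfolding frob_sum_def sum.atMost_Suc_shift sum_distrib_left
  by (simp add: mult.assoc del: funpow.simps)

lemma red_frob_sum: "red (frob_sum m b) = red (b 0) ^ (CHAR('k) ^ m)"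
  for b :: "nat \<Rightarrow> ('v, 'k::comm_ring_prime_char witt) mpoly"
  by (cases m) (simp add: frob_sum_def,
      simp add: frob_sum_Suc red.add red_frob_pow del: funpow.simps)

text \<open>
  The coefficients of the expansion of \<open>y ^ (p ^ j)\<close> in iterated Frobenius lifts of elements that
  depend on \<open>y\<close> but not on \<open>j\<close>; the coefficient with index \<open>1\<close> is \<open>delta y\<close>. The quotients are
  exact because \<open>y ^ p\<close> and \<open>frob_lift y\<close> agree modulo \<open>p\<close>.
\<close>

fun dwork :: "('v, 'k::comm_ring_prime_char witt) mpoly \<Rightarrow> nat \<Rightarrow> ('v, 'k witt) mpoly" where
  "dwork y 0 = y"
| "dwork y (Suc j) = (SOME h. of_nat CHAR('k) ^ Suc j * h
     = y ^ (CHAR('k) ^ Suc j) - frob_lift (y ^ (CHAR('k) ^ j)))"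

declare dwork.simps(2) [simp del]

lemma dwork_Suc:
  fixes y :: "('v, 'k::{alg_closed_field, field_prime_char} witt) mpoly"
  shows "of_nat CHAR('k) ^ Suc j * dwork y (Suc j)
    = y ^ (CHAR('k) ^ Suc j) - frob_lift (y ^ (CHAR('k) ^ j))"
proof -
  have "of_nat CHAR('k) dvd y ^ CHAR('k) - frob_lift y"
    by (simp add: red.power red_frob_lift flip: red_eq_iff)
  from dvd_diff_power_prime_power[OF CHAR_prime this, of j]
  have "\<exists>h. of_nat CHAR('k) ^ Suc j * h = y ^ (CHAR('k) ^ Suc j) - frob_lift (y ^ (CHAR('k) ^ j))"
    by (auto simp: frob_lift.power simp flip: power_mult elim!: dvdE)
  then show ?thesis unfolding dwork.simps(2) by (rule someI_ex)
qed

lemma frob_sum_Suc_top: "frob_sum (Suc m) b =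
    frob_lift (frob_sum m b) + of_nat CHAR('k) ^ Suc m * b (Suc m)"
  for b :: "nat \<Rightarrow> ('v, 'k::comm_ring_prime_char witt) mpoly"
  by (simp add: frob_sum_def frob_lift.sum frob_lift.mult frob_lift.power frob_lift.of_nat Suc_diff_le)

lemma power_eq_frob_sum_dwork:
  fixes y :: "('v, 'k::{alg_closed_field, field_prime_char} witt) mpoly"
  shows "y ^ (CHAR('k) ^ j) = frob_sum j (dwork y)"
proof (induction j)
  case 0
  then show ?case by (simp add: frob_sum_def)
next
  case (Suc j)
  show ?case unfolding frob_sum_Suc_top Suc[symmetric] dwork_Suc by simp
qed

lemma ghost_eq_frob_sum:
  fixes x :: "nat \<Rightarrow> ('v, 'k::{alg_closed_field, field_prime_char} witt) mpoly"
  shows "ghost CHAR('k) m x = frob_sum m (\<lambda>r. \<Sum>i\<le>r. dwork (x i) (r - i))"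
proof (induction m)
  case 0
  then show ?case by (simp add: ghost_def frob_sum_def)
next
  case (Suc m)
  have "ghost CHAR('k) (Suc m) x = frob_lift (ghost CHAR('k) m x)
      + of_nat CHAR('k) ^ Suc m * (\<Sum>i\<le>Suc m. dwork (x i) (Suc m - i))"
  proof -
    have "of_nat CHAR('k) ^ i * x i ^ (CHAR('k) ^ (Suc m - i))
        = of_nat CHAR('k) ^ i * frob_lift (x i ^ (CHAR('k) ^ (m - i)))
        + of_nat CHAR('k) ^ Suc m * dwork (x i) (Suc m - i)" if "i \<le> m" for i
    proof -
      have "(of_nat CHAR('k) :: ('v, 'k witt) mpoly) ^ Suc m = of_nat CHAR('k) ^ i * of_nat CHAR('k) ^ Suc (m - i)"
        using that by (simp flip: power_add power_Suc)
      then show ?thesis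
        using dwork_Suc[of "m - i" "x i"] that
        by (simp only: mult.assoc Suc_diff_le) (simp add: algebra_simps)
    qed
    then have "(\<Sum>i\<le>m. of_nat CHAR('k) ^ i * x i ^ (CHAR('k) ^ (Suc m - i)))
        = (\<Sum>i\<le>m. of_nat CHAR('k) ^ i * frob_lift (x i ^ (CHAR('k) ^ (m - i)))
        + of_nat CHAR('k) ^ Suc m * dwork (x i) (Suc m - i))"
      by (intro sum.cong) auto
    then show ?thesis
      by (simp add: ghost_def frob_lift.sum frob_lift.mult frob_lift.power frob_lift.of_nat
          sum.distrib sum_distrib_left distrib_left add.assoc)
  qed
  then show ?case by (simp only: Suc frob_sum_Suc_top)
qed

lemma wval_eq_frob_sum:
  fixes a :: "('v, 'k::{alg_closed_field, field_prime_char}) mpoly witt"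
  shows "\<exists>b. wval m a = frob_sum m b \<and> red (b 0) = coord a 0"
  unfolding wval_def ghost_eq_frob_sum by (intro exI conjI, rule refl) (simp add: red_teich_lift)

lemma teichmueller_power: "teichmueller c ^ n = teichmueller (c ^ n)"
proof (induction n)
  case 0
  then show ?case by (intro witt_eqI) (simp add: coord_one coord_teichmueller)
next
  case (Suc n)
  have "teichmueller c * teichmueller d = teichmueller (c * d)" for d
    unfolding teichmueller_mult by (rule witt_eqI) (simp add: coord_teichmueller)
  then show ?case by (simp add: Suc)
qed

lemma frob_lift_teichmueller_monomial:
  "(frob_lift ^^ n) (single \<mu> (teichmueller c)) = single \<mu> (teichmueller c) ^ (CHAR('k) ^ n)"
  for c :: "'k::comm_ring_prime_char"
proof (induction n)
  case (Suc n)
  have "frob_lift (single \<mu> (teichmueller c)) = single \<mu> (teichmueller c) ^ CHAR('k)"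
    unfolding frob_lift_single single_power teichmueller_power
    by (rule arg_cong[where f = "single _"], rule witt_eqI) (simp add: coord_teichmueller zero_power)
  then show ?case by (simp add: Suc frob_lift.power flip: power_mult)
qed simp

text \<open>
  On a monomial with Teichmueller coefficient the Frobenius lift is the \<open>p\<close>-th power map, so the
  ghost component of a Witt vector concentrated in one place is already of the required shape. The
  remaining terms are divisible by \<open>p\<close> and hence belong to the next index \<open>i + 1\<close>.
\<close>

lemma wval_surj_aux:
  fixes b :: "('v::{finite, linorder}, 'k::{alg_closed_field, field_prime_char} witt) mpoly"
  assumes "i \<le> Suc m"
  shows "\<exists>a. pcong m (wval m a) (of_nat CHAR('k) ^ i * (frob_lift ^^ (m - i)) b)"
  using assms
proof (induction i arbitrary: b rule: inc_induct)
  case base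
  show ?case
    by (rule exI[of _ 0], rule pcong_trans[OF wval_zero])
      (simp add: pcong_sym pcong_zero_iff flip: power_Suc)
next
  case (step i)
  let ?t = "\<lambda>b :: ('v, 'k witt) mpoly. of_nat CHAR('k) ^ i * (frob_lift ^^ (m - i)) b"
  have add: "\<exists>a. pcong m (wval m a) (?t (b + c))"
    if "\<exists>a. pcong m (wval m a) (?t b)" "\<exists>a. pcong m (wval m a) (?t c)" for b c
  proof -
    from that obtain a a' where "pcong m (wval m a) (?t b)" "pcong m (wval m a') (?t c)" by blast
    then have "pcong m (wval m (a + a')) (?t b + ?t c)"
      using wval_add pcong_add pcong_trans by blast
    then show ?thesis by (auto simp: frob_pow.add distrib_left)
  qed
  have single: "\<exists>a. pcong m (wval m a) (?t (single \<mu> c))" for \<mu> c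
  proof -
    have "coord (c - teichmueller (coord c 0)) 0 = 0"
      by (simp add: unital_hom.diff[OF unital_hom_coord_0] coord_teichmueller)
    then obtain c' where "c - teichmueller (coord c 0) = of_nat CHAR('k) * c'"
      using of_nat_CHAR_dvd_witt by metis
    then have "c = teichmueller (coord c 0) + of_nat CHAR('k) * c'" by (simp add: algebra_simps)
    then have "single \<mu> c = single \<mu> (teichmueller (coord c 0) + of_nat CHAR('k) * c')" by simp
    also have "\<dots> = single \<mu> (teichmueller (coord c 0)) + of_nat CHAR('k) * single \<mu> c'"
      using mult_single[of 0 "of_nat CHAR('k)" \<mu> c'] by (simp add: single_add)
    finally have c: "single \<mu> c = single \<mu> (teichmueller (coord c 0)) + of_nat CHAR('k) * single \<mu> c'" .
    show ?thesis
      unfolding c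
    proof (rule add)
      define a where "a = Witt (\<lambda>j. if j = i then single \<mu> (coord c 0) else 0)"
      have "pcong m (wval m a)
          (ghost CHAR('k) m (\<lambda>j. if j = i then single \<mu> (teichmueller (coord c 0)) else 0))"
        by (rule wval_pcong_ghost) (simp add: a_def red_single red.zero coord_teichmueller)
      also have "ghost CHAR('k) m (\<lambda>j. if j = i then single \<mu> (teichmueller (coord c 0)) else 0)
          = ?t (single \<mu> (teichmueller (coord c 0)))"
        using step.hyps by (simp add: ghost_single frob_lift_teichmueller_monomial)
      finally show "\<exists>a. pcong m (wval m a) (?t (single \<mu> (teichmueller (coord c 0))))" ..
      define d where "d = (if i < m then frob_lift (single \<mu> c') else single \<mu> c')"
      have "?t (of_nat CHAR('k) * single \<mu> c') = of_nat CHAR('k) ^ Suc i * (frob_lift ^^ (m - Suc i)) d"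
      proof (cases "i < m")
        case True
        then have "m - i = Suc (m - Suc i)" by simp
        then show ?thesis
          by (simp add: d_def True frob_pow.mult frob_pow.of_nat frob_lift.mult frob_lift.of_nat
              funpow_swap1 mult_ac)
      next
        case False
        then show ?thesis by (simp add: d_def mult_ac)
      qed
      then show "\<exists>a. pcong m (wval m a) (?t (of_nat CHAR('k) * single \<mu> c'))"
        using step.IH[of d] by simp
    qed
  qed
  have zero: "\<exists>a. pcong m (wval m a) (?t 0)"
    using wval_zero[of m] by (auto simp: frob_pow.zero)
  show ?case
    by (induction b rule: poly_mapping_add_induct) (fact zero single add)+
qed

lemma wval_surj:
  fixes b :: "nat \<Rightarrow> ('v::{finite, linorder}, 'k::{alg_closed_field, field_prime_char} witt) mpoly"
  shows "\<exists>a. pcong m (wval m a) (frob_sum m b)"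
proof -
  have "\<forall>i. \<exists>a. i \<le> m \<longrightarrow> pcong m (wval m a) (of_nat CHAR('k) ^ i * (frob_lift ^^ (m - i)) (b i))"
    using wval_surj_aux by (metis le_SucI)
  then obtain a where "\<And>i. i \<le> m \<Longrightarrow> pcong m (wval m (a i)) (of_nat CHAR('k) ^ i * (frob_lift ^^ (m - i)) (b i))"
    by metis
  then have "pcong m (\<Sum>i\<le>m. wval m (a i)) (frob_sum m b)"
    unfolding frob_sum_def by (intro pcong_sum) simp
  then show ?thesis using wval_sum[of m a "{..m}"] pcong_trans by blast
qed

lemma coord_0_eq_red:
  fixes a :: "('v::{finite, linorder}, 'k::{alg_closed_field, field_prime_char}) mpoly witt"
  assumes "pcong m (wval m a) (frob_sum m b)"
  shows "coord a 0 = red (b 0)"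
proof -
  have "coord a 0 ^ (CHAR('k) ^ m) = red (b 0) ^ (CHAR('k) ^ m)"
    using red_pcong[OF assms] by (simp add: wval_def red_ghost red_teich_lift red_frob_sum)
  then show ?thesis by (rule mpoly_power_CHAR_inject)
qed


section \<open>Clearing denominators in the splitting condition\<close>

text \<open>
  A splitting of \<open>W\<^sub>n(A)(p D\<^sub>n)\<close> restricts to \<open>W\<^sub>n(A)\<close>, and multiplication by
  the scalar \<open>[f]\<close>, which acts as \<open>[f ^ p]\<close>, carries \<open>W\<^sub>n(A)(p D\<^sub>n)\<close> into \<open>W\<^sub>n(A)\<close>. Its
  image is cut out by the divisibility conditions in the last clause.
\<close>

definition witt_splitting :: "nat \<Rightarrow> 'a::idom_prime_char \<Rightarrow> ('a witt \<Rightarrow> 'a) \<Rightarrow> bool" where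
  "witt_splitting n f \<psi> \<longleftrightarrow>
     (\<forall>x y. \<psi> (x + y) = \<psi> x + \<psi> y) \<and>
     (\<forall>w x. \<psi> (witt_frob w * x) = coord w 0 * \<psi> x) \<and>
     \<psi> 1 = 1 \<and>
     (\<forall>x. (\<forall>i<n. coord x i = 0) \<longrightarrow> \<psi> x = 0) \<and>
     (\<forall>x. (\<forall>i. i + 1 < n \<longrightarrow> f dvd coord x i) \<and> f\<^sup>2 dvd coord x (n - 1) \<longrightarrow> f dvd \<psi> x)"

lemma unital_hom_to_frac: "unital_hom to_frac"
  by standard (simp_all add: to_frac_def One_fract_def)

interpretation to_frac: unital_hom to_frac
  by (rule unital_hom_to_frac)

lemma to_frac_inject: "to_frac a = to_frac b \<longleftrightarrow> a = b"
  by (simp add: to_frac_def eq_fract)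

lemma to_frac_eq_0_iff: "to_frac a = 0 \<longleftrightarrow> a = 0"
  by (metis to_frac_inject to_frac.zero)

abbreviation witt_frac :: "'a::idom_prime_char witt \<Rightarrow> 'a fract witt" where
  "witt_frac \<equiv> map_witt to_frac"

interpretation witt_frac: unital_hom "witt_frac :: 'a::idom_prime_char witt \<Rightarrow> _"
  by (intro unital_hom_map_witt unital_hom_to_frac) simp

lemma witt_trunc_one: "n \<ge> 1 \<Longrightarrow> witt_trunc n 1 = 1"
  by (rule witt_trunc_id) (simp add: witt_len_def coord_one)

lemma witt_frac_trunc_in_pD: "witt_frac (witt_trunc n x) \<in> witt_pD n f"
proof -
  have "to_frac f ^ e * to_frac a \<in> range to_frac" for e a
    by (auto simp flip: to_frac.power to_frac.mult)
  then show ?thesis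
    by (simp add: witt_pD_def witt_len_def coord_witt_trunc to_frac.zero)
qed

lemma coord_diff_trunc:
  assumes "i < n"
  shows "coord (x - witt_trunc n x) i = 0"
proof -
  have "witt_trunc n (x + - witt_trunc n x) = witt_trunc n (witt_trunc n x + - witt_trunc n x)"
    by (metis witt_trunc_add witt_trunc_trunc)
  then show ?thesis using assms by (simp add: witt_trunc_eq_iff)
qed

lemma two_le_CHAR_power:
  assumes "n \<ge> 1"
  shows "2 \<le> CHAR('a::semiring_prime_char) ^ n"
proof -
  have "2 \<le> CHAR('a)" by (intro prime_ge_2_nat) simp
  moreover have "CHAR('a) ^ 1 \<le> CHAR('a) ^ n" using assms by (intro power_increasing) (simp_all add: Suc_leI)
  ultimately show ?thesis by simp
qed

text \<open>
  The last clause of a splitting holds because a Witt vector with these divisibilities is \<open>[f ^ p]\<close>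
  times an element \<open>y\<close> of \<open>W\<^sub>n(A)(p D\<^sub>n)\<close>, and \<open>[f ^ p]\<close> is the Frobenius of \<open>[f]\<close>, so that
  linearity gives \<open>f\<close> times the value at \<open>y\<close>.
\<close>

lemma witt_splitting_of_quasi_F_split:
  fixes f :: "'a::idom_prime_char"
  assumes "f \<noteq> 0" "n \<ge> 1" "quasi_F_split n f"
  shows "\<exists>\<psi>. witt_splitting n f \<psi>"
proof -
  let ?p = "CHAR('a)"
  obtain \<phi> :: "'a fract witt \<Rightarrow> 'a" where
    add: "\<And>x y. x \<in> witt_pD n f \<Longrightarrow> y \<in> witt_pD n f \<Longrightarrow> \<phi> (witt_trunc n (x + y)) = \<phi> x + \<phi> y"
    and lin: "\<And>w x. w \<in> witt_len n \<Longrightarrow> x \<in> witt_pD n f \<Longrightarrow>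
        \<phi> (witt_trunc n (witt_frac (witt_frob w) * x)) = coord w 0 * \<phi> x"
    and one: "\<phi> 1 = 1"
    using assms(3) unfolding quasi_F_split_def by blast
  define \<psi> where "\<psi> x = \<phi> (witt_frac (witt_trunc n x))" for x
  have "witt_splitting n f \<psi>"
    unfolding witt_splitting_def
  proof (intro conjI allI impI)
    fix x y :: "'a witt"
    have "witt_frac (witt_trunc n (x + y))
        = witt_trunc n (witt_frac (witt_trunc n x) + witt_frac (witt_trunc n y))"
      by (simp add: witt_trunc_map to_frac.zero witt_trunc_add flip: witt_frac.add)
    then show "\<psi> (x + y) = \<psi> x + \<psi> y"
      by (simp add: \<psi>_def add witt_frac_trunc_in_pD)
  next
    fix w x :: "'a witt"
    have "witt_frac (witt_trunc n (witt_frob w * x))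
        = witt_trunc n (witt_frac (witt_frob (witt_trunc n w)) * witt_frac (witt_trunc n x))"
      by (simp add: witt_trunc_map to_frac.zero witt_trunc_mult flip: witt_frac.mult witt_trunc_frob)
    then show "\<psi> (witt_frob w * x) = coord w 0 * \<psi> x"
      using assms(2) by (simp add: \<psi>_def lin witt_frac_trunc_in_pD witt_trunc_in_len coord_witt_trunc)
  next
    show "\<psi> 1 = 1"
      using assms(2) by (simp add: \<psi>_def witt_trunc_one witt_frac.one one)
  next
    fix x :: "'a witt"
    assume "\<forall>i<n. coord x i = 0"
    then have x: "witt_trunc n x = 0" by (intro witt_eqI) (simp add: coord_witt_trunc)
    have zero: "witt_trunc n 0 = 0" by (rule witt_eqI) (simp add: coord_witt_trunc)
    have "\<phi> (witt_trunc n (0 + 0)) = \<phi> 0 + \<phi> 0"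
      using witt_frac_trunc_in_pD[of n x f] by (intro add) (simp_all add: x witt_frac.zero)
    then have "\<phi> 0 = \<phi> 0 + \<phi> 0" by (simp only: zero add_0_left)
    then have "\<phi> 0 = 0" by (metis add_cancel_right_right)
    then show "\<psi> x = 0" by (simp add: \<psi>_def x witt_frac.zero)
  next
    fix x :: "'a witt"
    assume x: "(\<forall>i. i + 1 < n \<longrightarrow> f dvd coord x i) \<and> f\<^sup>2 dvd coord x (n - 1)"
    have f0: "to_frac f \<noteq> 0" using assms(1) by (simp add: to_frac_eq_0_iff)
    define y where "y = Witt (\<lambda>i. if i < n then to_frac (coord x i) / to_frac f ^ (?p ^ (i + 1)) else 0)"
    have quot: "to_frac f ^ (e - c) * (to_frac a / to_frac f ^ e) \<in> range to_frac"
      if "f ^ c dvd a" "c \<le> e" for a c e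
    proof -
      obtain t where "a = f ^ c * t" using \<open>f ^ c dvd a\<close> ..
      moreover have "to_frac f ^ e = to_frac f ^ (e - c) * to_frac f ^ c"
        using that by (simp flip: power_add)
      ultimately have "to_frac f ^ (e - c) * (to_frac a / to_frac f ^ e) = to_frac t"
        using f0 by (simp add: to_frac.mult to_frac.power field_simps)
      then show ?thesis by simp
    qed
    have y: "y \<in> witt_pD n f"
      using x assms(2) two_le_CHAR_power[where ?'a = 'a, OF assms(2)] quot[of 1] quot[of 2 "coord x (n - 1)" "?p ^ n"]
      by (auto simp: witt_pD_def witt_len_def y_def Suc_leI)
    have "witt_frac (witt_frob (teichmueller f)) = teichmueller (to_frac f ^ ?p)"
      by (rule witt_eqI) (simp add: coord_teichmueller to_frac.power to_frac.zero zero_power)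
    then have "witt_trunc n (witt_frac (witt_frob (teichmueller f)) * y) = witt_frac (witt_trunc n x)"
      using f0 by (intro witt_eqI)
        (simp add: teichmueller_mult y_def coord_witt_trunc to_frac.zero flip: power_mult power_Suc)
    then have "\<psi> x = f * \<phi> y"
      using lin[OF _ y, of "teichmueller f"] assms(2)
      by (simp add: \<psi>_def witt_len_def coord_teichmueller)
    then show "f dvd \<psi> x" by simp
  qed
  then show ?thesis by blast
qed

text \<open>
  Conversely, multiplying by \<open>[f ^ p]\<close> clears denominators, and dividing the value by \<open>f\<close>
  afterwards compensates for this.
\<close>

lemma quasi_F_split_of_witt_splitting:
  fixes f :: "'a::idom_prime_char"
  assumes "f \<noteq> 0" "n \<ge> 1" "witt_splitting n f \<psi>"
  shows "quasi_F_split n f"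
proof -
  let ?p = "CHAR('a)"
  have add: "\<psi> (x + y) = \<psi> x + \<psi> y"
    and lin: "\<psi> (witt_frob w * x) = coord w 0 * \<psi> x" and one: "\<psi> 1 = 1"
    and vanish: "(\<And>i. i < n \<Longrightarrow> coord x i = 0) \<Longrightarrow> \<psi> x = 0"
    and dvd: "(\<And>i. i + 1 < n \<Longrightarrow> f dvd coord x i) \<Longrightarrow> f\<^sup>2 dvd coord x (n - 1) \<Longrightarrow> f dvd \<psi> x" for w x y
    using assms(3) unfolding witt_splitting_def by auto
  have f0: "to_frac f \<noteq> 0" using assms(1) by (simp add: to_frac_eq_0_iff)
  define T where "T = teichmueller (f ^ ?p)"
  have T_mult: "witt_frac T * u = Witt (\<lambda>i. to_frac f ^ (?p ^ (i + 1)) * coord u i)" for u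
  proof -
    have "witt_frac T = teichmueller (to_frac f ^ ?p)"
      by (rule witt_eqI) (simp add: T_def coord_teichmueller to_frac.power to_frac.zero)
    then show ?thesis by (simp add: teichmueller_mult flip: power_mult)
  qed
  define num where "num u = Witt (\<lambda>i. SOME a. to_frac a = coord (witt_frac T * u) i)" for u
  have num_eqI: "num u = z" if "witt_frac z = witt_frac T * u" for u z
    by (rule witt_eqI) (simp add: num_def to_frac_inject flip: that)
  have \<psi>_trunc: "\<psi> (witt_trunc n z) = \<psi> z" for z
    using add[of "z - witt_trunc n z" "witt_trunc n z"] vanish[OF coord_diff_trunc] by simp
  have \<psi>_num: "\<psi> (num (witt_trunc n u)) = \<psi> z" if "witt_frac z = witt_frac T * u" for u z
  proof -
    have "witt_frac (witt_trunc n z) = witt_frac T * witt_trunc n u"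
      using that[THEN arg_cong, of "\<lambda>x. coord x _"]
      by (intro witt_eqI) (simp add: T_mult coord_witt_trunc to_frac.zero)
    from num_eqI[OF this] show ?thesis by (simp add: \<psi>_trunc)
  qed
  have num: "witt_frac (num x) = witt_frac T * x" "f dvd \<psi> (num x)" if "x \<in> witt_pD n f" for x
  proof -
    have p2: "2 \<le> ?p ^ n" by (rule two_le_CHAR_power[OF assms(2)])
    have ex: "\<exists>a. to_frac (f ^ (if i + 1 < n then 1 else 2) * a) = to_frac f ^ (?p ^ (i + 1)) * coord x i" for i
    proof (cases "i < n")
      case True
      define c :: nat where "c = (if i + 1 < n then 1 else 2)"
      have "to_frac f ^ (?p ^ (i + 1) - c) * coord x i \<in> range to_frac"
      proof (cases "i + 1 < n")
        case False
        with True have "i = n - 1" "n = i + 1" by auto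
        then show ?thesis using that False unfolding witt_pD_def c_def by force
      qed (use that in \<open>auto simp: witt_pD_def c_def\<close>)
      then obtain a where "to_frac a = to_frac f ^ (?p ^ (i + 1) - c) * coord x i" by (metis imageE)
      moreover have "c \<le> ?p ^ (i + 1)"
      proof (cases "i + 1 < n")
        case False
        with True have "n = i + 1" by simp
        then show ?thesis using p2 False by (simp add: c_def)
      qed (simp add: c_def Suc_leI)
      then have "to_frac f ^ (?p ^ (i + 1)) = to_frac f ^ c * to_frac f ^ (?p ^ (i + 1) - c)"
        by (simp flip: power_add)
      ultimately have "to_frac (f ^ c * a) = to_frac f ^ (?p ^ (i + 1)) * coord x i"
        by (simp add: to_frac.mult to_frac.power)
      then show ?thesis unfolding c_def ..
    next
      case False
      then have "to_frac (f ^ (if i + 1 < n then 1 else 2) * 0) = to_frac f ^ (?p ^ (i + 1)) * coord x i"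
        using that by (simp add: witt_pD_def witt_len_def to_frac.zero)
      then show ?thesis ..
    qed
    then obtain a where a: "\<And>i. to_frac (f ^ (if i + 1 < n then 1 else 2) * a i)
        = to_frac f ^ (?p ^ (i + 1)) * coord x i" by metis
    define z where "z = Witt (\<lambda>i. f ^ (if i + 1 < n then 1 else 2) * a i)"
    have z: "witt_frac z = witt_frac T * x"
      unfolding T_mult by (rule witt_eqI) (simp only: z_def coord_map_witt witt.sel a)
    then show "witt_frac (num x) = witt_frac T * x" by (simp add: num_eqI)
    have "f dvd \<psi> z"
      by (rule dvd) (simp_all add: z_def)
    then show "f dvd \<psi> (num x)" by (simp add: num_eqI[OF z])
  qed
  have trunc_pD: "witt_trunc n x = x" if "x \<in> witt_pD n f" for x
    using that by (intro witt_trunc_id) (simp add: witt_pD_def)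
  define \<phi> where "\<phi> u = (SOME t. \<psi> (num u) = f * t)" for u
  have \<phi>_eqI: "\<phi> u = t" if "\<psi> (num u) = f * t" for u t
    unfolding \<phi>_def using that assms(1) by auto
  have \<phi>: "\<psi> (num x) = f * \<phi> x" if "x \<in> witt_pD n f" for x
    using num(2)[OF that] \<phi>_eqI by (auto elim!: dvdE)
  show ?thesis
    unfolding quasi_F_split_def
  proof (intro exI[of _ \<phi>] conjI ballI)
    fix x y assume xy: "x \<in> witt_pD n f" "y \<in> witt_pD n f"
    have "witt_frac (num x + num y) = witt_frac T * (x + y)"
      using xy by (simp add: num witt_frac.add distrib_left)
    from \<psi>_num[OF this] show "\<phi> (witt_trunc n (x + y)) = \<phi> x + \<phi> y"
      using xy by (intro \<phi>_eqI) (simp add: add \<phi> distrib_left)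
  next
    fix w :: "'a witt" and x assume x: "x \<in> witt_pD n f"
    have "witt_frac (witt_frob w * num x) = witt_frac T * (witt_frac (witt_frob w) * x)"
      using x by (simp add: num witt_frac.mult mult.left_commute)
    from \<psi>_num[OF this] show "\<phi> (witt_trunc n (witt_frac (witt_frob w) * x)) = coord w 0 * \<phi> x"
      using x by (intro \<phi>_eqI) (simp add: lin \<phi>)
  next
    have "T = witt_frob (teichmueller f)"
      by (rule witt_eqI) (simp add: T_def coord_teichmueller zero_power)
    then have "\<psi> T = f" using lin[of "teichmueller f" 1] by (simp add: one coord_teichmueller)
    then show "\<phi> 1 = 1" using num_eqI[of T 1] by (intro \<phi>_eqI) simp
  qed
qed


section \<open>Semilinear functionals on Witt vectors in ghost coordinates\<close>

lemma funpow_diff_Suc: "i \<le> m \<Longrightarrow> (h ^^ (m - i)) ((h ^^ Suc i) x) = (h ^^ Suc m) x"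
  using funpow_add[of "m - i" "Suc i" h] by (simp add: fun_eq_iff del: funpow.simps)

lemma frob_sum_single:
  fixes b :: "('v, 'k::comm_ring_prime_char witt) mpoly"
  assumes "i \<le> m"
  shows "frob_sum m (\<lambda>r. if r = i then b else 0) = of_nat CHAR('k) ^ i * (frob_lift ^^ (m - i)) b"
proof -
  have "frob_sum m (\<lambda>r. if r = i then b else 0)
      = (\<Sum>r\<le>m. if r = i then of_nat CHAR('k) ^ i * (frob_lift ^^ (m - i)) b else 0)"
    unfolding frob_sum_def by (intro sum.cong) (auto simp: frob_pow.zero)
  then show ?thesis using assms by simp
qed

lemma frob_sum_shift:
  fixes b :: "nat \<Rightarrow> ('v, 'k::comm_ring_prime_char witt) mpoly"
  shows "frob_sum (i + j) (\<lambda>r. if r < i then 0 else b (r - i)) = of_nat CHAR('k) ^ i * frob_sum j b"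
proof (induction i)
  case (Suc i)
  have "(\<lambda>r. if Suc r < Suc i then 0 else b (Suc r - Suc i)) = (\<lambda>r. if r < i then 0 else b (r - i))"
    by auto
  then show ?case by (simp add: frob_sum_Suc Suc frob_pow.zero mult.assoc frob_lift.zero)
qed (simp add: frob_sum_def)

lemma frob_lift_frob_sum:
  fixes c :: "nat \<Rightarrow> ('v, 'k::comm_ring_prime_char witt) mpoly"
  shows "\<exists>d. frob_lift (frob_sum m c) = (frob_lift ^^ Suc m) (c 0) + of_nat CHAR('k) * frob_sum m d"
proof (cases m)
  case 0
  then show ?thesis
    by (intro exI[of _ "\<lambda>_. 0"]) (simp add: frob_sum_def)
next
  case (Suc n)
  define d where "d i = (if i \<le> n then c (Suc i) else 0)" for i
  have "frob_sum n (\<lambda>i. c (Suc i)) = frob_sum n d"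
    unfolding frob_sum_def by (intro sum.cong) (simp_all add: d_def)
  then have "frob_lift (frob_sum n (\<lambda>i. c (Suc i))) = frob_sum m d"
    unfolding Suc frob_sum_Suc_top by (simp add: d_def)
  then show ?thesis
    unfolding Suc frob_sum_Suc[of n c] frob_lift.add frob_lift.mult frob_lift.of_nat
    by (intro exI[of _ d]) simp
qed

lemma trace_Suc_power_mult:
  fixes a g :: "('v::finite, 'k::{alg_closed_field, field_prime_char}) mpoly"
  shows "trace (Suc e) (a ^ CHAR('k) * g) = trace e (a * trace 1 g)"
  using trace_trace[of e 1 "a ^ CHAR('k) * g"] trace_power_mult[of 1 a g] by simp

text \<open>
  The value at \<open>\<Sum>i\<le>m. p ^ i * \<phi> ^ (m - i) (b i)\<close> of the functional with coefficients \<open>g\<close>. The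
  representation of an element of the ghost image by \<open>b\<close> is unique up to replacing \<open>(p * c, d)\<close> by \<open>(0, d + \<phi> c)\<close> in consecutive places, so the functional
  is well defined as soon as the trace kills \<open>g i\<close> for \<open>i \<ge> 1\<close>.
\<close>

definition functional :: "nat \<Rightarrow> (nat \<Rightarrow> ('v::finite, 'k::{alg_closed_field, field_prime_char}) mpoly) \<Rightarrow>
    (nat \<Rightarrow> ('v, 'k witt) mpoly) \<Rightarrow> ('v, 'k) mpoly" where
  "functional m g b = (\<Sum>i\<le>m. trace (Suc i) (g i * red (b i)))"

lemma functional_add: "functional m g (\<lambda>i. b i + c i) = functional m g b + functional m g c"
  by (simp add: functional_def red.add distrib_left trace_add sum.distrib)

lemma functional_diff: "functional m g (\<lambda>i. b i - c i) = functional m g b - functional m g c"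
  by (simp add: functional_def red.diff right_diff_distrib trace_diff sum_subtractf)

lemma functional_well_defined_aux:
  fixes g :: "nat \<Rightarrow> ('v::{finite, linorder}, 'k::{alg_closed_field, field_prime_char}) mpoly"
  assumes "\<And>i. 1 \<le> i \<Longrightarrow> i \<le> m \<Longrightarrow> trace 1 (g i) = 0" and "pcong m (frob_sum m b) 0"
  shows "(\<Sum>i\<le>m. trace (Suc (e + i)) (g i * red (b i))) = 0"
  using assms
proof (induction m arbitrary: g b e)
  case 0
  then have "red (b 0) = 0" using red_pcong[OF 0(2)] by (simp add: frob_sum_def red.zero)
  then show ?case by simp
next
  case (Suc m)
  have "red (b 0) ^ (CHAR('k) ^ Suc m) = 0 ^ (CHAR('k) ^ Suc m)"
    using red_pcong[OF Suc.prems(2)] by (simp add: red_frob_sum red.zero zero_power)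
  then have red0: "red (b 0) = 0" by (rule mpoly_power_CHAR_inject)
  then obtain c where c: "b 0 = of_nat CHAR('k) * c" unfolding red_eq_0_iff ..
  define b' where "b' i = b (Suc i) + (if i = 0 then frob_lift c else 0)" for i
  have "(frob_lift ^^ Suc m) (b 0) = of_nat CHAR('k) * (frob_lift ^^ m) (frob_lift c)"
    unfolding c by (simp add: frob_pow.mult frob_pow.of_nat frob_lift.mult frob_lift.of_nat funpow_swap1)
  moreover have "frob_sum m b' = frob_sum m (\<lambda>i. b (Suc i)) + frob_sum m (\<lambda>i. if i = 0 then frob_lift c else 0)"
    unfolding b'_def[abs_def] by (rule frob_sum_add)
  then have "frob_sum m b' = frob_sum m (\<lambda>i. b (Suc i)) + (frob_lift ^^ m) (frob_lift c)"
    using frob_sum_single[of 0 m "frob_lift c"] by simp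
  ultimately have "frob_sum (Suc m) b = of_nat CHAR('k) * frob_sum m b'"
    unfolding frob_sum_Suc by (simp add: algebra_simps)
  then obtain z where "of_nat CHAR('k) * frob_sum m b' = of_nat CHAR('k) * (of_nat CHAR('k) ^ Suc m * z)"
    using Suc.prems(2) unfolding pcong_zero_iff by (auto simp: mult.assoc elim!: dvdE)
  then have "pcong m (frob_sum m b') 0"
    unfolding pcong_zero_iff by (metis of_nat_CHAR_mult_cancel dvd_triv_left)
  from Suc.IH[OF _ this, of "\<lambda>i. g (Suc i)" "Suc e"] Suc.prems(1)
  have IH: "(\<Sum>i\<le>m. trace (Suc (Suc e + i)) (g (Suc i) * red (b' i))) = 0" by simp
  have "trace (Suc (Suc e + i)) (g (Suc i) * red (b' i))
      = trace (Suc (e + Suc i)) (g (Suc i) * red (b (Suc i)))" for i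
  proof (cases i)
    case 0
    have "trace (Suc (Suc e)) (g 1 * red c ^ CHAR('k)) = 0"
      using trace_Suc_power_mult[of "Suc e" "red c" "g 1"] Suc.prems(1)[of 1] by (simp add: mult.commute)
    then show ?thesis
      by (simp add: 0 b'_def red.add red_frob_lift distrib_left trace_add)
  qed (simp add: b'_def)
  then show ?case
    using IH by (simp add: sum.atMost_Suc_shift red0 del: sum.atMost_Suc)
qed

lemma functional_well_defined:
  fixes g :: "nat \<Rightarrow> ('v::{finite, linorder}, 'k::{alg_closed_field, field_prime_char}) mpoly"
  assumes "\<And>i. 1 \<le> i \<Longrightarrow> i \<le> m \<Longrightarrow> trace 1 (g i) = 0" and "pcong m (frob_sum m b) (frob_sum m c)"
  shows "functional m g b = functional m g c"
proof -
  have "pcong m (frob_sum m (\<lambda>i. b i - c i)) 0"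
    using assms(2) by (simp add: frob_sum_diff pcong_def)
  from functional_well_defined_aux[where e = 0, OF assms(1) this]
  have "functional m g (\<lambda>i. b i - c i) = 0" by (simp add: functional_def)
  then show ?thesis by (simp add: functional_diff)
qed

definition represents :: "nat \<Rightarrow> (nat \<Rightarrow> ('v::finite, 'k::{alg_closed_field, field_prime_char}) mpoly) \<Rightarrow>
    (('v, 'k) mpoly witt \<Rightarrow> ('v, 'k) mpoly) \<Rightarrow> bool" where
  "represents m g \<psi> \<longleftrightarrow> (\<forall>a b. pcong m (wval m a) (frob_sum m b) \<longrightarrow> \<psi> a = functional m g b)"

lemma additive_CHAR_mult:
  fixes \<psi> :: "'a::comm_ring_1 \<Rightarrow> ('v, 'k::comm_ring_prime_char) mpoly"
  assumes add: "\<And>x y. \<psi> (x + y) = \<psi> x + \<psi> y"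
  shows "\<psi> (of_nat CHAR('k) * x) = 0"
proof -
  have zero: "\<psi> 0 = 0" using add[of 0 0] by simp
  have "\<psi> (of_nat n * x) = of_nat n * \<psi> x" for n
    by (induction n) (simp_all add: zero add distrib_right)
  moreover have "(of_nat CHAR('k) :: ('v, 'k) mpoly) = 0" by (simp add: of_nat_eq_0_iff_char_dvd)
  ultimately show ?thesis by simp
qed

lemma represents_one:
  fixes \<psi> :: "('v::{finite, linorder}, 'k::{alg_closed_field, field_prime_char}) mpoly witt \<Rightarrow> ('v, 'k) mpoly"
  assumes "represents m g \<psi>"
  shows "\<psi> 1 = trace 1 (g 0)"
proof -
  have "pcong m (wval m 1) (frob_sum m (\<lambda>r. if r = 0 then 1 else 0 :: ('v, 'k witt) mpoly))"
    using wval_one[of m] by (simp add: frob_sum_single frob_pow.one)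
  then have "\<psi> 1 = functional m g (\<lambda>r. if r = 0 then 1 else 0)"
    using assms by (simp add: represents_def)
  also have "\<dots> = (\<Sum>r\<le>m. if r = 0 then trace 1 (g 0) else 0)"
    unfolding functional_def by (intro sum.cong) (auto simp: red.zero red.one)
  finally show ?thesis by simp
qed

text \<open>
  For linearity, modulo \<open>p\<close> times the ghost image, the Frobenius of a scalar acts on the ghost image
  through the iterated Frobenius lift of a lift of its zeroth coordinate; the functional kills
  multiples of \<open>p\<close> because its values lie in characteristic \<open>p\<close>.
\<close>

lemma functional_exists:
  fixes g :: "nat \<Rightarrow> ('v::{finite, linorder}, 'k::{alg_closed_field, field_prime_char}) mpoly"
  assumes g: "\<And>i. 1 \<le> i \<Longrightarrow> i \<le> m \<Longrightarrow> trace 1 (g i) = 0"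
  shows "\<exists>\<psi>. represents m g \<psi> \<and>
    (\<forall>x y. \<psi> (x + y) = \<psi> x + \<psi> y) \<and>
    (\<forall>w x. \<psi> (witt_frob w * x) = coord w 0 * \<psi> x) \<and>
    (\<forall>x. (\<forall>i\<le>m. coord x i = 0) \<longrightarrow> \<psi> x = 0)"
proof -
  define \<psi> where "\<psi> a = functional m g (SOME b. wval m a = frob_sum m b)" for a
  have some: "wval m a = frob_sum m (SOME b. wval m a = frob_sum m b)" for a :: "('v, 'k) mpoly witt"
  proof -
    have "\<exists>b. wval m a = frob_sum m b" using wval_eq_frob_sum by blast
    then show ?thesis by (rule someI_ex)
  qed
  have rep: "\<psi> a = functional m g b" if "pcong m (wval m a) (frob_sum m b)" for a b
    unfolding \<psi>_def using that some[of a] by (intro functional_well_defined g) simp_all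
  have add: "\<psi> (x + y) = \<psi> x + \<psi> y" for x y
  proof -
    obtain b c where bc: "wval m x = frob_sum m b" "wval m y = frob_sum m c"
      using wval_eq_frob_sum by metis
    then have "pcong m (wval m (x + y)) (frob_sum m (\<lambda>i. b i + c i))"
      using wval_add[of m x y] by (simp add: frob_sum_add)
    then have "\<psi> (x + y) = functional m g b + functional m g c"
      by (simp add: rep functional_add)
    also have "functional m g b = \<psi> x" by (rule rep[symmetric]) (simp add: bc)
    also have "functional m g c = \<psi> y" by (rule rep[symmetric]) (simp add: bc)
    finally show ?thesis .
  qed
  have vanish: "\<psi> x = 0" if "\<And>i. i \<le> m \<Longrightarrow> coord x i = 0" for x
  proof -
    have "frob_sum m (\<lambda>_. 0 :: ('v, 'k witt) mpoly) = 0"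
      by (simp add: frob_sum_def frob_pow.zero)
    then have "\<psi> x = functional m g (\<lambda>_. 0)"
      using that by (intro rep) (simp add: wval_pcong_zero)
    then show ?thesis by (simp add: functional_def red.zero)
  qed
  have char: "\<psi> (of_nat CHAR('k) * x) = 0" for x
    using add by (rule additive_CHAR_mult)
  have lin: "\<psi> (witt_frob w * x) = coord w 0 * \<psi> x" for w x
  proof -
    obtain c where c: "wval m w = frob_sum m c" "red (c 0) = coord w 0"
      using wval_eq_frob_sum by metis
    obtain b where b: "wval m x = frob_sum m b"
      using wval_eq_frob_sum by metis
    obtain d where d: "frob_lift (frob_sum m c) = (frob_lift ^^ Suc m) (c 0) + of_nat CHAR('k) * frob_sum m d"
      using frob_lift_frob_sum by blast
    obtain a where a: "pcong m (wval m a) (frob_sum m d)" using wval_surj by blast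
    define b' where "b' i = (frob_lift ^^ Suc i) (c 0) * b i" for i
    have b': "frob_sum m b' = (frob_lift ^^ Suc m) (c 0) * frob_sum m b"
      unfolding frob_sum_def sum_distrib_left
    proof (intro sum.cong refl)
      fix i assume "i \<in> {..m}"
      then have "(frob_lift ^^ (m - i)) ((frob_lift ^^ Suc i) (c 0)) = (frob_lift ^^ Suc m) (c 0)"
        by (intro funpow_diff_Suc) simp
      then show "of_nat CHAR('k) ^ i * (frob_lift ^^ (m - i)) (b' i) =
          (frob_lift ^^ Suc m) (c 0) * (of_nat CHAR('k) ^ i * (frob_lift ^^ (m - i)) (b i))"
        unfolding b'_def frob_pow.mult by (simp add: mult_ac)
    qed
    have "pcong m (wval m (witt_frob w * x)) (wval m (witt_frob w) * wval m x)" by (rule wval_mult)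
    also have "pcong m \<dots> (frob_lift (wval m w) * wval m x)"
      by (intro pcong_mult pcong_refl wval_frob)
    also have "\<dots> = frob_sum m b' + of_nat CHAR('k) * (frob_sum m d * wval m x)"
      by (simp only: c d b b' distrib_right mult.assoc)
    finally have 1: "pcong m (wval m (witt_frob w * x)) (frob_sum m b' + of_nat CHAR('k) * (frob_sum m d * wval m x))" .
    have "pcong m (wval m (of_nat CHAR('k) * (a * x))) (of_nat CHAR('k) * wval m (a * x))"
      by (rule wval_of_nat_mult)
    also have "pcong m \<dots> (of_nat CHAR('k) * (wval m a * wval m x))"
      by (intro pcong_mult pcong_refl wval_mult)
    also have "pcong m \<dots> (of_nat CHAR('k) * (frob_sum m d * wval m x))"
      by (intro pcong_mult pcong_refl a)
    finally have 2: "pcong m (wval m (of_nat CHAR('k) * (a * x))) (of_nat CHAR('k) * (frob_sum m d * wval m x))" .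
    have "pcong m (wval m (witt_frob w * x - of_nat CHAR('k) * (a * x)))
        (wval m (witt_frob w * x) - wval m (of_nat CHAR('k) * (a * x)))" by (rule wval_diff)
    also have "pcong m \<dots> (frob_sum m b' + of_nat CHAR('k) * (frob_sum m d * wval m x)
        - of_nat CHAR('k) * (frob_sum m d * wval m x))"
      by (intro pcong_diff 1 2)
    finally have "\<psi> (witt_frob w * x - of_nat CHAR('k) * (a * x)) = functional m g b'"
      by (intro rep) simp
    also have "\<dots> = coord w 0 * functional m g b"
      unfolding functional_def sum_distrib_left
    proof (intro sum.cong refl)
      fix i
      have "g i * red (b' i) = coord w 0 ^ (CHAR('k) ^ Suc i) * (g i * red (b i))"
        by (simp only: b'_def red.mult red_frob_pow c mult_ac)
      then show "trace (Suc i) (g i * red (b' i)) = coord w 0 * trace (Suc i) (g i * red (b i))"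
        by (simp only: trace_power_mult)
    qed
    also have "functional m g b = \<psi> x" using rep[of x b] b by simp
    finally show ?thesis
      using add[of "witt_frob w * x - of_nat CHAR('k) * (a * x)" "of_nat CHAR('k) * (a * x)"] char by simp
  qed
  show ?thesis
    by (rule exI[of _ \<psi>]) (auto simp: represents_def rep add lin vanish)
qed

text \<open>
  Restricted to the terms \<open>p ^ i * \<phi> ^ (m - i) (b)\<close>, a linear functional depends only on \<open>b\<close> modulo
  \<open>p\<close> and is inverse-linear for the \<open>p ^ (i + 1)\<close>-th power Frobenius, hence is a trace pairing with
  some \<open>g i\<close>. For \<open>i \<ge> 1\<close> and \<open>b = \<phi> c\<close> the term is \<open>p\<close> times an element of the ghost image, so
  the functional vanishes on \<open>p\<close>-th powers, which says that the trace kills \<open>g i\<close>.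
\<close>

lemma functional_represents:
  fixes \<psi> :: "('v::{finite, linorder}, 'k::{alg_closed_field, field_prime_char}) mpoly witt \<Rightarrow> ('v, 'k) mpoly"
  assumes add: "\<And>x y. \<psi> (x + y) = \<psi> x + \<psi> y"
    and lin: "\<And>w x. \<psi> (witt_frob w * x) = coord w 0 * \<psi> x"
    and vanish: "\<And>x. (\<And>i. i \<le> m \<Longrightarrow> coord x i = 0) \<Longrightarrow> \<psi> x = 0"
  obtains g where "\<And>i. 1 \<le> i \<Longrightarrow> i \<le> m \<Longrightarrow> trace 1 (g i) = 0" "represents m g \<psi>"
proof -
  have char: "\<psi> (of_nat CHAR('k) * x) = 0" for x
    using add by (rule additive_CHAR_mult)
  have cong: "\<psi> x = \<psi> y" if "pcong m (wval m x) (wval m y)" for x y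
  proof -
    have "pcong m (wval m (x - y)) (wval m x - wval m y)" by (rule wval_diff)
    also have "pcong m \<dots> (wval m y - wval m y)" by (intro pcong_diff that pcong_refl)
    finally have "\<psi> (x - y) = 0" by (intro vanish) (simp add: wval_pcong_zero)
    then show ?thesis using add[of "x - y" y] by simp
  qed
  define rel where "rel i a b \<longleftrightarrow> pcong m (wval m a) (of_nat CHAR('k) ^ i * (frob_lift ^^ (m - i)) b)"
    for i a and b :: "('v, 'k witt) mpoly"
  have ex: "\<exists>a. rel i a b" if "i \<le> m" for i b
    unfolding rel_def using that by (intro wval_surj_aux) simp
  have rel_add: "rel i (a + a') (b + b')" if "rel i a b" "rel i a' b'" for i a a' b b'
    unfolding rel_def frob_pow.add distrib_left
    using pcong_trans[OF wval_add pcong_add[OF that[unfolded rel_def]]] .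
  have rel_p: "rel i (of_nat CHAR('k) * a) (of_nat CHAR('k) * b)" if "rel i a b" for i a b
    unfolding rel_def frob_pow.mult frob_pow.of_nat mult.left_commute[of _ "of_nat CHAR('k)"]
    using pcong_trans[OF wval_of_nat_mult pcong_mult[OF pcong_refl that[unfolded rel_def]]] .
  have rel_cong: "\<psi> a = \<psi> a'" if "rel i a b" "rel i a' b'" "red b = red b'" "i \<le> m" for i a a' b b'
  proof -
    have "of_nat CHAR('k) dvd b - b'" using that(3) by (simp add: red_eq_iff)
    then obtain c where "b - b' = of_nat CHAR('k) * c" ..
    then have c: "b = b' + of_nat CHAR('k) * c" by (simp add: algebra_simps)
    obtain a'' where "rel i a'' c" using ex \<open>i \<le> m\<close> by blast
    from rel_add[OF that(2) rel_p[OF this]] have "rel i (a' + of_nat CHAR('k) * a'') b"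
      by (simp only: c)
    then have "\<psi> a = \<psi> (a' + of_nat CHAR('k) * a'')"
      using that(1) unfolding rel_def by (intro cong) (rule pcong_trans[OF _ pcong_sym])
    then show ?thesis by (simp add: add char)
  qed
  define P where "P i \<beta> = \<psi> (SOME a. rel i a (teich_lift \<beta>))" for i \<beta>
  have P: "P i (red b) = \<psi> a" if "rel i a b" "i \<le> m" for i a b
  proof -
    have "rel i (SOME a. rel i a (teich_lift (red b))) (teich_lift (red b))"
      by (rule someI_ex) (rule ex[OF that(2)])
    from rel_cong[OF this that(1) _ that(2)] show ?thesis by (simp add: P_def red_teich_lift)
  qed
  have P_add: "P i (\<beta> + \<gamma>) = P i \<beta> + P i \<gamma>" if i: "i \<le> m" for i \<beta> \<gamma>
  proof -
    obtain a a' where a: "rel i a (teich_lift \<beta>)" "rel i a' (teich_lift \<gamma>)" using ex[OF i] by metis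
    show ?thesis
      using P[OF rel_add[OF a] i] P[OF a(1) i] P[OF a(2) i]
      by (simp add: red.add red_teich_lift add)
  qed
  have P_lin: "P i (\<beta> ^ (CHAR('k) ^ Suc i) * \<gamma>) = \<beta> * P i \<gamma>" if i: "i \<le> m" for i \<beta> \<gamma>
  proof -
    obtain a where a: "rel i a (teich_lift \<gamma>)" using ex i by blast
    \<comment> \<open>A scalar whose ghost value is the iterated Frobenius of a lift of \<open>\<beta>\<close>; the Teichmueller
      representative of \<open>\<beta>\<close> does not have this property unless \<open>\<beta>\<close> is a monomial.\<close>
    obtain w where w: "rel 0 w (teich_lift \<beta>)" using ex by blast
    have w_cong: "pcong m (wval m w) (frob_sum m (\<lambda>r. if r = 0 then teich_lift \<beta> else 0))"
      using w by (simp add: rel_def frob_sum_single)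
    have w0: "coord w 0 = \<beta>"
      using coord_0_eq_red[OF w_cong] by (simp add: red_teich_lift)
    have "pcong m (wval m (witt_frob w * a)) (wval m (witt_frob w) * wval m a)" by (rule wval_mult)
    also have "pcong m \<dots> (frob_lift (wval m w) * wval m a)" by (intro pcong_mult pcong_refl wval_frob)
    also have "pcong m \<dots> (frob_lift ((frob_lift ^^ m) (teich_lift \<beta>)) *
        (of_nat CHAR('k) ^ i * (frob_lift ^^ (m - i)) (teich_lift \<gamma>)))"
      using w a by (intro pcong_mult pcong_frob_lift) (simp_all add: rel_def)
    also have "frob_lift ((frob_lift ^^ m) (teich_lift \<beta>)) = (frob_lift ^^ (m - i)) ((frob_lift ^^ Suc i) (teich_lift \<beta>))"
      unfolding funpow_diff_Suc[OF i] by simp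
    finally have "rel i (witt_frob w * a) ((frob_lift ^^ Suc i) (teich_lift \<beta>) * teich_lift \<gamma>)"
      unfolding rel_def frob_pow.mult by (simp only: mult_ac)
    from P[OF this i] P[OF a i] show ?thesis
      by (simp only: red.mult red_frob_pow red_teich_lift lin w0)
  qed
  have "\<forall>i. \<exists>g. i \<le> m \<longrightarrow> (\<forall>b. P i b = trace (Suc i) (g * b))"
    using trace_representable[OF P_add P_lin] by blast
  then obtain g where g: "\<And>i b. i \<le> m \<Longrightarrow> P i b = trace (Suc i) (g i * b)" by metis
  have "trace 1 (g i) = 0" if i: "1 \<le> i" "i \<le> m" for i
  proof -
    have "P i (\<gamma> ^ CHAR('k)) = 0" for \<gamma>
    proof -
      obtain a where a: "rel (i - 1) a (teich_lift \<gamma>)" using ex[of "i - 1"] i by fastforce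
      have m: "m - (i - 1) = Suc (m - i)" using i by auto
      have "(of_nat CHAR('k) :: ('v, 'k witt) mpoly) ^ i = of_nat CHAR('k) * of_nat CHAR('k) ^ (i - 1)"
        using i by (simp flip: power_Suc)
      then have eq: "of_nat CHAR('k) * (of_nat CHAR('k) ^ (i - 1) * (frob_lift ^^ (m - (i - 1))) (teich_lift \<gamma>))
          = of_nat CHAR('k) ^ i * (frob_lift ^^ (m - i)) (frob_lift (teich_lift \<gamma>))"
        unfolding m by (simp add: funpow_swap1 mult.assoc)
      have "rel i (of_nat CHAR('k) * a) (frob_lift (teich_lift \<gamma>))"
        unfolding rel_def eq[symmetric]
        by (rule pcong_trans[OF wval_of_nat_mult pcong_mult[OF pcong_refl a[unfolded rel_def]]])
      from P[OF this i(2)] show ?thesis by (simp add: red_frob_lift red_teich_lift char)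
    qed
    then have "trace i (trace 1 (g i) * \<gamma>) = 0" for \<gamma>
      using g[OF i(2), of "\<gamma> ^ CHAR('k)"] trace_Suc_power_mult[of i \<gamma> "g i"] by (simp add: mult.commute)
    then have "0 ^ (CHAR('k) ^ i) dvd trace 1 (g i)" by (intro trace_dvd_imp_dvd) simp
    then show ?thesis by (simp add: zero_power)
  qed
  moreover have "represents m g \<psi>"
    unfolding represents_def
  proof (intro allI impI)
    fix a :: "('v, 'k) mpoly witt" and b :: "nat \<Rightarrow> ('v, 'k witt) mpoly"
    assume a: "pcong m (wval m a) (frob_sum m b)"
    have "\<forall>i. \<exists>c. i \<le> m \<longrightarrow> rel i c (b i)" using ex by blast
    then obtain c where c: "\<And>i. i \<le> m \<Longrightarrow> rel i (c i) (b i)" by metis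
    have "pcong m (wval m (\<Sum>i\<le>m. c i)) (\<Sum>i\<le>m. wval m (c i))" by (rule wval_sum)
    also have "pcong m \<dots> (frob_sum m b)"
      unfolding frob_sum_def using c by (intro pcong_sum) (simp add: rel_def)
    also have "pcong m \<dots> (wval m a)" by (rule pcong_sym[OF a])
    finally have "\<psi> a = \<psi> (\<Sum>i\<le>m. c i)" by (intro cong[symmetric])
    also have "\<dots> = (\<Sum>i\<le>m. \<psi> (c i))"
      by (induction m) (simp_all add: add)
    also have "\<dots> = functional m g b"
      unfolding functional_def using P[OF c] g by (intro sum.cong refl) simp
    finally show "\<psi> a = functional m g b" .
  qed
  ultimately show thesis by (rule that)
qed


section \<open>A Fedder type criterion\<close>

lemma power_add_p_multiple:
  fixes X \<epsilon> :: "'r::comm_ring_1"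
  assumes p: "prime p" and j: "j \<ge> 1"
  shows "\<exists>z. (X + of_nat p ^ j * \<epsilon>) ^ p =
    X ^ p + of_nat p ^ Suc j * (X ^ (p - 1) * \<epsilon> + of_nat p ^ ((p - 1) * j - 1) * \<epsilon> ^ p + of_nat p * z)"
proof -
  let ?P = "of_nat p :: 'r"
  have p2: "p \<ge> 2" using p by (rule prime_ge_2_nat)
  let ?t = "\<lambda>k. of_nat (p choose k) * (?P ^ j * \<epsilon>) ^ k * X ^ (p - k)"
  have "?P ^ Suc (Suc j) dvd (\<Sum>k\<in>{2..<p}. ?t k)"
  proof (rule dvd_sum)
    fix k assume k: "k \<in> {2..<p}"
    then have "p dvd p choose k" using p by (intro dvd_choose_prime) auto
    then have "?P dvd of_nat (p choose k)" by (auto elim!: dvdE)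
    moreover have "Suc j \<le> j * k"
    proof -
      have "j * 2 \<le> j * k" using k by simp
      then show ?thesis using j by linarith
    qed
    then have "?P ^ Suc j dvd (?P ^ j * \<epsilon>) ^ k"
      unfolding power_mult_distrib power_mult[symmetric] by (intro dvd_mult2 le_imp_power_dvd)
    ultimately have "?P * ?P ^ Suc j dvd of_nat (p choose k) * (?P ^ j * \<epsilon>) ^ k"
      by (rule mult_dvd_mono)
    then show "?P ^ Suc (Suc j) dvd ?t k" by (simp add: dvd_mult2)
  qed
  then obtain z where z: "(\<Sum>k\<in>{2..<p}. ?t k) = ?P ^ Suc (Suc j) * z" ..
  have "j * p = Suc j + ((p - 1) * j - 1)"
  proof -
    have "(p - 1) * j \<ge> 1" using p2 j by simp
    moreover have "j * p = j + (p - 1) * j" using p2 by (cases p) simp_all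
    ultimately show ?thesis by linarith
  qed
  then have last: "?t p = ?P ^ Suc j * (?P ^ ((p - 1) * j - 1) * \<epsilon> ^ p)"
    by (simp add: power_mult_distrib power_add mult.assoc flip: power_mult)
  have "{..p} = insert 0 (insert 1 (insert p {2..<p}))" using p2 by auto
  then have "(?P ^ j * \<epsilon> + X) ^ p = ?t 0 + (?t 1 + (?t p + (\<Sum>k\<in>{2..<p}. ?t k)))"
    unfolding binomial_ring using p2 by simp
  also have "\<dots> = X ^ p + ?P ^ Suc j * (X ^ (p - 1) * \<epsilon> + ?P ^ ((p - 1) * j - 1) * \<epsilon> ^ p + ?P * z)"
    unfolding z last by (simp add: algebra_simps)
  finally show ?thesis by (auto simp: add.commute)
qed

lemma red_delta_mult:
  fixes g h :: "('v, 'k::{alg_closed_field, field_prime_char} witt) mpoly"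
  shows "red (delta (g * h)) = red g ^ CHAR('k) * red (delta h) + red h ^ CHAR('k) * red (delta g)"
proof -
  have "of_nat CHAR('k) * delta (g * h)
      = g ^ CHAR('k) * (of_nat CHAR('k) * delta h) + frob_lift h * (of_nat CHAR('k) * delta g)"
    unfolding CHAR_mult_delta by (simp add: frob_lift.mult power_mult_distrib algebra_simps)
  also have "\<dots> = of_nat CHAR('k) * (g ^ CHAR('k) * delta h + frob_lift h * delta g)"
    by (simp add: algebra_simps)
  finally have "delta (g * h) = g ^ CHAR('k) * delta h + frob_lift h * delta g"
    by (rule of_nat_CHAR_mult_cancel)
  then show ?thesis by (simp add: red.add red.mult red.power red_frob_lift)
qed

text \<open>
  The coefficients matter only modulo \<open>p\<close>-th powers, on which the functionals attached to
  sequences killed by the trace vanish. Up to those, passing from \<open>j\<close> to \<open>j + 1\<close> multiplies by a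
  power of \<open>y\<close>: this is the linear term in the binomial expansion of the \<open>p\<close>-th power, while the
  last term is itself a \<open>p\<close>-th power modulo \<open>p\<close> and the terms between are divisible by \<open>p\<close> once more.
\<close>

lemma red_dwork_Suc:
  fixes y :: "('v, 'k::{alg_closed_field, field_prime_char} witt) mpoly"
  shows "\<exists>e. red (dwork y (Suc j)) = red y ^ (CHAR('k) ^ Suc j - CHAR('k)) * red (delta y) + e ^ CHAR('k)"
proof (induction j)
  case 0
  have "of_nat CHAR('k) * dwork y (Suc 0) = of_nat CHAR('k) * delta y"
    using dwork_Suc[of 0 y] by (simp add: CHAR_mult_delta)
  then have "dwork y (Suc 0) = delta y" by (rule of_nat_CHAR_mult_cancel)
  then show ?case by (intro exI[of _ 0]) (simp add: zero_power)
next
  case (Suc j)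
  let ?p = "CHAR('k)" and ?P = "of_nat CHAR('k) :: ('v, 'k witt) mpoly"
  obtain e where e: "red (dwork y (Suc j)) = red y ^ (?p ^ Suc j - ?p) * red (delta y) + e ^ ?p"
    using Suc by blast
  define X where "X = frob_lift (y ^ (?p ^ j))"
  define \<epsilon> where "\<epsilon> = dwork y (Suc j)"
  define s where "s = (?p - 1) * Suc j - 1"
  have y: "y ^ (?p ^ Suc j) = X + ?P ^ Suc j * \<epsilon>"
    unfolding X_def \<epsilon>_def dwork_Suc by simp
  obtain z where z: "(X + ?P ^ Suc j * \<epsilon>) ^ ?p =
      X ^ ?p + ?P ^ Suc (Suc j) * (X ^ (?p - 1) * \<epsilon> + ?P ^ s * \<epsilon> ^ ?p + ?P * z)"
    using power_add_p_multiple[of ?p "Suc j" X \<epsilon>] unfolding s_def by auto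
  have "y ^ (?p ^ Suc (Suc j)) = (X + ?P ^ Suc j * \<epsilon>) ^ ?p"
    unfolding y[symmetric] by (simp only: power_mult[symmetric] power_Suc2)
  moreover have "frob_lift (y ^ (?p ^ Suc j)) = X ^ ?p"
    unfolding X_def frob_lift.power[symmetric] by (simp only: power_mult[symmetric] power_Suc2)
  ultimately have "?P ^ Suc (Suc j) * dwork y (Suc (Suc j))
      = ?P ^ Suc (Suc j) * (X ^ (?p - 1) * \<epsilon> + ?P ^ s * \<epsilon> ^ ?p + ?P * z)"
    using dwork_Suc[of "Suc j" y] z by simp
  then have "dwork y (Suc (Suc j)) = X ^ (?p - 1) * \<epsilon> + ?P ^ s * \<epsilon> ^ ?p + ?P * z"
    by (rule of_nat_CHAR_power_mult_cancel)
  moreover have P0: "(of_nat ?p :: ('v, 'k) mpoly) = 0"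
    by (simp add: of_nat_eq_0_iff_char_dvd)
  ultimately have "red (dwork y (Suc (Suc j))) = red X ^ (?p - 1) * red \<epsilon> + red (?P ^ s) * red \<epsilon> ^ ?p"
    by (simp add: red.add red.mult red.power red.of_nat P0)
  also have "red (?P ^ s) = (0 ^ s) ^ ?p"
    by (cases s) (simp_all add: red.power red.of_nat red.one zero_power P0)
  also have "red X = (red y ^ (?p ^ j)) ^ ?p"
    by (simp add: X_def red_frob_lift red.power)
  also have "((red y ^ (?p ^ j)) ^ ?p) ^ (?p - 1) * red \<epsilon>
      = (red y ^ (?p ^ Suc j)) ^ (?p - 1) * red y ^ (?p ^ Suc j - ?p) * red (delta y)
        + ((red y ^ (?p ^ j)) ^ (?p - 1) * e) ^ ?p"
    unfolding \<epsilon>_def e by (simp add: power_mult_distrib distrib_left mult_ac flip: power_mult)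
  also have "(red y ^ (?p ^ Suc j)) ^ (?p - 1) * red y ^ (?p ^ Suc j - ?p) = red y ^ (?p ^ Suc (Suc j) - ?p)"
  proof -
    have "?p ^ Suc j * (?p - 1) + (?p ^ Suc j - ?p) = ?p ^ Suc (Suc j) - ?p"
    proof -
      have "?p ^ 1 \<le> ?p ^ Suc j" by (intro power_increasing) (simp_all add: Suc_leI)
      moreover have "?p ^ Suc (Suc j) = ?p ^ Suc j * (?p - 1) + ?p ^ Suc j"
        by (cases ?p) simp_all
      ultimately show ?thesis by simp
    qed
    then show ?thesis by (metis power_add power_mult)
  qed
  finally have "red (dwork y (Suc (Suc j))) = red y ^ (?p ^ Suc (Suc j) - ?p) * red (delta y)
      + (((red y ^ (?p ^ j)) ^ (?p - 1) * e) ^ ?p + (0 ^ s * red \<epsilon>) ^ ?p)"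
    by (simp only: power_mult_distrib add.assoc)
  also have "((red y ^ (?p ^ j)) ^ (?p - 1) * e) ^ ?p + (0 ^ s * red \<epsilon>) ^ ?p
      = ((red y ^ (?p ^ j)) ^ (?p - 1) * e + 0 ^ s * red \<epsilon>) ^ ?p"
    using add_power_CHAR[of "(red y ^ (?p ^ j)) ^ (?p - 1) * e" "0 ^ s * red \<epsilon>" 1] by simp
  finally show ?case by blast
qed

text \<open>
  For \<open>F\<close> a lift of \<open>f\<close> and \<open>\<delta>\<close> the reduction of \<open>delta F\<close>, these two operators carry all the
  information about quasi-F-splitting.
\<close>

definition tau where
  "tau f h = trace 1 (f ^ (CHAR('k) - 2) * h)"
  for f h :: "('v::finite, 'k::{alg_closed_field, field_prime_char}) mpoly"

definition theta where
  "theta f \<delta> h = trace 1 (f ^ (CHAR('k) - 2) * \<delta> * h)"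
  for f \<delta> h :: "('v::finite, 'k::{alg_closed_field, field_prime_char}) mpoly"

definition witt_unit :: "nat \<Rightarrow> 'a::comm_ring_prime_char \<Rightarrow> 'a witt" where
  "witt_unit i c = Witt (\<lambda>j. if j = i then c else 0)"

lemma sum_atMost_shift:
  fixes F :: "nat \<Rightarrow> 'a::comm_monoid_add"
  assumes "\<And>r. r < i \<Longrightarrow> F r = 0"
  shows "(\<Sum>r\<le>i + j. F r) = (\<Sum>l\<le>j. F (i + l))"
proof (induction j)
  case 0
  have "(\<Sum>r\<le>i. F r) = (\<Sum>r<i. F r) + F i"
    by (simp flip: lessThan_Suc_atMost)
  then show ?case using assms by simp
qed simp

lemma pcong_wval_witt_unit:
  fixes C :: "('v::{finite, linorder}, 'k::{alg_closed_field, field_prime_char} witt) mpoly"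
  assumes "i \<le> m"
  shows "pcong m (wval m (witt_unit i (red C)))
    (frob_sum m (\<lambda>r. if r < i then 0 else dwork C (r - i)))"
proof -
  have "pcong m (wval m (witt_unit i (red C))) (ghost CHAR('k) m (\<lambda>j. if j = i then C else 0))"
    by (rule wval_pcong_ghost) (simp add: witt_unit_def red.zero)
  also have "ghost CHAR('k) m (\<lambda>j. if j = i then C else 0) = of_nat CHAR('k) ^ i * frob_sum (m - i) (dwork C)"
    using assms by (simp add: ghost_single power_eq_frob_sum_dwork)
  also have "\<dots> = frob_sum m (\<lambda>r. if r < i then 0 else dwork C (r - i))"
    using frob_sum_shift[of i "m - i" "dwork C"] assms by simp
  finally show ?thesis .
qed

lemma represents_witt_unit:
  fixes C :: "('v::{finite, linorder}, 'k::{alg_closed_field, field_prime_char} witt) mpoly"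
  assumes "represents m g \<psi>" "i \<le> m"
  shows "\<psi> (witt_unit i (red C)) = (\<Sum>l\<le>m - i. trace (Suc (i + l)) (g (i + l) * red (dwork C l)))"
proof -
  have "\<psi> (witt_unit i (red C)) = functional m g (\<lambda>r. if r < i then 0 else dwork C (r - i))"
    using assms(1) pcong_wval_witt_unit[OF assms(2), of C] by (simp add: represents_def)
  also have "\<dots> = (\<Sum>r\<le>i + (m - i). trace (Suc r) (g r * red (if r < i then 0 else dwork C (r - i))))"
    using assms(2) by (simp add: functional_def)
  also have "\<dots> = (\<Sum>l\<le>m - i. trace (Suc (i + l)) (g (i + l) * red (dwork C l)))"
    by (subst sum_atMost_shift) (simp_all add: red.zero)
  finally show ?thesis .
qed

text \<open>
  In the expansion of the Witt vector with single entry \<open>f * y\<close> at \<open>i\<close>, the coefficient with index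
  \<open>l \<ge> 1\<close> is, modulo \<open>p\<close>-th powers, \<open>(f * y) ^ (p ^ l - p)\<close> times the delta of the product, which
  splits by the Leibniz rule. The summand with the delta of \<open>y\<close> carries enough factors \<open>f\<close> to be
  divisible by \<open>f\<close> after the trace, and so does the other summand when \<open>l \<ge> 2\<close>. There remain the
  terms with \<open>l = 0\<close> and \<open>l = 1\<close>, which involve \<open>g i\<close> and \<open>h (i + 1)\<close>.
\<close>

lemma represents_witt_unit_mult:
  fixes F :: "('v::{finite, linorder}, 'k::{alg_closed_field, field_prime_char} witt) mpoly"
    and f :: "('v, 'k) mpoly"
  defines "p \<equiv> CHAR('k)"
  assumes rep: "represents m g \<psi>" and g0: "\<And>r. 1 \<le> r \<Longrightarrow> r \<le> m \<Longrightarrow> trace 1 (g r) = 0"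
    and F: "red F = f" and i: "i < m"
    and gh: "\<And>r. i < r \<Longrightarrow> r \<le> m \<Longrightarrow> g r = f ^ (p ^ Suc r - 2) * h r"
  shows "f dvd \<psi> (witt_unit i (f * y))
    - trace (Suc i) (y * (f * g i + f ^ (p ^ Suc i - 1) * theta f (red (delta F)) (h (Suc i))))"
proof -
  define \<delta> where "\<delta> = red (delta F)"
  define C where "C = F * teich_lift y"
  have C: "red C = f * y" by (simp add: C_def red.mult F red_teich_lift)
  have p2: "p \<ge> 2" unfolding p_def by (intro prime_ge_2_nat) simp
  obtain j where j: "m - i = Suc j" using i by (metis Suc_diff_Suc)
  define T where "T l = trace (Suc (i + l)) (g (i + l) * red (dwork C l))" for l
  define M where "M = trace (Suc i) (f ^ (p ^ Suc i - 1) * theta f \<delta> (h (Suc i)) * y)"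
  have T: "f dvd T (Suc l) - (if l = 0 then M else 0)" if l: "l \<le> j" for l
  proof -
    define r where "r = i + Suc l"
    have r: "i < r" "r \<le> m" using l j by (auto simp: r_def)
    obtain e where e: "red (dwork C (Suc l)) = (f * y) ^ (p ^ Suc l - p) * red (delta C) + e ^ p"
      using red_dwork_Suc[of C l] C unfolding p_def by auto
    have "trace (Suc r) (g r * e ^ p) = 0"
      using trace_Suc_power_mult[of r e "g r"] g0[of r] r by (simp add: p_def mult.commute)
    moreover have "red (delta C) = f ^ p * red (delta (teich_lift y)) + y ^ p * \<delta>"
      unfolding C_def red_delta_mult by (simp add: F red_teich_lift p_def \<delta>_def)
    ultimately have "g r * red (dwork C (Suc l)) =
          f ^ (p ^ Suc r - 2) * f ^ p * (h r * (f * y) ^ (p ^ Suc l - p) * red (delta (teich_lift y)))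
        + f ^ (p ^ Suc r - 2) * h r * (f * y) ^ (p ^ Suc l - p) * y ^ p * \<delta> + g r * e ^ p"
      unfolding e gh[OF r] by (simp add: algebra_simps del: power_Suc)
    with \<open>trace (Suc r) (g r * e ^ p) = 0\<close> have T_eq: "T (Suc l) = trace (Suc r)
          (f ^ (p ^ Suc r - 2) * f ^ p * (h r * (f * y) ^ (p ^ Suc l - p) * red (delta (teich_lift y))))
        + trace (Suc r) (f ^ (p ^ Suc r - 2) * h r * (f * y) ^ (p ^ Suc l - p) * y ^ p * \<delta>)"
      unfolding T_def r_def[symmetric] by (simp only: trace_add add_0_right)
    have A_dvd: "f dvd trace (Suc r)
        (f ^ (p ^ Suc r - 2) * f ^ p * (h r * (f * y) ^ (p ^ Suc l - p) * red (delta (teich_lift y))))"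
    proof (rule dvd_trace, rule dvd_mult2)
      have "p ^ Suc r \<le> p ^ Suc r - 2 + p" using p2 by linarith
      then show "f ^ CHAR('k) ^ Suc r dvd f ^ (p ^ Suc r - 2) * f ^ p"
        unfolding p_def power_add[symmetric] by (rule le_imp_power_dvd)
    qed
    have B_eq: "trace (Suc r) (f ^ (p ^ Suc r - 2) * h r * (f * y) ^ (p ^ Suc l - p) * y ^ p * \<delta>)
        = trace r (f ^ (p ^ r + p ^ l - 2) * y ^ (p ^ l) * theta f \<delta> (h r))"
    proof -
      have exponent: "p * a - 2 + (p * b - p) = p * (a + b - 2) + (p - 2)" if "a \<ge> 1" "b \<ge> 1" for a b
      proof -
        define a' b' where "a' = a - 1" and "b' = b - 1"
        then have ab: "a = Suc a'" "b = Suc b'" using that by simp_all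
        have "p * a - 2 = p * a' + (p - 2)" "p * b - p = p * b'" "a + b - 2 = a' + b'"
          using p2 by (simp_all add: ab)
        then show ?thesis by (simp only: distrib_left add.assoc add.commute)
      qed
      have f_power: "f ^ (p ^ Suc r - 2) * f ^ (p ^ Suc l - p) = (f ^ (p ^ r + p ^ l - 2)) ^ p * f ^ (p - 2)"
        unfolding power_add[symmetric] power_mult[symmetric]
        using exponent[of "p ^ r" "p ^ l"] p2 by (simp add: mult.commute)
      have y_power: "y ^ (p ^ Suc l - p) * y ^ p = (y ^ (p ^ l)) ^ p"
      proof -
        have "p ^ 1 \<le> p ^ Suc l" using p2 by (intro power_increasing) auto
        then show ?thesis by (simp add: mult.commute flip: power_add power_mult)
      qed
      have "f ^ (p ^ Suc r - 2) * h r * (f * y) ^ (p ^ Suc l - p) * y ^ p * \<delta>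
          = (f ^ (p ^ Suc r - 2) * f ^ (p ^ Suc l - p)) * (y ^ (p ^ Suc l - p) * y ^ p) * (\<delta> * h r)"
        by (simp only: power_mult_distrib mult_ac)
      also have "\<dots> = (f ^ (p ^ r + p ^ l - 2) * y ^ (p ^ l)) ^ p * (f ^ (p - 2) * \<delta> * h r)"
        unfolding f_power y_power by (simp only: power_mult_distrib mult_ac)
      finally show ?thesis
        unfolding theta_def p_def by (simp only: trace_Suc_power_mult)
    qed
    have B_dvd: "f dvd trace r (f ^ (p ^ r + p ^ l - 2) * y ^ (p ^ l) * theta f \<delta> (h r)) - (if l = 0 then M else 0)"
    proof (cases "l = 0")
      case True
      then show ?thesis by (simp add: M_def r_def mult_ac)
    next
      case False
      have "p ^ 1 \<le> p ^ l" using p2 False by (intro power_increasing) auto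
      then have "p ^ r \<le> p ^ r + p ^ l - 2" using p2 by simp
      then have "f ^ (p ^ r) dvd f ^ (p ^ r + p ^ l - 2)" by (rule le_imp_power_dvd)
      then show ?thesis
        using False unfolding p_def by (simp add: dvd_trace dvd_mult2)
    qed
    show ?thesis
      using dvd_add[OF A_dvd B_dvd] unfolding T_eq B_eq by (simp only: add_diff_eq)
  qed
  have "f dvd (\<Sum>l\<le>j. T (Suc l) - (if l = 0 then M else 0))"
    by (intro dvd_sum T) simp
  then have "f dvd (\<Sum>l\<le>j. T (Suc l)) - M"
    by (simp add: sum_subtractf)
  moreover have "\<psi> (witt_unit i (f * y)) = T 0 + (\<Sum>l\<le>j. T (Suc l))"
    using represents_witt_unit[OF rep, of i C] i
    by (simp add: C j T_def sum.atMost_Suc_shift del: sum.atMost_Suc)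
  moreover have "trace (Suc i) (y * (f * g i + f ^ (p ^ Suc i - 1) * theta f \<delta> (h (Suc i)))) = T 0 + M"
    by (simp add: T_def M_def C distrib_left trace_add mult_ac)
  ultimately show ?thesis by (simp add: \<delta>_def)
qed

text \<open>
  The divisibility imposed on the last coordinate forces \<open>f ^ (p ^ (m + 1) - 2)\<close> to divide \<open>g m\<close>.
  Going down, the divisibility imposed on the coordinate \<open>i\<close> then forces \<open>g i\<close> to be
  \<open>f ^ (p ^ (i + 1) - 2)\<close> times some \<open>h i\<close> congruent to \<open>- theta f \<delta> (h (i + 1))\<close> modulo \<open>f\<close>, because
  the trace pairing detects divisibility by powers of \<open>f\<close>. In terms of \<open>h\<close>, the conditions on the
  traces of the \<open>g i\<close> become conditions on \<open>tau\<close>.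
\<close>

theorem witt_splitting_iff_chain:
  fixes F :: "('v::{finite, linorder}, 'k::{alg_closed_field, field_prime_char} witt) mpoly"
  assumes f: "f \<noteq> 0" and F: "red F = f"
  shows "(\<exists>\<psi>. witt_splitting (Suc m) f \<psi>) \<longleftrightarrow>
    (\<exists>h. tau f (h 0) = 1 \<and> (\<forall>i. 1 \<le> i \<and> i \<le> m \<longrightarrow> tau f (h i) = 0) \<and>
      (\<forall>i<m. f dvd h i + theta f (red (delta F)) (h (Suc i))))"
proof -
  define p where "p = CHAR('k)"
  define \<delta> where "\<delta> = red (delta F)"
  have p2: "p \<ge> 2" unfolding p_def by (intro prime_ge_2_nat) simp
  have q2: "p ^ Suc r \<ge> 2" for r
    unfolding p_def by (rule two_le_CHAR_power) simp
  have f_square: "f ^ (p ^ Suc r) = f ^ (p ^ Suc r - 2) * f\<^sup>2" for r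
  proof -
    have "p ^ Suc r = (p ^ Suc r - 2) + 2" using q2[of r] by simp
    then show ?thesis by (metis power_add)
  qed
  have f_pred: "f ^ (p ^ Suc r) = f ^ (p ^ Suc r - 1) * f" for r
  proof -
    have "p ^ Suc r = Suc (p ^ Suc r - 1)" using q2[of r] by linarith
    then show ?thesis by (metis power_Suc2)
  qed
  have trace_g: "trace 1 (f ^ (p ^ Suc r - 2) * h) = f ^ (p ^ r - 1) * tau f h" for r h
  proof -
    have "p ^ Suc r - 2 = p * (p ^ r - 1) + (p - 2)"
      using p2 by (simp add: diff_mult_distrib2)
    then have "f ^ (p ^ Suc r - 2) * h = (f ^ (p ^ r - 1)) ^ p ^ 1 * (f ^ (p - 2) * h)"
      by (simp add: power_add power_mult mult.assoc) (simp add: mult.commute flip: power_mult)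
    then have "trace 1 (f ^ (p ^ Suc r - 2) * h) = trace 1 ((f ^ (p ^ r - 1)) ^ CHAR('k) ^ 1 * (f ^ (p - 2) * h))"
      by (simp only: p_def)
    then show ?thesis by (simp only: trace_power_mult tau_def p_def)
  qed
  have f_mult: "f * (f ^ (p ^ Suc r - 2) * h) = f ^ (p ^ Suc r - 1) * h" for r h
  proof -
    have "p ^ Suc r - 1 = Suc (p ^ Suc r - 2)" using q2[of r] by linarith
    then show ?thesis by (simp add: mult.assoc)
  qed
  show ?thesis
    unfolding \<delta>_def[symmetric]
  proof
    assume "\<exists>\<psi>. witt_splitting (Suc m) f \<psi>"
    then obtain \<psi> where splitting: "witt_splitting (Suc m) f \<psi>" ..
    have add: "\<psi> (x + y) = \<psi> x + \<psi> y"
      and lin: "\<psi> (witt_frob w * x) = coord w 0 * \<psi> x" and one: "\<psi> 1 = 1" for w x y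
      using splitting by (simp_all add: witt_splitting_def)
    have vanish: "\<psi> x = 0" if "\<And>i. i \<le> m \<Longrightarrow> coord x i = 0" for x
      using splitting that by (simp add: witt_splitting_def less_Suc_eq_le)
    have dvd: "f dvd \<psi> x" if "\<And>i. i < m \<Longrightarrow> f dvd coord x i" "f\<^sup>2 dvd coord x m" for x
      using splitting that by (simp add: witt_splitting_def)
    obtain g where g0: "\<And>i. 1 \<le> i \<Longrightarrow> i \<le> m \<Longrightarrow> trace 1 (g i) = 0" and rep: "represents m g \<psi>"
      using functional_represents[OF add lin vanish] by blast
    define h where "h i = (SOME h. g i = f ^ (p ^ Suc i - 2) * h)" for i
    have hI: "h i = c" if "g i = f ^ (p ^ Suc i - 2) * c" for i c
      unfolding h_def using that f by auto
    have gh: "\<forall>r. i \<le> r \<and> r \<le> m \<longrightarrow> g r = f ^ (p ^ Suc r - 2) * h r \<and>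
        (r < m \<longrightarrow> f dvd h r + theta f \<delta> (h (Suc r)))" if "i \<le> m" for i
      using that
    proof (induction rule: inc_induct)
      case base
      have "f dvd trace (Suc m) ((g m * f\<^sup>2) * b)" for b
      proof -
        have "f dvd \<psi> (witt_unit m (red (teich_lift (f\<^sup>2 * b))))"
          by (rule dvd) (simp_all add: witt_unit_def red_teich_lift)
        then show ?thesis
          unfolding represents_witt_unit[OF rep order_refl] by (simp add: red_teich_lift mult_ac)
      qed
      then have "f ^ (p ^ Suc m) dvd g m * f\<^sup>2" unfolding p_def by (rule trace_dvd_imp_dvd)
      then obtain c where "g m * f\<^sup>2 = f ^ (p ^ Suc m) * c" ..
      also have "f ^ (p ^ Suc m) = f ^ (p ^ Suc m - 2) * f\<^sup>2"
        by (rule f_square)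
      finally have "g m = f ^ (p ^ Suc m - 2) * c" using f by (simp add: mult_ac)
      then show ?case using hI[of m c] by auto
    next
      case (step i)
      let ?Z = "f * g i + f ^ (p ^ Suc i - 1) * theta f \<delta> (h (Suc i))"
      have "f dvd trace (Suc i) (?Z * b)" for b
      proof -
        have "f dvd \<psi> (witt_unit i (f * b))"
          using step.hyps by (intro dvd) (simp_all add: witt_unit_def)
        moreover have "f dvd \<psi> (witt_unit i (f * b)) - trace (Suc i) (b * ?Z)"
          unfolding p_def \<delta>_def
          by (rule represents_witt_unit_mult[OF rep g0 F])
            (use step in \<open>auto simp: p_def\<close>)
        ultimately have "f dvd \<psi> (witt_unit i (f * b)) - (\<psi> (witt_unit i (f * b)) - trace (Suc i) (b * ?Z))"
          by (rule dvd_diff)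
        then show ?thesis by (simp add: mult.commute)
      qed
      then have "f ^ (p ^ Suc i) dvd ?Z" unfolding p_def by (rule trace_dvd_imp_dvd)
      then obtain t where "?Z = f ^ (p ^ Suc i) * t" ..
      also have "f ^ (p ^ Suc i) = f ^ (p ^ Suc i - 1) * f"
        by (rule f_pred)
      finally have "f * g i = f * (f ^ (p ^ Suc i - 2) * (f * t - theta f \<delta> (h (Suc i))))"
        unfolding f_mult by (simp add: algebra_simps)
      then have gi: "g i = f ^ (p ^ Suc i - 2) * (f * t - theta f \<delta> (h (Suc i)))"
        using f by simp
      from hI[OF this] have hi: "h i = f * t - theta f \<delta> (h (Suc i))" .
      show ?case
      proof (intro allI impI)
        fix r assume r: "i \<le> r \<and> r \<le> m"
        show "g r = f ^ (p ^ Suc r - 2) * h r \<and> (r < m \<longrightarrow> f dvd h r + theta f \<delta> (h (Suc r)))"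
        proof (cases "r = i")
          case True
          then show ?thesis using gi hi by simp
        next
          case False
          then show ?thesis using step.IH r by (auto simp: Suc_le_eq)
        qed
      qed
    qed
    show "\<exists>h. tau f (h 0) = 1 \<and> (\<forall>i. 1 \<le> i \<and> i \<le> m \<longrightarrow> tau f (h i) = 0) \<and>
        (\<forall>i<m. f dvd h i + theta f \<delta> (h (Suc i)))"
    proof (intro exI[of _ h] conjI allI impI)
      show "tau f (h 0) = 1"
        using represents_one[OF rep] one gh[of 0] trace_g[of 0 "h 0"] by simp
    next
      fix i assume i: "1 \<le> i \<and> i \<le> m"
      then have "f ^ (p ^ i - 1) * tau f (h i) = 0"
        using gh[of i] g0[of i] trace_g[of i "h i"] by simp
      then show "tau f (h i) = 0" using f by simp
    next
      fix i assume "i < m"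
      then show "f dvd h i + theta f \<delta> (h (Suc i))" using gh[of i] by simp
    qed
  next
    assume "\<exists>h. tau f (h 0) = 1 \<and> (\<forall>i. 1 \<le> i \<and> i \<le> m \<longrightarrow> tau f (h i) = 0) \<and>
      (\<forall>i<m. f dvd h i + theta f \<delta> (h (Suc i)))"
    then obtain h where h0: "tau f (h 0) = 1" and h: "\<And>i. 1 \<le> i \<Longrightarrow> i \<le> m \<Longrightarrow> tau f (h i) = 0"
      and h_dvd: "\<And>i. i < m \<Longrightarrow> f dvd h i + theta f \<delta> (h (Suc i))" by blast
    define g where "g r = f ^ (p ^ Suc r - 2) * h r" for r
    have g0: "trace 1 (g i) = 0" if "1 \<le> i" "i \<le> m" for i
      using that unfolding g_def trace_g by (simp add: h)
    obtain \<psi> where \<psi>: "represents m g \<psi> \<and>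
        (\<forall>x y. \<psi> (x + y) = \<psi> x + \<psi> y) \<and>
        (\<forall>w x. \<psi> (witt_frob w * x) = coord w 0 * \<psi> x) \<and>
        (\<forall>x. (\<forall>i\<le>m. coord x i = 0) \<longrightarrow> \<psi> x = 0)"
      using functional_exists[of m g, OF g0] by (rule exE)
    then have rep: "represents m g \<psi>" and add: "\<psi> (x + y) = \<psi> x + \<psi> y"
      and lin: "\<psi> (witt_frob w * x) = coord w 0 * \<psi> x" for w x y by simp_all
    have vanish: "\<psi> x = 0" if "\<And>i. i \<le> m \<Longrightarrow> coord x i = 0" for x
      using \<psi> that by simp
    have zero: "\<psi> 0 = 0" by (rule vanish) simp
    have cong: "\<psi> x = \<psi> y" if "pcong m (wval m x) (wval m y)" for x y
      using that rep wval_eq_frob_sum[of m x] wval_eq_frob_sum[of m y]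
      unfolding represents_def by (metis pcong_refl)
    have sum_units: "\<psi> x = (\<Sum>i\<le>m. \<psi> (witt_unit i (coord x i)))" for x
    proof -
      have "wval m (witt_unit i (coord x i)) = of_nat p ^ i * teich_lift (coord x i) ^ (p ^ (m - i))"
        if "i \<le> m" for i
      proof -
        have "(\<lambda>j. teich_lift (coord (witt_unit i (coord x i)) j)) = (\<lambda>j. if j = i then teich_lift (coord x i) else 0)"
          by (auto simp: witt_unit_def teich_lift_zero)
        then show ?thesis using that by (simp add: wval_def ghost_single p_def)
      qed
      then have "(\<Sum>i\<le>m. wval m (witt_unit i (coord x i))) = wval m x"
        by (simp add: wval_def ghost_def p_def)
      then have "\<psi> x = \<psi> (\<Sum>i\<le>m. witt_unit i (coord x i))"
        using wval_sum[of m "\<lambda>i. witt_unit i (coord x i)" "{..m}"] by (intro cong) (simp add: pcong_sym)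
      also have "\<psi> (sum c S) = (\<Sum>i\<in>S. \<psi> (c i))" for c :: "nat \<Rightarrow> ('v, 'k) mpoly witt" and S
        by (induction S rule: infinite_finite_induct) (simp_all add: add zero)
      finally show ?thesis .
    qed
    have "witt_splitting (Suc m) f \<psi>"
      unfolding witt_splitting_def
    proof (intro conjI allI impI)
      show "\<psi> 1 = 1"
        using represents_one[OF rep] trace_g[of 0 "h 0"] by (simp add: g_def h0)
    next
      fix x :: "('v, 'k) mpoly witt"
      assume x: "(\<forall>i. i + 1 < Suc m \<longrightarrow> f dvd coord x i) \<and> f\<^sup>2 dvd coord x (Suc m - 1)"
      show "f dvd \<psi> x"
        unfolding sum_units[of x]
      proof (rule dvd_sum)
        fix i assume i: "i \<in> {..m}"
        show "f dvd \<psi> (witt_unit i (coord x i))"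
        proof (cases "i < m")
          case True
          then obtain y where y: "coord x i = f * y" using x by (auto elim: dvdE)
          have "f dvd \<psi> (witt_unit i (f * y))
              - trace (Suc i) (y * (f * g i + f ^ (p ^ Suc i - 1) * theta f \<delta> (h (Suc i))))"
            unfolding p_def \<delta>_def
            by (rule represents_witt_unit_mult[OF rep g0 F True]) (simp_all add: g_def p_def)
          moreover have "f dvd trace (Suc i) (y * (f * g i + f ^ (p ^ Suc i - 1) * theta f \<delta> (h (Suc i))))"
          proof (rule dvd_trace, rule dvd_mult)
            have "f ^ (p ^ Suc i) = f ^ (p ^ Suc i - 1) * f"
        by (rule f_pred)
            moreover have "f * g i + f ^ (p ^ Suc i - 1) * theta f \<delta> (h (Suc i))
                = f ^ (p ^ Suc i - 1) * (h i + theta f \<delta> (h (Suc i)))"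
              unfolding g_def f_mult by (simp add: distrib_left)
            ultimately show "f ^ CHAR('k) ^ Suc i dvd f * g i + f ^ (p ^ Suc i - 1) * theta f \<delta> (h (Suc i))"
              using h_dvd[OF True] by (simp add: p_def)
          qed
          ultimately show ?thesis unfolding y by (metis dvd_add diff_add_cancel)
        next
          case False
          with i have im: "i = m" by simp
          from x obtain y where y: "coord x m = f\<^sup>2 * y" by (auto elim: dvdE)
          have "\<psi> (witt_unit m (f\<^sup>2 * y)) = trace (Suc m) (g m * (f\<^sup>2 * y))"
            using represents_witt_unit[OF rep order_refl, of "teich_lift (f\<^sup>2 * y)"] by (simp add: red_teich_lift)
          also have "g m * (f\<^sup>2 * y) = f ^ (CHAR('k) ^ Suc m) * (h m * y)"
          proof -
            have "f ^ (p ^ Suc m) = f ^ (p ^ Suc m - 2) * f\<^sup>2"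
              by (rule f_square)
            then show ?thesis by (simp add: g_def mult_ac flip: p_def)
          qed
          finally show ?thesis by (simp only: im y trace_power_mult) simp
        qed
      qed
    qed (use add lin vanish in \<open>auto simp: less_Suc_eq_le\<close>)
    then show "\<exists>\<psi>. witt_splitting (Suc m) f \<psi>" by blast
  qed
qed

corollary quasi_F_split_iff_chain:
  fixes F :: "('v::{finite, linorder}, 'k::{alg_closed_field, field_prime_char} witt) mpoly"
  assumes f: "f \<noteq> 0" and F: "red F = f"
  shows "quasi_F_split (Suc m) f \<longleftrightarrow>
    (\<exists>h. tau f (h 0) = 1 \<and> (\<forall>i. 1 \<le> i \<and> i \<le> m \<longrightarrow> tau f (h i) = 0) \<and>
      (\<forall>i<m. f dvd h i + theta f (red (delta F)) (h (Suc i))))"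
  using witt_splitting_iff_chain[OF f F, of m] witt_splitting_of_quasi_F_split[OF f, of "Suc m"]
    quasi_F_split_of_witt_splitting[OF f, of "Suc m"] by auto


section \<open>The criterion in the middle degree\<close>

lemma homogeneous_zero [simp]: "homogeneous q D 0"
  by (simp add: homogeneous_def)

lemma homogeneous_sum: "(\<And>s. s \<in> S \<Longrightarrow> homogeneous q D (h s)) \<Longrightarrow> homogeneous q D (sum h S)"
  by (induction S rule: infinite_finite_induct) (auto intro: homogeneous_add)

lemma homogeneous_single: "weighted_degree q \<mu> = D \<Longrightarrow> homogeneous q D (single \<mu> c)"
  by (auto simp: homogeneous_def lookup_single when_def)

lemma homogeneous_const_mult: "homogeneous q D g \<Longrightarrow> homogeneous q D (single 0 c * g)"
  by (simp add: homogeneous_def lookup_const_mult) (metis mult_zero_right)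

lemma single_0_power: "single (0 :: 'v monomial) c ^ n = single 0 (c ^ n)"
  for c :: "'r::comm_ring_1"
proof -
  have "scale_monomial n (0 :: 'v monomial) = 0" by (rule poly_mapping_eqI) simp
  then show ?thesis by (simp add: single_power)
qed

lemma trace_const_mult:
  fixes g :: "('v::finite, 'k::{alg_closed_field, field_prime_char}) mpoly"
  shows "trace e (single 0 c * g) = single 0 (frob_root e c) * trace e g"
  using trace_power_mult[of e "single 0 (frob_root e c)" g] by (simp add: single_0_power)

lemma tau_diff: "tau f (g - h) = tau f g - tau f h"
  by (simp add: tau_def right_diff_distrib trace_diff)

lemma tau_power_mult: "tau f (a ^ CHAR('k) * h) = a * tau f h"
  for f a h :: "('v::finite, 'k::{alg_closed_field, field_prime_char}) mpoly"
  using trace_power_mult[of 1 a "f ^ (CHAR('k) - 2) * h"] by (simp add: tau_def mult.left_commute)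

lemma theta_diff: "theta f \<delta> (g - h) = theta f \<delta> g - theta f \<delta> h"
  by (simp add: theta_def right_diff_distrib trace_diff)

lemma theta_zero [simp]: "theta f \<delta> 0 = 0"
  by (simp add: theta_def)

lemma theta_power_mult: "theta f \<delta> (a ^ CHAR('k) * h) = a * theta f \<delta> h"
  for f \<delta> a h :: "('v::finite, 'k::{alg_closed_field, field_prime_char}) mpoly"
  using trace_power_mult[of 1 a "f ^ (CHAR('k) - 2) * \<delta> * h"] by (simp add: theta_def mult.left_commute)

text \<open>Replacing \<open>\<delta>\<close> by \<open>\<delta> - g ^ p\<close>, the effect of changing the lift, perturbs \<open>theta\<close> by a
  multiple of \<open>tau\<close>; on the kernel of \<open>tau\<close> nothing changes.\<close>

lemma theta_twist: "theta f (\<delta> - g ^ CHAR('k)) h = theta f \<delta> h - g * tau f h"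
  for f \<delta> g h :: "('v::finite, 'k::{alg_closed_field, field_prime_char}) mpoly"
proof -
  have "f ^ (CHAR('k) - 2) * (\<delta> - g ^ CHAR('k)) * h
      = f ^ (CHAR('k) - 2) * \<delta> * h - g ^ CHAR('k) ^ 1 * (f ^ (CHAR('k) - 2) * h)"
    by (simp add: algebra_simps)
  then show ?thesis
    by (simp only: theta_def tau_def trace_diff trace_power_mult)
qed

text \<open>
  The degree of \<open>f\<close> equals the sum of the weights, which is exactly the shift of degrees caused by
  the trace. Hence \<open>theta\<close> preserves the forms of degree \<open>d\<close>, \<open>tau\<close> maps them to constants, and the
  multiples of \<open>f\<close> among them are the constant ones. The criterion becomes a statement about
  inverse-linear maps on a finite-dimensional vector space.
\<close>

locale middle_degree =
  fixes q :: "'v::{finite, linorder} \<Rightarrow> nat"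
    and f \<delta> :: "('v, 'k::{alg_closed_field, field_prime_char}) mpoly"
  assumes q_pos: "\<And>j. q j > 0"
    and f_nonzero: "f \<noteq> 0"
    and f_hom: "homogeneous q (\<Sum>j\<in>UNIV. q j) f"
    and \<delta>_hom: "homogeneous q (CHAR('k) * (\<Sum>j\<in>UNIV. q j)) \<delta>"
begin

abbreviation d :: nat where "d \<equiv> \<Sum>j\<in>UNIV. q j"

lemma p_ge_2: "CHAR('k) \<ge> 2"
  by (intro prime_ge_2_nat) simp

lemma tau_hom_part: "tau f (hom_part q d h) = single 0 (lookup (tau f h) 0)"
proof -
  have "CHAR('k) - 1 = Suc (CHAR('k) - 2)" using p_ge_2 by simp
  then have degree: "CHAR('k) ^ 1 * 0 + d * (CHAR('k) ^ 1 - 1) = (CHAR('k) - 2) * d + d" by simp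
  have "hom_part q 0 (tau f h) = tau f (hom_part q d h)"
    unfolding tau_def hom_part_trace degree hom_part_mult[OF homogeneous_power[OF f_hom]] ..
  then show ?thesis using hom_part_0[of q "tau f h", OF q_pos] by simp
qed

lemma theta_hom_part:
  assumes "homogeneous q (CHAR('k) * d) \<delta>'"
  shows "theta f \<delta>' (hom_part q d h) = hom_part q d (theta f \<delta>' h)"
proof -
  have "CHAR('k) - 1 = Suc (CHAR('k) - 2)" using p_ge_2 by simp
  then have degree: "CHAR('k) ^ 1 * d + d * (CHAR('k) ^ 1 - 1) = ((CHAR('k) - 2) * d + CHAR('k) * d) + d"
    by simp
  show ?thesis
    unfolding theta_def hom_part_trace degree
      hom_part_mult[OF homogeneous_mult[OF homogeneous_power[OF f_hom] assms]] ..
qed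

lemma tau_homogeneous: "homogeneous q d h \<Longrightarrow> \<exists>c. tau f h = single 0 c"
  using tau_hom_part by (metis homogeneous_iff)

lemma theta_homogeneous:
  "homogeneous q (CHAR('k) * d) \<delta>' \<Longrightarrow> homogeneous q d h \<Longrightarrow> homogeneous q d (theta f \<delta>' h)"
  using theta_hom_part by (metis homogeneous_iff)

text \<open>
  The forms of degree \<open>d\<close> that can stand, in a chain as in the Fedder type criterion, in front of
  \<open>n\<close> further terms.
\<close>

fun J :: "nat \<Rightarrow> ('v, 'k) mpoly set" where
  "J 0 = {h. homogeneous q d h}"
| "J (Suc n) = {single 0 c * f - theta f \<delta> h | c h. h \<in> J n \<and> tau f h = 0}"

lemma J_homogeneous: "h \<in> J n \<Longrightarrow> homogeneous q d h"
proof (induction n arbitrary: h)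
  case (Suc n)
  then show ?case
    by (auto intro!: homogeneous_diff homogeneous_const_mult f_hom theta_homogeneous[OF \<delta>_hom])
qed simp

lemma J_const_mult: "h \<in> J n \<Longrightarrow> single 0 c * h \<in> J n"
proof (induction n arbitrary: h c)
  case 0
  then show ?case by (simp add: homogeneous_const_mult)
next
  case (Suc n)
  then obtain a h' where h: "h = single 0 a * f - theta f \<delta> h'" "h' \<in> J n" "tau f h' = 0" by auto
  have "single 0 c * h = single 0 (c * a) * f - theta f \<delta> (single 0 (c ^ CHAR('k)) * h')"
    unfolding h(1) single_0_power[symmetric] theta_power_mult
    using mult_single[of "0 :: 'v monomial" c 0 a] by (simp add: right_diff_distrib mult.assoc[symmetric])
  moreover have "tau f (single 0 (c ^ CHAR('k)) * h') = 0"
    unfolding single_0_power[symmetric] tau_power_mult h(3) by simp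
  ultimately show ?case using Suc.IH[OF h(2)] by auto
qed

lemma J_diff: "g \<in> J n \<Longrightarrow> h \<in> J n \<Longrightarrow> g - h \<in> J n"
proof (induction n arbitrary: g h)
  case 0
  then show ?case by (simp add: homogeneous_diff)
next
  case (Suc n)
  from Suc.prems obtain a g' b h' where
    "g = single 0 a * f - theta f \<delta> g'" "g' \<in> J n" "tau f g' = 0"
    "h = single 0 b * f - theta f \<delta> h'" "h' \<in> J n" "tau f h' = 0" by auto
  then have "g - h = single 0 (a - b) * f - theta f \<delta> (g' - h')" "g' - h' \<in> J n" "tau f (g' - h') = 0"
    by (simp_all add: theta_diff tau_diff single_diff left_diff_distrib Suc.IH)
  then show ?case by auto
qed

lemma J_uminus: "h \<in> J n \<Longrightarrow> - h \<in> J n"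
  using J_const_mult[of h n "- 1"] by (simp add: single_uminus)

lemma zero_in_J: "0 \<in> J n"
proof (induction n)
  case (Suc n)
  then show ?case by (auto intro!: exI[of _ 0] simp: tau_def)
qed simp

lemma f_in_J: "f \<in> J n"
proof (cases n)
  case 0
  then show ?thesis by (simp add: f_hom)
next
  case (Suc m)
  have "f = single 0 1 * f - theta f \<delta> 0 \<and> 0 \<in> J m \<and> tau f 0 = 0"
    by (simp add: zero_in_J tau_def)
  then show ?thesis unfolding Suc J.simps by blast
qed

lemma J_Suc_subset: "J (Suc n) \<subseteq> J n"
proof (induction n)
  case 0
  then show ?case using J_homogeneous[of _ "Suc 0"] by auto
next
  case (Suc n)
  then show ?case by (subst (1 2) J.simps(2)) blast
qed

lemma J_antimono: "m \<le> n \<Longrightarrow> J n \<subseteq> J m"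
  by (induction n rule: dec_induct) (use J_Suc_subset in blast)+

text \<open>
  Every condition on a chain is compatible with taking components of degree \<open>d\<close>, so a chain may be
  replaced by one consisting of forms. \<open>J m\<close> collects the possible initial terms, built from the
  end of the chain.
\<close>

lemma chain_iff_J:
  "(\<exists>h. tau f (h 0) = 1 \<and> (\<forall>i. 1 \<le> i \<and> i \<le> m \<longrightarrow> tau f (h i) = 0) \<and>
      (\<forall>i<m. f dvd h i + theta f \<delta> (h (Suc i)))) \<longleftrightarrow> (\<exists>h\<in>J m. tau f h = 1)"
proof
  assume "\<exists>h. tau f (h 0) = 1 \<and> (\<forall>i. 1 \<le> i \<and> i \<le> m \<longrightarrow> tau f (h i) = 0) \<and>
      (\<forall>i<m. f dvd h i + theta f \<delta> (h (Suc i)))"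
  then obtain h where h: "tau f (h 0) = 1" "\<And>i. 1 \<le> i \<Longrightarrow> i \<le> m \<Longrightarrow> tau f (h i) = 0"
    "\<And>i. i < m \<Longrightarrow> f dvd h i + theta f \<delta> (h (Suc i))" by blast
  have step: "\<exists>c. hom_part q d (h i) = single 0 c * f - theta f \<delta> (hom_part q d (h (Suc i)))" if i: "i < m" for i
  proof -
    obtain t where "h i + theta f \<delta> (h (Suc i)) = f * t" using h(3)[OF i] ..
    then have "hom_part q d (h i) + hom_part q d (theta f \<delta> (h (Suc i))) = hom_part q (d + 0) (f * t)"
      by (simp flip: hom_part_add)
    also have "\<dots> = single 0 (lookup t 0) * f"
      unfolding hom_part_mult[OF f_hom] hom_part_0[OF q_pos] by (rule mult.commute)
    finally show ?thesis
      unfolding theta_hom_part[OF \<delta>_hom] by (intro exI[of _ "lookup t 0"]) (simp add: algebra_simps)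
  qed
  have "hom_part q d (h (m - i)) \<in> J i" if "i \<le> m" for i
    using that
  proof (induction i)
    case 0
    then show ?case by (simp add: homogeneous_hom_part)
  next
    case (Suc i)
    then have m: "Suc (m - Suc i) = m - i" by simp
    obtain c where "hom_part q d (h (m - Suc i)) = single 0 c * f - theta f \<delta> (hom_part q d (h (m - i)))"
      using step[of "m - Suc i"] Suc.prems unfolding m by auto
    moreover have "tau f (hom_part q d (h (m - i))) = 0"
      unfolding tau_hom_part using h(2)[of "m - i"] Suc.prems by simp
    ultimately show ?case using Suc by auto
  qed
  from this[of m] have "hom_part q d (h 0) \<in> J m" by simp
  moreover have "tau f (hom_part q d (h 0)) = 1" unfolding tau_hom_part h(1) by simp
  ultimately show "\<exists>h\<in>J m. tau f h = 1" by blast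
next
  have "\<exists>s. s 0 = h \<and> (\<forall>i<m. tau f (s (Suc i)) = 0 \<and> f dvd s i + theta f \<delta> (s (Suc i)))"
    if "h \<in> J m" for h
    using that
  proof (induction m arbitrary: h)
    case (Suc m)
    then obtain c h' where h: "h = single 0 c * f - theta f \<delta> h'" "h' \<in> J m" "tau f h' = 0" by auto
    obtain s where s: "s 0 = h'" "\<forall>i<m. tau f (s (Suc i)) = 0 \<and> f dvd s i + theta f \<delta> (s (Suc i))"
      using Suc.IH[OF h(2)] by blast
    show ?case
    proof (intro exI[of _ "case_nat h s"] conjI allI impI)
      fix i assume "i < Suc m"
      then show "tau f (case_nat h s (Suc i)) = 0"
        and "f dvd case_nat h s i + theta f \<delta> (case_nat h s (Suc i))"
        using s h by (cases i; simp)+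
    qed simp
  qed auto
  moreover assume "\<exists>h\<in>J m. tau f h = 1"
  ultimately obtain s where "tau f (s 0) = 1"
    and s: "\<And>i. i < m \<Longrightarrow> tau f (s (Suc i)) = 0 \<and> f dvd s i + theta f \<delta> (s (Suc i))" by blast
  moreover have "tau f (s i) = 0" if "1 \<le> i" "i \<le> m" for i
    using that s[of "i - 1"] by simp
  ultimately show "\<exists>h. tau f (h 0) = 1 \<and> (\<forall>i. 1 \<le> i \<and> i \<le> m \<longrightarrow> tau f (h i) = 0) \<and>
      (\<forall>i<m. f dvd h i + theta f \<delta> (h (Suc i)))" by blast
qed

lemma tau_J_dichotomy: "(\<exists>h\<in>J m. tau f h = 1) \<longleftrightarrow> (\<exists>h\<in>J m. tau f h \<noteq> 0)"
proof
  assume "\<exists>h\<in>J m. tau f h \<noteq> 0"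
  then obtain h where h: "h \<in> J m" "tau f h \<noteq> 0" by blast
  obtain c where c: "tau f h = single 0 c" using tau_homogeneous[OF J_homogeneous[OF h(1)]] ..
  with h have "c \<noteq> 0" by auto
  then have "tau f (single 0 (inverse c ^ CHAR('k)) * h) = 1"
    unfolding single_0_power[symmetric] tau_power_mult c by (simp add: mult_single)
  then show "\<exists>h\<in>J m. tau f h = 1" using J_const_mult[OF h(1)] by blast
qed (metis zero_neq_one)

abbreviation twist :: "('v, 'k) mpoly \<Rightarrow> ('v, 'k) mpoly \<Rightarrow> ('v, 'k) mpoly" where
  "twist g \<equiv> theta f (\<delta> - g ^ CHAR('k))"

lemma twist_eq: "tau f h = 0 \<Longrightarrow> twist g h = theta f \<delta> h"
  by (simp add: theta_twist)

lemma twist_pow_diff: "(twist g ^^ e) (h - h') = (twist g ^^ e) h - (twist g ^^ e) h'"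
  by (induction e) (simp_all add: theta_diff)

lemma twist_pow_const_mult:
  "tau f ((twist g ^^ e) (single 0 c * h)) = single 0 (frob_root (Suc e) c) * tau f ((twist g ^^ e) h)"
proof (induction e arbitrary: c h)
  case 0
  show ?case using tau_power_mult[of f "single 0 (frob_root 1 c)" h] frob_root_power[of 1 c]
    by (simp add: single_0_power)
next
  case (Suc e)
  have "twist g (single 0 c * h) = single 0 (frob_root 1 c) * twist g h"
    using theta_power_mult[of f "\<delta> - g ^ CHAR('k)" "single 0 (frob_root 1 c)" h] frob_root_power[of 1 c]
    by (simp add: single_0_power)
  then show ?case
    using Suc[of "frob_root 1 c" "twist g h"] by (simp add: funpow_swap1 frob_root_root)
qed

text \<open>
  Along a chain \<open>theta\<close> is applied only to elements killed by \<open>tau\<close>, where it agrees with every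
  twist. An element of \<open>J N\<close> is therefore an \<open>N\<close>-fold twist of a form, up to sign, plus twists of
  order below \<open>N\<close> of multiples of \<open>f\<close>.
\<close>

lemma tau_J_eq_0_of_twist:
  assumes top: "\<And>h. homogeneous q d h \<Longrightarrow> tau f ((twist g ^^ N) h) = 0"
    and f0: "\<And>e. e < N \<Longrightarrow> tau f ((twist g ^^ e) f) = 0"
    and "h \<in> J N"
  shows "tau f h = 0"
proof -
  have "tau f ((twist g ^^ (N - j)) h) = 0" if "j \<le> N" "h \<in> J j" for j h
    using that
  proof (induction j arbitrary: h)
    case 0
    then show ?case by (simp add: top)
  next
    case (Suc j)
    then obtain c h' where h: "h = single 0 c * f - theta f \<delta> h'" "h' \<in> J j" "tau f h' = 0" by auto
    have "(twist g ^^ (N - Suc j)) (theta f \<delta> h') = (twist g ^^ (N - j)) h'"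
    proof -
      have "N - j = Suc (N - Suc j)" using Suc.prems by simp
      then show ?thesis by (simp add: funpow_swap1 twist_eq[OF h(3)])
    qed
    moreover have "tau f ((twist g ^^ (N - j)) h') = 0" using Suc.IH[of h'] Suc.prems h by simp
    moreover have "tau f ((twist g ^^ (N - Suc j)) (single 0 c * f)) = 0"
      using f0[of "N - Suc j"] Suc.prems by (simp add: twist_pow_const_mult)
    ultimately show ?case unfolding h(1) twist_pow_diff tau_diff by simp
  qed
  from this[of N h] assms(3) show ?thesis by simp
qed

text \<open>
  If \<open>e\<close> is a form in \<open>J (N - 1)\<close> with \<open>tau f e = 1\<close>, the twist by \<open>theta f \<delta> e\<close> kills \<open>e\<close>, so it
  is \<open>theta\<close> composed with the projection to the kernel of \<open>tau\<close> along \<open>e\<close>. That projection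
  preserves \<open>J i\<close> for \<open>i < N\<close>, whence the twist maps \<open>J i\<close> into \<open>J (i + 1)\<close>.
\<close>

lemma exists_twist:
  assumes zero: "\<And>h. h \<in> J N \<Longrightarrow> tau f h = 0"
    and less: "\<And>i. i < N \<Longrightarrow> \<exists>h\<in>J i. tau f h = 1"
  shows "\<exists>g. homogeneous q d g \<and>
    (\<forall>h. homogeneous q d h \<longrightarrow> tau f ((twist g ^^ N) h) = 0) \<and> (\<forall>e. tau f ((twist g ^^ e) f) = 0 \<or> N = 0)"
proof (cases N)
  case 0
  then show ?thesis using zero by (intro exI[of _ 0]) auto
next
  case (Suc M)
  obtain e where e: "e \<in> J M" "tau f e = 1" using less[of M] Suc by auto
  define g where "g = theta f \<delta> e"
  have g: "homogeneous q d g"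
    unfolding g_def by (intro theta_homogeneous \<delta>_hom J_homogeneous[OF e(1)])
  have twist_e: "twist g e = 0" by (simp add: theta_twist e g_def)
  have theta_J: "theta f \<delta> x \<in> J (Suc i)" if "x \<in> J i" "tau f x = 0" for x i
  proof -
    have "single 0 0 * f - theta f \<delta> x \<in> J (Suc i)" using that unfolding J.simps by blast
    then show ?thesis using J_uminus by fastforce
  qed
  have twist_J: "twist g x \<in> J (Suc i)" if x: "x \<in> J i" "i \<le> M" for x i
  proof -
    obtain c where c: "tau f x = single 0 c" using tau_homogeneous[OF J_homogeneous[OF x(1)]] ..
    define y where "y = x - single 0 c ^ CHAR('k) * e"
    have "e \<in> J i" using e(1) J_antimono[OF x(2)] by blast
    then have "y \<in> J i"
      unfolding y_def single_0_power by (intro J_diff x(1) J_const_mult)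
    moreover have "tau f y = 0"
      unfolding y_def tau_diff tau_power_mult by (simp add: c e(2))
    moreover have "twist g x = twist g y"
      unfolding y_def theta_diff theta_power_mult twist_e by simp
    ultimately show ?thesis using theta_J twist_eq by simp
  qed
  have pow_J: "(twist g ^^ i) h \<in> J i" if "homogeneous q d h" "i \<le> N" for h i
    using that by (induction i) (auto simp: Suc simp del: J.simps(2) intro: twist_J)
  have "(twist g ^^ i) f \<in> J N" for i
  proof (induction i)
    case 0
    show ?case using f_in_J by simp
  next
    case (Suc i)
    then have "twist g ((twist g ^^ i) f) \<in> J (Suc N)"
      using zero theta_J twist_eq by simp
    then show ?case using J_Suc_subset by auto
  qed
  then show ?thesis using g pow_J[of _ N] zero by blast
qed

end

section \<open>Frobenius powers of the maximal ideal\<close>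

lemma Var_power_eq: "Var v ^ e = single (single v e) (1 :: 'r::comm_ring_1)"
proof -
  have "scale_monomial e (single v 1) = single v e"
    by (rule poly_mapping_eqI) (simp add: lookup_single when_def)
  then show ?thesis by (simp add: Var_def single_power)
qed

lemma frob_ideal_add: "x \<in> frob_ideal l \<Longrightarrow> y \<in> frob_ideal l \<Longrightarrow> x + y \<in> frob_ideal l"
proof -
  assume "x \<in> frob_ideal l" "y \<in> frob_ideal l"
  then obtain h u h' u' where "x = of_nat CHAR('b) * h + (\<Sum>v\<in>UNIV. Var v ^ (CHAR('b) ^ l) * u v)"
    "y = of_nat CHAR('b) * h' + (\<Sum>v\<in>UNIV. Var v ^ (CHAR('b) ^ l) * u' v)"
    unfolding frob_ideal_def by blast
  then have "x + y = of_nat CHAR('b) * (h + h') + (\<Sum>v\<in>UNIV. Var v ^ (CHAR('b) ^ l) * (u v + u' v))"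
    by (simp add: distrib_left sum.distrib)
  then show ?thesis unfolding frob_ideal_def mem_Collect_eq by (intro exI conjI) (assumption, rule TrueI)
qed

lemma frob_ideal_p_mult: "of_nat CHAR('k) * h \<in> frob_ideal l"
  for h :: "('v::finite, 'k::comm_ring_prime_char witt) mpoly"
  unfolding frob_ideal_def mem_Collect_eq
  by (intro exI[of _ h] exI[of _ "\<lambda>_. 0"] conjI) simp_all

lemma frob_ideal_Var_mult: "Var w ^ (CHAR('k) ^ l) * u \<in> frob_ideal l"
  for u :: "('v::finite, 'k::comm_ring_prime_char witt) mpoly"
proof -
  have "(\<Sum>v\<in>UNIV. Var v ^ (CHAR('k) ^ l) * (if v = w then u else 0))
      = (\<Sum>v\<in>UNIV. if v = w then Var w ^ (CHAR('k) ^ l) * u else 0)"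
    by (intro sum.cong) auto
  then show ?thesis
    unfolding frob_ideal_def mem_Collect_eq
    by (intro exI[of _ 0] exI[of _ "\<lambda>v. if v = w then u else 0"] conjI) simp_all
qed

lemma frob_ideal_iff:
  fixes x :: "('v::finite, 'k::{alg_closed_field, field_prime_char} witt) mpoly"
  shows "x \<in> frob_ideal l \<longleftrightarrow> (\<forall>\<mu>\<in>keys (red x). \<exists>v. CHAR('k) ^ l \<le> lookup \<mu> v)"
proof
  assume "x \<in> frob_ideal l"
  then obtain h u where x: "x = of_nat CHAR('k) * h + (\<Sum>v\<in>UNIV. Var v ^ (CHAR('k) ^ l) * u v)"
    unfolding frob_ideal_def by blast
  have red_Var: "red (Var v :: ('v, 'k witt) mpoly) = Var v" for v
    by (simp add: Var_def red_single coord_one)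
  have "red x = (\<Sum>v\<in>UNIV. Var v ^ (CHAR('k) ^ l) * red (u v))"
    unfolding x red.add by (simp add: red.sum red.mult[of "Var _ ^ _"] red.power red_Var)
  then have "keys (red x) \<subseteq> (\<Union>v. keys (Var v ^ (CHAR('k) ^ l) * red (u v)))"
    using keys_sum[of "\<lambda>v. Var v ^ (CHAR('k) ^ l) * red (u v)" UNIV] by simp
  moreover have "CHAR('k) ^ l \<le> lookup \<mu> v" if "\<mu> \<in> keys (Var v ^ (CHAR('k) ^ l) * red (u v))" for \<mu> v
    using that keys_mult[of "Var v ^ (CHAR('k) ^ l)" "red (u v)"]
    by (auto simp: Var_power_eq lookup_add)
  ultimately show "\<forall>\<mu>\<in>keys (red x). \<exists>v. CHAR('k) ^ l \<le> lookup \<mu> v" by blast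
next
  assume keys: "\<forall>\<mu>\<in>keys (red x). \<exists>v. CHAR('k) ^ l \<le> lookup \<mu> v"
  have single: "single \<mu> (lookup x \<mu>) \<in> frob_ideal l" for \<mu>
  proof (cases "\<mu> \<in> keys (red x)")
    case True
    then obtain v where v: "CHAR('k) ^ l \<le> lookup \<mu> v" using keys by blast
    define \<nu> where "\<nu> = Abs_poly_mapping (\<lambda>w. if w = v then lookup \<mu> v - CHAR('k) ^ l else lookup \<mu> w)"
    have "\<mu> = single v (CHAR('k) ^ l) + \<nu>"
      by (rule poly_mapping_eqI) (use v in \<open>simp add: lookup_add lookup_single \<nu>_def when_def\<close>)
    then have "single \<mu> (lookup x \<mu>) = Var v ^ (CHAR('k) ^ l) * single \<nu> (lookup x \<mu>)"
      by (simp add: Var_power_eq mult_single)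
    then show ?thesis by (simp only: frob_ideal_Var_mult)
  next
    case False
    then have "coord (lookup x \<mu>) 0 = 0" by (simp add: in_keys_iff lookup_red)
    then obtain c where "of_nat CHAR('k) * c = lookup x \<mu>" using of_nat_CHAR_dvd_witt by blast
    then have "single \<mu> (lookup x \<mu>) = of_nat CHAR('k) * single \<mu> c"
      using mult_single[of 0 "of_nat CHAR('k)" \<mu> c] by simp
    then show ?thesis by (simp only: frob_ideal_p_mult)
  qed
  have zero: "(0 :: ('v, 'k witt) mpoly) \<in> frob_ideal l"
    using frob_ideal_p_mult[of 0] by simp
  have "(\<Sum>\<mu>\<in>S. single \<mu> (lookup x \<mu>)) \<in> frob_ideal l" if "finite S" for S
    using that by (induction S) (simp_all add: zero frob_ideal_add single)
  from this[OF finite_keys[of x]] show "x \<in> frob_ideal l" by (simp only: sum_single)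
qed

lemma lookup_mult_single: "lookup (P * single \<nu> c) (\<mu> + \<nu>) = lookup P \<mu> * c"
  for P :: "('v, 'r::comm_ring_1) mpoly"
  by (induction P rule: poly_mapping_add_induct)
    (simp_all add: mult_single lookup_single when_def distrib_right lookup_add)

text \<open>For forms, membership in a Frobenius power of the maximal ideal is orthogonality, under the
  trace pairing, to all forms of complementary degree.\<close>

lemma homogeneous_frob_ideal_iff:
  fixes P :: "('v::finite, 'k::{alg_closed_field, field_prime_char}) mpoly"
  assumes q: "\<And>j. q j > 0" and P: "homogeneous q D P"
    and DE: "D + E = (\<Sum>j\<in>UNIV. q j) * (CHAR('k) ^ l - 1)"
  shows "(\<forall>\<mu>\<in>keys P. \<exists>v. CHAR('k) ^ l \<le> lookup \<mu> v)
    \<longleftrightarrow> (\<forall>h. homogeneous q E h \<longrightarrow> trace l (P * h) = 0)"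
proof
  assume keys: "\<forall>\<mu>\<in>keys P. \<exists>v. CHAR('k) ^ l \<le> lookup \<mu> v"
  show "\<forall>h. homogeneous q E h \<longrightarrow> trace l (P * h) = 0"
  proof (intro allI impI)
    fix h :: "('v, 'k) mpoly" assume "homogeneous q E h"
    then have "hom_part q ((\<Sum>j\<in>UNIV. q j) * (CHAR('k) ^ l - 1)) (P * h) = P * h"
      using homogeneous_mult[OF P, of E h] unfolding DE homogeneous_iff by simp
    then have "hom_part q 0 (trace l (P * h)) = trace l (P * h)"
      unfolding hom_part_trace by simp
    moreover have "lookup (trace l (P * h)) 0 = 0"
    proof -
      have "const_monomial (CHAR('k) ^ l - 1) \<notin> keys (P * h)"
      proof
        assume "const_monomial (CHAR('k) ^ l - 1) \<in> keys (P * h)"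
        then obtain \<mu> \<nu> where "\<mu> \<in> keys P" and sum: "const_monomial (CHAR('k) ^ l - 1) = \<mu> + \<nu>"
          using keys_mult[of P h] by blast
        then obtain v where v: "CHAR('k) ^ l \<le> lookup \<mu> v" using keys by blast
        have "CHAR('k) ^ l - 1 = lookup \<mu> v + lookup \<nu> v"
          using arg_cong[OF sum, of "\<lambda>x. lookup x v"] by (simp add: lookup_add)
        moreover have "CHAR('k) ^ l > 0" by simp
        ultimately show False using v by linarith
      qed
      moreover have "scale_monomial (CHAR('k) ^ l) (0 :: 'v monomial) = 0"
        by (rule poly_mapping_eqI) simp
      ultimately show ?thesis by (simp add: lookup_trace in_keys_iff)
    qed
    ultimately show "trace l (P * h) = 0" using hom_part_0[of q "trace l (P * h)", OF q] by simp
  qed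
next
  assume tr: "\<forall>h. homogeneous q E h \<longrightarrow> trace l (P * h) = 0"
  show "\<forall>\<mu>\<in>keys P. \<exists>v. CHAR('k) ^ l \<le> lookup \<mu> v"
  proof (rule ballI, rule ccontr)
    fix \<mu> assume \<mu>: "\<mu> \<in> keys P" and "\<not> (\<exists>v. CHAR('k) ^ l \<le> lookup \<mu> v)"
    then have less: "lookup \<mu> v < CHAR('k) ^ l" for v by (simp add: not_le)
    define \<nu> where "\<nu> = dual_monomial (CHAR('k) ^ l) \<mu>"
    have sum: "\<mu> + \<nu> = const_monomial (CHAR('k) ^ l - 1)"
    proof (rule poly_mapping_eqI)
      fix v
      show "lookup (\<mu> + \<nu>) v = lookup (const_monomial (CHAR('k) ^ l - 1)) v"
        using less[of v] by (simp add: lookup_add \<nu>_def)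
    qed
    have "D + weighted_degree q \<nu> = D + E"
      using arg_cong[OF sum, of "weighted_degree q"] P \<mu>
      by (simp add: weighted_degree_add weighted_degree_const DE homogeneous_def in_keys_iff)
    then have "trace l (P * single \<nu> 1) = 0"
      using tr by (simp add: homogeneous_single)
    then have "lookup (trace l (P * single \<nu> 1)) 0 = 0" by simp
    moreover have "scale_monomial (CHAR('k) ^ l) (0 :: 'v monomial) = 0"
      by (rule poly_mapping_eqI) simp
    ultimately have "lookup (P * single \<nu> 1) (\<mu> + \<nu>) = 0"
      by (simp add: lookup_trace sum)
    then show False using \<mu> by (simp add: lookup_mult_single in_keys_iff)
  qed
qed


section \<open>The two non-splitting indices\<close>

text \<open>
  Changing the lift by \<open>p * h\<close> changes its \<open>p\<close>-th power only modulo \<open>p\<^sup>2\<close>, but changes the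
  Frobenius lift by \<open>p\<close> times a lift of the \<open>p\<close>-th power of \<open>h\<close>.
\<close>

lemma red_delta_add_p_mult:
  fixes g h :: "('v, 'k::{alg_closed_field, field_prime_char} witt) mpoly"
  shows "red (delta (g + of_nat CHAR('k) * h)) = red (delta g) - red h ^ CHAR('k)"
proof -
  let ?P = "of_nat CHAR('k) :: ('v, 'k witt) mpoly"
  have "?P ^ Suc 1 dvd (g + ?P * h) ^ CHAR('k) - g ^ CHAR('k)"
    by (rule dvd_diff_power_prime) simp_all
  then obtain z where "(g + ?P * h) ^ CHAR('k) - g ^ CHAR('k) = ?P ^ Suc 1 * z" ..
  then have z: "(g + ?P * h) ^ CHAR('k) = g ^ CHAR('k) + ?P * (?P * z)"
    by (simp add: algebra_simps)
  have "?P * delta (g + ?P * h) = ?P * delta g + ?P * (?P * z) - ?P * frob_lift h"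
    unfolding CHAR_mult_delta z frob_lift.add frob_lift.mult frob_lift.of_nat by (simp add: algebra_simps)
  also have "\<dots> = ?P * (delta g + ?P * z - frob_lift h)"
    by (simp add: algebra_simps)
  finally have "delta (g + ?P * h) = delta g + ?P * z - frob_lift h"
    by (rule of_nat_CHAR_mult_cancel)
  then show ?thesis by (simp add: red.add red.diff red_frob_lift)
qed

lemma homogeneous_red: "homogeneous q D g \<Longrightarrow> homogeneous q D (red g)"
  unfolding homogeneous_def lookup_red by (metis coord_zero)

lemma homogeneous_red_delta:
  fixes g :: "('v::finite, 'k::{alg_closed_field, field_prime_char} witt) mpoly"
  assumes "homogeneous q D g"
  shows "homogeneous q (CHAR('k) * D) (red (delta g))"
proof (rule homogeneous_red)
  have "homogeneous q (CHAR('k) * D) (frob_lift g)"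
    unfolding frob_lift_def using assms
    by (intro homogeneous_sum homogeneous_single)
      (auto simp: weighted_degree_scale homogeneous_def in_keys_iff)
  then have "homogeneous q (CHAR('k) * D) (of_nat CHAR('k) * delta g)"
    unfolding CHAR_mult_delta by (intro homogeneous_diff homogeneous_power assms)
  then show "homogeneous q (CHAR('k) * D) (delta g)"
    unfolding homogeneous_def lookup_of_nat_mult
    by (metis of_nat_CHAR_mult_witt_cancel mult_zero_right)
qed

lemma red_tilde_seq_1: "red (tilde_seq g 1) = red g ^ (CHAR('k) - 2)"
  for g :: "('v, 'k::comm_ring_prime_char witt) mpoly"
  by (simp add: tilde_seq_def red.power)

lemma red_tilde_seq_Suc:
  fixes g :: "('v, 'k::comm_ring_prime_char witt) mpoly"
  assumes "l \<ge> 1"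
  shows "red (tilde_seq g (Suc l))
    = red (tilde_seq g l) ^ CHAR('k) * (red g ^ (CHAR('k) - 2) * red (delta g))"
proof -
  define p where "p = CHAR('k)"
  define X where "X = red g ^ (p\<^sup>2 - 2 * p) * red (delta g)"
  define S where "S = (\<Sum>i<l - 1. p ^ i)"
  have "(\<Sum>i<l. p ^ i) = 1 + p * S"
  proof -
    obtain k where "l = Suc k" using assms by (cases l) auto
    then show ?thesis by (simp add: S_def sum.lessThan_Suc_shift sum_distrib_left del: sum.lessThan_Suc)
  qed
  then have "red (tilde_seq g (Suc l)) = red g ^ (p - 2) * (X * X ^ (p * S))"
    by (simp add: tilde_seq_def red.mult red.power X_def p_def power_add)
  also have "X = (red g ^ (p - 2)) ^ p * red (delta g)"
    by (simp add: X_def power2_eq_square diff_mult_distrib flip: power_mult)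
  also have "red g ^ (p - 2) * ((red g ^ (p - 2)) ^ p * red (delta g) * ((red g ^ (p - 2)) ^ p * red (delta g)) ^ (p * S))
      = (red g ^ (p - 2) * X ^ S) ^ p * (red g ^ (p - 2) * red (delta g))"
    unfolding \<open>X = (red g ^ (p - 2)) ^ p * red (delta g)\<close>
    by (simp add: power_mult_distrib mult_ac flip: power_mult)
  also have "red g ^ (p - 2) * X ^ S = red (tilde_seq g l)"
    by (simp add: tilde_seq_def red.mult red.power X_def S_def p_def)
  finally show ?thesis by (simp add: p_def)
qed

text \<open>
  The recursion for the reductions of \<open>tilde_seq\<close> has a \<open>p\<close>-th power as a factor, which leaves the
  innermost trace; each step thus contributes one application of \<open>theta\<close>.
\<close>

lemma trace_tilde_seq:
  fixes g :: "('v::finite, 'k::{alg_closed_field, field_prime_char} witt) mpoly"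
  shows "trace (Suc l) (red (tilde_seq g (Suc l)) * h)
    = tau (red g) ((theta (red g) (red (delta g)) ^^ l) h)"
proof (induction l arbitrary: h)
  case 0
  then show ?case using red_tilde_seq_1[of g] by (simp add: tau_def)
next
  case (Suc l)
  have "red (tilde_seq g (Suc (Suc l))) * h
      = red (tilde_seq g (Suc l)) ^ CHAR('k) * (red g ^ (CHAR('k) - 2) * red (delta g) * h)"
    by (subst red_tilde_seq_Suc) (simp_all add: mult.assoc)
  then have "trace (Suc (Suc l)) (red (tilde_seq g (Suc (Suc l))) * h)
      = trace (Suc l) (red (tilde_seq g (Suc l)) * theta (red g) (red (delta g)) h)"
    by (simp only: trace_Suc_power_mult theta_def)
  then show ?case by (simp add: Suc funpow_swap1)
qed

lemma homogeneous_red_tilde_seq: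
  fixes g :: "('v::finite, 'k::{alg_closed_field, field_prime_char} witt) mpoly"
  assumes "homogeneous q D g"
  shows "homogeneous q (D * (CHAR('k) ^ Suc l - 2)) (red (tilde_seq g (Suc l)))"
proof (induction l)
  case 0
  then show ?case
    using homogeneous_power[OF homogeneous_red[OF assms], of "CHAR('k) - 2"] red_tilde_seq_1[of g]
    by (simp add: mult.commute)
next
  case (Suc l)
  have "CHAR('k) * (D * (CHAR('k) ^ Suc l - 2)) + ((CHAR('k) - 2) * D + CHAR('k) * D)
      = D * (CHAR('k) ^ Suc (Suc l) - 2)"
  proof -
    define p Q where "p = CHAR('k)" and "Q = CHAR('k) ^ Suc l"
    have "2 \<le> p" unfolding p_def by (intro prime_ge_2_nat) simp
    moreover have "2 \<le> Q" unfolding Q_def by (rule two_le_CHAR_power) simp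
    then obtain r where "Q = r + 2" by (metis add.commute le_Suc_ex)
    moreover obtain s where "p = s + 2" using \<open>2 \<le> p\<close> by (metis add.commute le_Suc_ex)
    ultimately have "p * (D * (Q - 2)) + ((p - 2) * D + p * D) = D * (p * Q - 2)"
      by (simp add: algebra_simps)
    then show ?thesis by (simp add: p_def Q_def)
  qed
  then show ?case
    using homogeneous_mult[OF homogeneous_power[OF Suc, of "CHAR('k)"]
        homogeneous_mult[OF homogeneous_power[OF homogeneous_red[OF assms], of "CHAR('k) - 2"]
          homogeneous_red_delta[OF assms]]]
      red_tilde_seq_Suc[of "Suc l" g] by simp
qed

text \<open>
  The reductions of \<open>tilde_seq g i\<close> and of its product with \<open>g\<close> are forms of degrees \<open>d * (p ^ i - 2)\<close>
  and \<open>d * (p ^ i - 1)\<close>, so that the complementary degrees for the trace pairing are \<open>d\<close> and \<open>0\<close>.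
\<close>

lemma ns_mixed_eq_iff:
  fixes g :: "('v::finite, 'k::{alg_closed_field, field_prime_char} witt) mpoly"
  assumes q: "\<And>j. q j > 0" and g: "homogeneous q (\<Sum>j\<in>UNIV. q j) g"
  defines "t \<equiv> \<lambda>l h. tau (red g) ((theta (red g) (red (delta g)) ^^ l) h)"
    and "V \<equiv> {h. homogeneous q (\<Sum>j\<in>UNIV. q j) h}"
  shows "ns_mixed_eq g (Suc m) \<longleftrightarrow>
    (\<forall>i<m. (\<exists>h\<in>V. t i h \<noteq> 0) \<and> t i (red g) = 0) \<and> (\<forall>h\<in>V. t m h = 0)"
proof -
  define d where "d = (\<Sum>j\<in>UNIV. q j)"
  have two: "2 \<le> CHAR('k) ^ Suc l" for l by (rule two_le_CHAR_power) simp
  have 1: "tilde_seq g (Suc l) \<in> frob_ideal (Suc l) \<longleftrightarrow> (\<forall>h\<in>V. t l h = 0)" for l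
  proof -
    have "d * (CHAR('k) ^ Suc l - 2) + d = d * (CHAR('k) ^ Suc l - 1)"
    proof -
      have "CHAR('k) ^ Suc l - 1 = Suc (CHAR('k) ^ Suc l - 2)" using two[of l] by linarith
      then show ?thesis by simp
    qed
    then show ?thesis
      using homogeneous_frob_ideal_iff[OF q homogeneous_red_tilde_seq[OF g, of l], of d "Suc l"]
      unfolding frob_ideal_iff by (simp add: trace_tilde_seq t_def V_def d_def del: power_Suc)
  qed
  have 2: "g * tilde_seq g (Suc l) \<in> frob_ideal (Suc l) \<longleftrightarrow> t l (red g) = 0" for l
  proof -
    have degree: "(d + d * (CHAR('k) ^ Suc l - 2)) + 0 = d * (CHAR('k) ^ Suc l - 1)"
    proof -
      have "CHAR('k) ^ Suc l - 1 = Suc (CHAR('k) ^ Suc l - 2)" using two[of l] by linarith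
      then show ?thesis by simp
    qed
    have hom: "homogeneous q (d + d * (CHAR('k) ^ Suc l - 2)) (red (g * tilde_seq g (Suc l)))"
      unfolding red.mult d_def by (intro homogeneous_mult homogeneous_red homogeneous_red_tilde_seq g)
    have trace: "trace (Suc l) (red (g * tilde_seq g (Suc l))) = t l (red g)"
      by (simp add: red.mult trace_tilde_seq t_def mult.commute[of "red g"])
    have "g * tilde_seq g (Suc l) \<in> frob_ideal (Suc l) \<longleftrightarrow>
        (\<forall>h. homogeneous q 0 h \<longrightarrow> trace (Suc l) (red (g * tilde_seq g (Suc l)) * h) = 0)"
      unfolding frob_ideal_iff
      by (rule homogeneous_frob_ideal_iff[OF q hom[unfolded d_def] degree[unfolded d_def]])
    also have "\<dots> \<longleftrightarrow> t l (red g) = 0"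
    proof
      assume "\<forall>h. homogeneous q 0 h \<longrightarrow> trace (Suc l) (red (g * tilde_seq g (Suc l)) * h) = 0"
      then show "t l (red g) = 0" using homogeneous_one[of q] trace by (metis mult_1_right)
    next
      assume t0: "t l (red g) = 0"
      show "\<forall>h. homogeneous q 0 h \<longrightarrow> trace (Suc l) (red (g * tilde_seq g (Suc l)) * h) = 0"
      proof (intro allI impI)
        fix h :: "('v, 'k) mpoly" assume "homogeneous q 0 h"
        then have "h = single 0 (lookup h 0)" using hom_part_0[of q h, OF q] by (simp add: homogeneous_iff)
        then have "red (g * tilde_seq g (Suc l)) * h = single 0 (lookup h 0) * red (g * tilde_seq g (Suc l))"
          by (metis mult.commute)
        then show "trace (Suc l) (red (g * tilde_seq g (Suc l)) * h) = 0"
          by (simp add: trace_const_mult trace t0)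
      qed
    qed
    finally show ?thesis .
  qed
  have "(\<forall>i\<in>{1..Suc m - 1}. P i) \<longleftrightarrow> (\<forall>i<m. P (Suc i))" for P
  proof
    assume "\<forall>i<m. P (Suc i)"
    then show "\<forall>i\<in>{1..Suc m - 1}. P i" by (metis atLeastAtMost_iff Suc_le_D One_nat_def Suc_le_eq diff_Suc_1)
  qed auto
  then show ?thesis unfolding ns_mixed_eq_def by (simp add: 1 2)
qed

lemma red_teichmueller_sum:
  "red (\<Sum>i\<in>UNIV. single (\<alpha> i) (teichmueller (c $ i))) = generic_poly \<alpha> c"
  for c :: "'k::field_prime_char ^ 'm::finite"
  by (simp add: generic_poly_def red.sum red_single coord_teichmueller)

lemma generic_lift_eq:
  fixes b c :: "'k::field_prime_char ^ 'm::finite"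
  shows "generic_lift \<alpha> b c = generic_lift \<alpha> b 0
    + of_nat CHAR('k) * (\<Sum>i\<in>UNIV. single (\<alpha> i) (teichmueller (c $ i)))"
proof -
  have "single (\<alpha> i) (of_nat CHAR('k) * x) = of_nat CHAR('k) * single (\<alpha> i) x" for i and x :: "'k witt"
    using mult_single[of 0 "of_nat CHAR('k)" "\<alpha> i" x] by simp
  then show ?thesis
    by (simp add: generic_lift_def teichmueller_zero single_add sum.distrib sum_distrib_left)
qed

lemma red_generic_lift: "red (generic_lift \<alpha> b c) = generic_poly \<alpha> b"
  for b c :: "'k::field_prime_char ^ 'm::finite"
proof -
  have "red (generic_lift \<alpha> b 0) = generic_poly \<alpha> b"
    using red_teichmueller_sum[of \<alpha> b] by (simp add: generic_lift_def teichmueller_zero)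
  then show ?thesis unfolding generic_lift_eq[of \<alpha> b c] by (simp add: red.add)
qed

lemma lookup_generic_poly:
  assumes "inj \<alpha>"
  shows "lookup (generic_poly \<alpha> b) (\<alpha> i) = b $ i"
proof -
  have "lookup (generic_poly \<alpha> b) (\<alpha> i) = (\<Sum>j\<in>UNIV. if j = i then b $ i else 0)"
    unfolding generic_poly_def lookup_sum lookup_single
    using assms by (intro sum.cong) (auto simp: when_def dest: injD)
  then show ?thesis by simp
qed

theorem theorem5p8:
  fixes q :: "'n::{finite, linorder} \<Rightarrow> nat"
    and d :: nat
    and \<alpha> :: "'m::finite \<Rightarrow> 'n monomial"
    and b :: "'k::{alg_closed_field, field_prime_char}^'m"
  assumes "\<And>j. q j > 0"
    and "d = (\<Sum>j\<in>UNIV. q j)"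
    and "bij_betw \<alpha> UNIV {\<mu>. weighted_degree q \<mu> = d}"
    and "b \<noteq> 0"
  shows "ns (generic_poly \<alpha> b) = (LEAST v. v \<in> {ns_mixed (generic_lift \<alpha> b c) | c. True})"
proof -
  define f where "f = generic_poly \<alpha> b"
  define \<delta> where "\<delta> = red (delta (generic_lift \<alpha> b 0))"
  have inj: "inj \<alpha>" using assms(3) by (simp add: bij_betw_def)
  have deg: "weighted_degree q (\<alpha> i) = d" for i using assms(3) by (auto simp: bij_betw_def)
  have hom_poly: "homogeneous q (sum q UNIV) (generic_poly \<alpha> c)" for c :: "'k ^ 'm"
    unfolding generic_poly_def by (intro homogeneous_sum homogeneous_single) (simp add: deg assms(2))
  have hom_lift: "homogeneous q (sum q UNIV) (generic_lift \<alpha> b c)" for c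
    unfolding generic_lift_def by (intro homogeneous_sum homogeneous_single) (simp add: deg assms(2))
  have f0: "f \<noteq> 0"
  proof
    assume "f = 0"
    then have "b $ i = 0" for i using lookup_generic_poly[OF inj, of b i] by (simp add: f_def)
    then show False using assms(4) by (simp add: vec_eq_iff)
  qed
  interpret middle_degree q f \<delta>
    by unfold_locales
      (use assms(1) f0 hom_poly homogeneous_red_delta[OF hom_lift] in \<open>simp_all add: f_def \<delta>_def\<close>)
  have red_f: "red (generic_lift \<alpha> b c) = f" for c by (simp add: f_def red_generic_lift)
  have delta: "red (delta (generic_lift \<alpha> b c)) = \<delta> - generic_poly \<alpha> c ^ CHAR('k)" for c
    unfolding generic_lift_eq[of \<alpha> b c] red_delta_add_p_mult red_teichmueller_sum \<delta>_def ..
  define X where "X = {n. n \<ge> 1 \<and> \<not> quasi_F_split n f}"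
  have X_iff: "Suc m \<in> X \<longleftrightarrow> (\<forall>h\<in>J m. tau f h = 0)" for m
    using quasi_F_split_iff_chain[OF f0 red_f[of 0], of m] chain_iff_J[of m] tau_J_dichotomy[of m]
    by (auto simp: X_def \<delta>_def)
  have ns: "ns f = Inf (enat ` X)"
    unfolding ns_def X_def by (rule arg_cong[of _ _ Inf]) auto
  have mixed: "ns_mixed_eq (generic_lift \<alpha> b c) (Suc m) \<longleftrightarrow>
      (\<forall>i<m. (\<exists>h. homogeneous q (sum q UNIV) h \<and> tau f ((twist (generic_poly \<alpha> c) ^^ i) h) \<noteq> 0) \<and>
         tau f ((twist (generic_poly \<alpha> c) ^^ i) f) = 0) \<and>
      (\<forall>h. homogeneous q (sum q UNIV) h \<longrightarrow> tau f ((twist (generic_poly \<alpha> c) ^^ m) h) = 0)" for c m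
    unfolding ns_mixed_eq_iff[OF assms(1) hom_lift] red_f delta by blast
  have ns_mixed_eqI: "ns_mixed g = enat n" if "ns_mixed_eq g n" for g :: "('n, 'k witt) mpoly" and n
    using that ns_mixed_eq_unique[of g] by (auto simp: ns_mixed_def intro!: the_equality)
  have lower: "ns f \<le> ns_mixed (generic_lift \<alpha> b c)" for c
  proof (cases "\<exists>n. ns_mixed_eq (generic_lift \<alpha> b c) n")
    case True
    then obtain n where n: "ns_mixed_eq (generic_lift \<alpha> b c) n" by blast
    then obtain m where m: "n = Suc m" by (cases n) (auto simp: ns_mixed_eq_def)
    have top: "tau f ((twist (generic_poly \<alpha> c) ^^ m) h) = 0" if "homogeneous q (sum q UNIV) h" for h
      using n that unfolding m mixed by blast
    have f_orbit: "tau f ((twist (generic_poly \<alpha> c) ^^ e) f) = 0" if "e < m" for e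
      using n that unfolding m mixed by blast
    have "\<forall>h\<in>J m. tau f h = 0"
      using tau_J_eq_0_of_twist[OF top f_orbit] by blast
    then have "n \<in> X" unfolding m X_iff .
    then show ?thesis unfolding ns ns_mixed_eqI[OF n] by (intro Inf_lower) auto
  qed (simp add: ns_mixed_def)
  have "\<exists>c. ns_mixed (generic_lift \<alpha> b c) \<le> ns f"
  proof (cases "X = {}")
    case True
    then show ?thesis unfolding ns by (simp add: top_enat_def)
  next
    case False
    define n where "n = (LEAST n. n \<in> X)"
    obtain k where "k \<in> X" using False by blast
    then have n: "n \<in> X" unfolding n_def by (rule LeastI[of "\<lambda>n. n \<in> X"])
    have n_le: "n \<le> n'" if "n' \<in> X" for n'
      unfolding n_def using that by (rule Least_le[of "\<lambda>n. n \<in> X"])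
    obtain N where N: "n = Suc N" using n by (cases n) (auto simp: X_def)
    have "\<exists>h\<in>J i. tau f h = 1" if "i < N" for i
    proof -
      have "Suc i \<notin> X" using n_le[of "Suc i"] that N by auto
      then show ?thesis using tau_J_dichotomy[of i] by (auto simp: X_iff)
    qed
    then obtain g where g: "homogeneous q (sum q UNIV) g"
      and top: "\<And>h. homogeneous q (sum q UNIV) h \<Longrightarrow> tau f ((twist g ^^ N) h) = 0"
      and f_orbit: "\<And>e. tau f ((twist g ^^ e) f) = 0 \<or> N = 0"
      using exists_twist[of N] n unfolding N X_iff by blast
    define c where "c = (\<chi> i. lookup g (\<alpha> i))"
    have c: "generic_poly \<alpha> c = g"
    proof (rule poly_mapping_eqI)
      fix \<mu>
      show "lookup (generic_poly \<alpha> c) \<mu> = lookup g \<mu>"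
      proof (cases "weighted_degree q \<mu> = d")
        case True
        then obtain i where "\<mu> = \<alpha> i" using assms(3) by (auto simp: bij_betw_def)
        then show ?thesis by (simp add: lookup_generic_poly[OF inj] c_def)
      next
        case False
        then show ?thesis
          using g hom_poly[of c] by (simp add: homogeneous_def assms(2)) metis
      qed
    qed
    \<comment> \<open>The condition at \<open>N\<close> may hold earlier for this lift; its index is the first place where it
      does, and the lower bound rules out that this is smaller than \<open>n\<close>.\<close>
    define P where "P m \<longleftrightarrow> (\<forall>h. homogeneous q (sum q UNIV) h \<longrightarrow> tau f ((twist g ^^ m) h) = 0)" for m
    define M where "M = (LEAST m. P m)"
    have "P N" using top by (simp add: P_def)
    then have M: "P M" "M \<le> N" unfolding M_def by (rule LeastI[of P], rule Least_le[of P])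
    have "\<not> P i" if "i < M" for i using that unfolding M_def by (rule not_less_Least[of _ P])
    then have "ns_mixed_eq (generic_lift \<alpha> b c) (Suc M)"
      unfolding mixed c using M f_orbit unfolding P_def by fastforce
    then have "ns_mixed (generic_lift \<alpha> b c) = enat (Suc M)" by (rule ns_mixed_eqI)
    also have "\<dots> \<le> enat n" using M(2) N by simp
    also have "enat n \<le> ns f" unfolding ns by (rule Inf_greatest) (auto simp: n_le)
    finally show ?thesis by blast
  qed
  then obtain c where "ns f = ns_mixed (generic_lift \<alpha> b c)"
    using lower by (metis order_antisym)
  then have "ns f \<in> {ns_mixed (generic_lift \<alpha> b c) | c. True}" by blast
  then have "(LEAST v. v \<in> {ns_mixed (generic_lift \<alpha> b c) | c. True}) = ns f"
    by (rule Least_equality) (auto intro: lower)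
  then show ?thesis by (simp add: f_def)
qed

end
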